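(* Take for $X\to B$ the universal family over $B=\mathcal M_{0,n}'$, the enhanced moduli space of compact Riemann surfaces of genus $0$ with $n$ distinct points $s_0,s_1,\dots,s_{n-1}$ and a (non-zero) tangent vector at $s_0$. Let $\mathbf S^{\mathrm{eff}}{}'$, $\mathbf S^{\mathrm{eff}}_{\mathrm{tree}}{}'$ and $\mathbf G'$ be the restrictions to the twistor line $\{(1-u,u)\}\subset\mathbb C^2$ of the effective action, its tree part and the Hodge correlator class (see context). Then $$\mathbf S^{\mathrm{eff}}{}'|_{u=0}=\mathbf S^{\mathrm{eff}}_{\mathrm{tree}}{}'|_{u=0}=\mathbf G'|_{u=0},\qquad \mathbf S^{\mathrm{eff}}{}'|_{u=1}=\mathbf S^{\mathrm{eff}}_{\mathrm{tree}}{}'|_{u=1}=\mathbf G'|_{u=1}.$$ In particular, for $\mathcal M_{0,4}'\simeq\mathbb P^1(\mathbb C)\setminus\{0,1,\infty\}$ (together with the tangent vector at $s_0$), $$\mathbf S^{\mathrm{eff}}{}'|_{u=1}=\mathbf S^{\mathrm{eff}}_{\mathrm{tree}}{}'|_{u=1}=\mathbf G'|_{u=1}=-(\mathrm{Id}\otimes\mathrm{ad})\,\omega^{\mathrm{KZ}},\qquad \mathbf S^{\mathrm{eff}}{}'|_{u=0}=\mathbf S^{\mathrm{eff}}_{\mathrm{tree}}{}'|_{u=0}=\mathbf G'|_{u=0}=-(\mathrm{Id}\otimes\mathrm{ad})\,\overline{\omega}^{\mathrm{KZ}},$$ where $\omega^{\mathrm{KZ}}$ is the formal KZ connection 1-form,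 and $(\mathrm{Id}\otimes\mathrm{ad})\omega^{\mathrm{KZ}}$ takes values in the special derivation algebra of the free Lie algebra in two variables. Equalities between $\mathbf G'$ and $\mathbf S^{\mathrm{eff}}{}'$ are understood through the identification $W\mapsto\sum_T(T,W;\mathrm{Or}_T)$ of cyclic words with sums of trees described in the context.
   Context: **Setting.** $S^\ast=\{s_1,\dots,s_{n-1}\}$, and $v$ is the tautological tangent vector at $s_0$. Since fibres have genus 0, $H^1=0$ and all decorations are by $S^\ast$. Graphs are finite; univalent vertices are external, others internal; $V^{\mathrm{int}}_\Gamma,E_\Gamma$ are the sets of internal vertices and edges; uni-trivalent means valencies 1 or 3; $l(\Gamma)$ is the first Betti number; an orientation $\mathrm{Or}_\Gamma$ is one of $\pm E_1\wedge\dots\wedge E_m$. Graphs with external vertices decorated by $\mathbb C[S^\ast]$ are taken modulo multilinearity and sign under orientation reversal, and are zero if they have a self-loop, a multiple edge, an internal vertex adjacent to two equally labelled external vertices, or are a single edge with equal labels. $\Gamma^\vee$ is $\Gamma$ with dual decorations ($S^\ast$ orthonormal); $[\Gamma^\vee]$ is its class modulo IHX. $\langle\Gamma_1,\Gamma_2\rangle=\delta_{\Gamma_1,\Gamma_2^\vee}|\mathrm{Aut}(\Gamma_1)|$, with $\mathrm{Aut}$ the permutations of half-edges preserving edges, vertices, decorations. **Green current and $Z$.** $G$ is the 0-current on $X\times_BX$ with $\bar\partial\partial G=\delta_\Delta-\delta_{S_{s_0}}$ ($\Delta$ the relative diagonal, $S_{s_0}$ the divisor with fibre $\{s_0(b)\}\times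 X_b\cup X_b\times\{s_0(b)\}$), normalized by $\lim_{x\to s_0(b)}(G(x,y)+\frac1{\pi\sqrt{-1}}\log|t(x)|)=0$ for a fibre coordinate $t$ with $dt(v)=1$. On $\mathbb C^2\ni(z,w)$, $\mathsf D^{\mathbb C}G=((w\partial-z\bar\partial)+(z\,dw-w\,dz))G$, which on the twistor line $(z,w)=(1-u,u)$ is $(u\partial-(1-u)\bar\partial+du)G$. For a single edge with labels $s\ne t$, $Z=(s,t)^\ast\mathsf D^{\mathbb C}G$ (and $0$ if $s=t$); for $|E_\Gamma|\ge2$, $Z_\Gamma=0$ if there is a self-loop, otherwise $Z_\Gamma$ is the fibre integral over configurations $(x_v)_{v\in V^{\mathrm{int}}_\Gamma}$ of distinct points of $X_b$, distinct from $s_0(b)$ and the labels, of $\bigwedge_E\omega_E$ (ordered by $\mathrm{Or}_\Gamma$), $\omega_E=\mathsf D^{\mathbb C}G(x_i,x_j)$ or $\mathsf D^{\mathbb C}G(x_i,s)$ for $E$ internal or external labelled $s$. **Effective action and $\mathbf G$.** $\mathbf S^{\mathrm{eff}}=\sum_{l(\Gamma)=0}\frac1{|\mathrm{Aut}(\Gamma)|}Z_\Gamma[\Gamma^\vee]\otimes\mathbb R(-1)+\hbar\sum_{l(\Gamma)=1}\frac1{|\mathrm{Aut}(\Gamma)|}Z_\Gamma[\Gamma^\vee]$, over connected uni-trivalent graphs without self-loops decorated in all ways (up to isomorphism) by $S^\ast$; $\mathbf S^{\mathrm{eff}}_{\mathrm{tree}}=\mathbf S^{\mathrm{eff}}|_{\hbar=0}$;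 $\mathbb R(-1)$ is the Tate twist. $\mathbf G=\sum_W\sum_T\frac1{|\mathrm{Aut}(W)|}Z_{(T,W;\mathrm{Or}_T)}W^\vee(-1)$, over cyclic words $W$ in $S^\ast$ and planar uni-trivalent trees $T$ in a disk with boundary vertices labelled counterclockwise by $W$, with canonical orientation $\mathrm{Or}_T$ (edges ordered by first encounter along the oriented boundary of a small neighbourhood of $T$, starting at an external edge), $W^\vee$ the dual cyclic word (in letters $X_s$) with $W^\vee(W)=|\mathrm{Aut}(W)|$. $\mathbf S^{\mathrm{eff}}_{\mathrm{tree}}$ is identified with a series of cyclic words by evaluating it, via $\langle-,-\rangle$, on $F(W)=\sum_T(T,W;\mathrm{Or}_T)$. **Derivations and KZ.** For $\mathcal M'_{0,4}$ one takes $s_0=z\in\mathbb P^1\setminus\{0,1,\infty\}$ and $S^\ast=\{0,1,\infty\}$, with letters $X_0,X_1,X_\infty$ subject to $X_\infty=-X_0-X_1$. A cyclic Lie element $F$ is regarded as the special derivation $X_s\mapsto[X_s,\partial F/\partial X_s]$, $X_{s_0}\mapsto0$, where for a cyclic word $\partial/\partial X_s$ sums, over occurrences of $X_s$, the word obtained by deleting that occurrence and reading cyclically from the next letter. $\omega^{\mathrm{KZ}}=\frac1{2\pi\sqrt{-1}}\big(\frac{dz}{z}\otimes X_0+\frac{dz}{z-1}\otimes X_1\big)$ and $\overline\omega^{\mathrm{KZ}}$ is its complex conjugate. $\mathrm{ad}(X)$ is the derivation $Y\mapsto[Y,X]$. *)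

theory Defs
  imports "HOL-Analysis.Analysis" "HOL-Combinatorics.Combinatorics" "HOL-Library.Disjoint_Sets"
begin

section \<open>Genus zero curves and the enhanced moduli space\<close>

text \<open>The projective line, with its two affine charts: \<open>chart False\<close> is the coordinate
  \<open>x\<close> and \<open>chart True\<close> the coordinate \<open>1/x\<close>. By uniformization every compact Riemann surface
  of genus 0 is isomorphic to it.\<close>

datatype P1 = Aff complex | Infty

definition chart :: "bool \<Rightarrow> complex \<Rightarrow> P1" where
  "chart k x = (if k then (if x = 0 then Infty else Aff (1 / x)) else Aff x)"

definition coord :: "bool \<Rightarrow> P1 \<Rightarrow> complex" where
  "coord k p = (THE x. chart k x = p)"

fun mob :: "complex \<Rightarrow> complex \<Rightarrow> complex \<Rightarrow> complex \<Rightarrow> P1 \<Rightarrow> P1" where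
  "mob a b c d (Aff x) = (if c * x + d = 0 then Infty else Aff (moebius a b c d x))"
| "mob a b c d Infty = (if c = 0 then Infty else Aff (a / c))"

definition holo :: "(complex^('b::finite)) set \<Rightarrow> (complex^'b \<Rightarrow> complex) \<Rightarrow> bool" where
  "holo U f \<longleftrightarrow> (\<forall>b\<in>U. \<exists>f'. (f has_derivative f') (at b) \<and> (\<forall>c v. f' (c *s v) = c * f' v))"

definition holo_P1 :: "(complex^('b::finite)) set \<Rightarrow> (complex^'b \<Rightarrow> P1) \<Rightarrow> bool" where
  "holo_P1 U f \<longleftrightarrow>
     (\<forall>b\<in>U. \<exists>k V h. open V \<and> b \<in> V \<and> V \<subseteq> U \<and> holo V h \<and> (\<forall>c\<in>V. f c = chart k (h c)))"

text \<open>A family of pointed projective lines over an open subset \<open>base\<close> of a complex vector space,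
  with total space \<open>base \<times> P1\<close>. The trivialization is chosen such that the section \<open>s\<^sub>0\<close> stays in
  the affine line; the tangent vector at \<open>s\<^sub>0(b)\<close> is \<open>tvec b\<close> times \<open>d/dx\<close>. The
  remaining points are \<open>mark s\<close>, for the labels \<open>s\<close> in \<open>{1..n-1}\<close>.\<close>

record ('b::finite) family =
  base :: "(complex^'b) set"
  sec0 :: "complex^'b \<Rightarrow> complex"
  tvec :: "complex^'b \<Rightarrow> complex"
  mark :: "nat \<Rightarrow> complex^'b \<Rightarrow> P1"

definition labels :: "nat \<Rightarrow> nat set" where
  "labels n = {1..n-1}"

definition pointed_line :: "nat \<Rightarrow> complex \<Rightarrow> complex \<Rightarrow> (nat \<Rightarrow> P1) \<Rightarrow> bool" where
  "pointed_line n z v q \<longleftrightarrow>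
     v \<noteq> 0 \<and> inj_on q (labels n) \<and> (\<forall>s\<in>labels n. q s \<noteq> Aff z)"

definition pointed_family :: "nat \<Rightarrow> ('b::finite) family \<Rightarrow> bool" where
  "pointed_family n X \<longleftrightarrow>
     open (base X) \<and> holo (base X) (sec0 X) \<and> holo (base X) (tvec X) \<and>
     (\<forall>s\<in>labels n. holo_P1 (base X) (mark X s)) \<and>
     (\<forall>b\<in>base X. pointed_line n (sec0 X b) (tvec X b) (\<lambda>s. mark X s b))"

definition pointed_iso ::
  "nat \<Rightarrow> complex \<Rightarrow> complex \<Rightarrow> (nat \<Rightarrow> P1) \<Rightarrow> complex \<Rightarrow> complex \<Rightarrow> (nat \<Rightarrow> P1) \<Rightarrow> bool" where
  "pointed_iso n z v q z' v' q' \<longleftrightarrow>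
     (\<exists>a b c d. a * d - b * c \<noteq> 0 \<and> mob a b c d (Aff z) = Aff z' \<and>
        (a * d - b * c) / (c * z + d)^2 * v = v' \<and>
        (\<forall>s\<in>labels n. mob a b c d (q s) = q' s))"

text \<open>For \<open>n \<ge> 3\<close> the pointed lines have no automorphisms, and a holomorphic family in which every
  isomorphism class occurs exactly once identifies its base biholomorphically with the enhanced
  moduli space and is the universal family over it. Such families exist, because the universal
  family has a holomorphic trivialization of the above kind and the moduli space is isomorphic to
  an open subset of \<open>n - 2\<close> dimensional complex space. Points with \<open>s\<^sub>0\<close> at infinity
  need not be considered, being isomorphic to others.\<close>

definition universal_family :: "nat \<Rightarrow> ('b::finite) family \<Rightarrow> bool" where
  "universal_family n X \<longleftrightarrow>
     pointed_family n X \<and>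
     (\<forall>z v q. pointed_line n z v q \<longrightarrow>
        (\<exists>!b. b \<in> base X \<and> pointed_iso n (sec0 X b) (tvec X b) (\<lambda>s. mark X s b) z v q))"

section \<open>The Green current\<close>

primrec Ck_on :: "nat \<Rightarrow> 'a::real_normed_vector set \<Rightarrow> ('a \<Rightarrow> complex) \<Rightarrow> bool" where
  "Ck_on 0 S f = continuous_on S f"
| "Ck_on (Suc k) S f = ((\<forall>x\<in>S. f differentiable (at x)) \<and>
     (\<forall>v. Ck_on k S (\<lambda>x. frechet_derivative f (at x) v)))"

text \<open>To be used for open \<open>S\<close> only.\<close>
definition smooth_on :: "'a::real_normed_vector set \<Rightarrow> ('a \<Rightarrow> complex) \<Rightarrow> bool" where
  "smooth_on S f \<longleftrightarrow> (\<forall>k. Ck_on k S f)"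

text \<open>Wirtinger derivatives at 0. If \<open>\<gamma> c = f (p + c v)\<close>, they are the values
  on the tangent vector \<open>v\<close> at \<open>p\<close> of the (1,0) part and of the (0,1) part of \<open>df\<close>.\<close>

definition wirt :: "(complex \<Rightarrow> complex) \<Rightarrow> complex" where
  "wirt \<gamma> = (vector_derivative (\<lambda>t::real. \<gamma> (of_real t)) (at 0)
             - \<i> * vector_derivative (\<lambda>t::real. \<gamma> (\<i> * of_real t)) (at 0)) / 2"

definition wirtbar :: "(complex \<Rightarrow> complex) \<Rightarrow> complex" where
  "wirtbar \<gamma> = (vector_derivative (\<lambda>t::real. \<gamma> (of_real t)) (at 0)
             + \<i> * vector_derivative (\<lambda>t::real. \<gamma> (\<i> * of_real t)) (at 0)) / 2"

text \<open>Points and tangent vectors of the fibre square of the total space over the base, in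
  a product of two affine charts.\<close>
type_synonym 'b sq = "(complex^'b) \<times> complex \<times> complex"

definition shift :: "('b::finite) sq \<Rightarrow> complex \<Rightarrow> 'b sq \<Rightarrow> 'b sq" where
  "shift P c v = (case (P, v) of ((b, x, y), (\<beta>, \<xi>, \<eta>)) \<Rightarrow> (b + c *s \<beta>, x + c * \<xi>, y + c * \<eta>))"

text \<open>The value of the 2-form obtained by applying first \<open>\<partial>\<close> and then its conjugate to the
  function \<open>\<phi>\<close> on the pair of tangent vectors \<open>p\<close>, \<open>q\<close> at \<open>P\<close>.\<close>
definition ddbar :: "(('b::finite) sq \<Rightarrow> complex) \<Rightarrow> 'b sq \<Rightarrow> 'b sq \<Rightarrow> 'b sq \<Rightarrow> complex" where
  "ddbar \<phi> P p q =
     wirtbar (\<lambda>c. wirt (\<lambda>e. \<phi> (shift (shift P c p) e q)))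
   - wirtbar (\<lambda>c. wirt (\<lambda>e. \<phi> (shift (shift P c q) e p)))"

text \<open>A (1,1)-current is treated as a 2-form with distribution coefficients: contracted with two
  constant vector fields \<open>p\<close>, \<open>q\<close> it is a distribution, to be evaluated on a test function
  \<open>\<phi>\<close>. The current of integration over the graph \<open>x = h(b,y)\<close> with \<open>(b,y)\<in>D\<close> is
  \<open>(\<i>/2) \<theta> \<and> cnj \<theta>\<close> times the delta function along the graph,
  where \<open>\<theta> = d(x - h)\<close> and \<open>h\<close> is holomorphic.\<close>

definition graph_current ::
  "((complex^('b::finite)) \<times> complex) set \<Rightarrow> ((complex^'b) \<times> complex \<Rightarrow> complex) \<Rightarrow>
   ('b sq \<Rightarrow> complex) \<Rightarrow> 'b sq \<Rightarrow> 'b sq \<Rightarrow> complex" where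
  "graph_current D h \<phi> p q =
     (LINT w:D|lborel. case w of (b, y) \<Rightarrow>
        (let \<theta> = (\<lambda>(\<beta>, \<xi>, \<eta>). \<xi> - wirt (\<lambda>c. h (b + c *s \<beta>, y + c * \<eta>)))
         in \<phi> (b, h (b, y), y) * (\<i> / 2) * (\<theta> p * cnj (\<theta> q) - \<theta> q * cnj (\<theta> p))))"

definition swap_sq :: "('b::finite) sq \<Rightarrow> 'b sq" where
  "swap_sq P = (case P of (b, x, y) \<Rightarrow> (b, y, x))"

text \<open>The relative diagonal, and the two components of the divisor of \<open>s\<^sub>0\<close>, in the product
  of the charts \<open>k1\<close> and \<open>k2\<close>.\<close>

definition delta_diag ::
  "('b::finite) family \<Rightarrow> bool \<Rightarrow> bool \<Rightarrow> ('b sq \<Rightarrow> complex) \<Rightarrow> 'b sq \<Rightarrow> 'b sq \<Rightarrow> complex" where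
  "delta_diag X k1 k2 =
     graph_current {(b, y). b \<in> base X \<and> chart k2 y \<in> range (chart k1)}
       (\<lambda>(b, y). coord k1 (chart k2 y))"

definition delta_sec1 ::
  "('b::finite) family \<Rightarrow> bool \<Rightarrow> ('b sq \<Rightarrow> complex) \<Rightarrow> 'b sq \<Rightarrow> 'b sq \<Rightarrow> complex" where
  "delta_sec1 X k =
     graph_current {(b, y). b \<in> base X \<and> Aff (sec0 X b) \<in> range (chart k)}
       (\<lambda>(b, y). coord k (Aff (sec0 X b)))"

definition delta_sec2 ::
  "('b::finite) family \<Rightarrow> bool \<Rightarrow> ('b sq \<Rightarrow> complex) \<Rightarrow> 'b sq \<Rightarrow> 'b sq \<Rightarrow> complex" where
  "delta_sec2 X k \<phi> p q = delta_sec1 X k (\<phi> \<circ> swap_sq) (swap_sq p) (swap_sq q)"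

definition test_function :: "('b::finite) family \<Rightarrow> ('b sq \<Rightarrow> complex) \<Rightarrow> bool" where
  "test_function X \<phi> \<longleftrightarrow>
     smooth_on UNIV \<phi> \<and> (\<exists>K. compact K \<and> K \<subseteq> base X \<times> UNIV \<and> (\<forall>P. P \<notin> K \<longrightarrow> \<phi> P = 0))"

type_synonym 'b green = "complex^'b \<Rightarrow> P1 \<Rightarrow> P1 \<Rightarrow> complex"

definition in_charts :: "('b::finite) green \<Rightarrow> bool \<Rightarrow> bool \<Rightarrow> 'b sq \<Rightarrow> complex" where
  "in_charts G k1 k2 P = (case P of (b, x, y) \<Rightarrow> G b (chart k1 x) (chart k2 y))"

definition off_divisors :: "('b::finite) family \<Rightarrow> bool \<Rightarrow> bool \<Rightarrow> 'b sq set" where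
  "off_divisors X k1 k2 =
     {(b, x, y). b \<in> base X \<and> chart k1 x \<noteq> chart k2 y \<and>
        chart k1 x \<noteq> Aff (sec0 X b) \<and> chart k2 y \<noteq> Aff (sec0 X b)}"

text \<open>The Green current: a locally integrable function, the representative being the one that is
  smooth where the current is, i.e.\ away from the divisors; the current equation is imposed on all
  products of charts. The values of \<open>G\<close> on the divisors are irrelevant.\<close>

definition green_current :: "('b::finite) family \<Rightarrow> 'b green \<Rightarrow> bool" where
  "green_current X G \<longleftrightarrow>
     (\<forall>k1 k2. smooth_on (off_divisors X k1 k2) (in_charts G k1 k2)) \<and>
     (\<forall>k1 k2 K. compact K \<and> K \<subseteq> base X \<times> UNIV \<longrightarrow>
        set_integrable lborel K (in_charts G k1 k2)) \<and>
     (\<forall>k1 k2 \<phi> p q. test_function X \<phi> \<longrightarrow>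
        (LINT P|lborel. in_charts G k1 k2 P * ddbar \<phi> P p q) =
          delta_diag X k1 k2 \<phi> p q - (delta_sec1 X k1 \<phi> p q + delta_sec2 X k2 \<phi> p q)) \<and>
     (\<forall>b\<in>base X. \<forall>y. y \<noteq> Aff (sec0 X b) \<longrightarrow>
        (\<forall>t U. open U \<and> sec0 X b \<in> U \<and> t holomorphic_on U \<and> t (sec0 X b) = 0 \<and>
           deriv t (sec0 X b) * tvec X b = 1 \<longrightarrow>
           ((\<lambda>x. G b (Aff x) y + 1 / (of_real pi * \<i>) * of_real (ln (norm (t x)))) \<longlongrightarrow> 0)
             (at (sec0 X b))))"

section \<open>Decorated graphs\<close>

text \<open>A graph is given by its half-edges; edges are two-element sets and vertices are nonempty sets
  of half-edges. Only external vertices carry a label; the function \<open>deco\<close> is normalized to 0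
  elsewhere, so that equal graphs have equal representations.

  The decorations are basis elements of \<open>\<complex>[S\<^sup>*]\<close>: modulo multilinearity these span. As the
  labels are orthonormal, a graph and its dual are represented by the same data.\<close>

record graph =
  hes :: "nat set"
  edges :: "nat set set"
  verts :: "nat set set"
  deco :: "nat set \<Rightarrow> nat"

definition ext_verts :: "graph \<Rightarrow> nat set set" where
  "ext_verts \<Gamma> = {v \<in> verts \<Gamma>. card v = 1}"

definition int_verts :: "graph \<Rightarrow> nat set set" where
  "int_verts \<Gamma> = {v \<in> verts \<Gamma>. card v \<noteq> 1}"

definition is_graph :: "nat \<Rightarrow> graph \<Rightarrow> bool" where
  "is_graph n \<Gamma> \<longleftrightarrow>
     finite (hes \<Gamma>) \<and> partition_on (hes \<Gamma>) (edges \<Gamma>) \<and> partition_on (hes \<Gamma>) (verts \<Gamma>) \<and>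
     (\<forall>E\<in>edges \<Gamma>. card E = 2) \<and>
     (\<forall>v\<in>ext_verts \<Gamma>. deco \<Gamma> v \<in> labels n) \<and> (\<forall>v. v \<notin> ext_verts \<Gamma> \<longrightarrow> deco \<Gamma> v = 0)"

definition uni_trivalent :: "graph \<Rightarrow> bool" where
  "uni_trivalent \<Gamma> \<longleftrightarrow> (\<forall>v\<in>verts \<Gamma>. card v = 1 \<or> card v = 3)"

definition vertex_of :: "graph \<Rightarrow> nat \<Rightarrow> nat set" where
  "vertex_of \<Gamma> h = (THE v. v \<in> verts \<Gamma> \<and> h \<in> v)"

definition components :: "graph \<Rightarrow> nat set set" where
  "components \<Gamma> = hes \<Gamma> // {(h, k). \<exists>A \<in> edges \<Gamma> \<union> verts \<Gamma>. h \<in> A \<and> k \<in> A}\<^sup>+"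

definition connected_graph :: "graph \<Rightarrow> bool" where
  "connected_graph \<Gamma> \<longleftrightarrow> card (components \<Gamma>) = 1"

definition betti1 :: "graph \<Rightarrow> int" where
  "betti1 \<Gamma> = int (card (edges \<Gamma>)) - int (card (verts \<Gamma>)) + int (card (components \<Gamma>))"

definition self_loop :: "graph \<Rightarrow> bool" where
  "self_loop \<Gamma> \<longleftrightarrow> (\<exists>E\<in>edges \<Gamma>. \<exists>v\<in>verts \<Gamma>. E \<subseteq> v)"

definition multiple_edge :: "graph \<Rightarrow> bool" where
  "multiple_edge \<Gamma> \<longleftrightarrow>
     (\<exists>E\<in>edges \<Gamma>. \<exists>E'\<in>edges \<Gamma>. E \<noteq> E' \<and> vertex_of \<Gamma> ` E = vertex_of \<Gamma> ` E')"

definition adjacent :: "graph \<Rightarrow> nat set \<Rightarrow> nat set \<Rightarrow> bool" where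
  "adjacent \<Gamma> v w \<longleftrightarrow> (\<exists>h\<in>v. \<exists>k\<in>w. h \<noteq> k \<and> {h, k} \<in> edges \<Gamma>)"

definition zero_graph :: "graph \<Rightarrow> bool" where
  "zero_graph \<Gamma> \<longleftrightarrow>
     self_loop \<Gamma> \<or> multiple_edge \<Gamma> \<or>
     (\<exists>v\<in>int_verts \<Gamma>. \<exists>w\<in>ext_verts \<Gamma>. \<exists>w'\<in>ext_verts \<Gamma>. w \<noteq> w' \<and> deco \<Gamma> w = deco \<Gamma> w' \<and>
        adjacent \<Gamma> v w \<and> adjacent \<Gamma> v w') \<or>
     (card (edges \<Gamma>) = 1 \<and> (\<exists>w\<in>ext_verts \<Gamma>. \<exists>w'\<in>ext_verts \<Gamma>. w \<noteq> w' \<and> deco \<Gamma> w = deco \<Gamma> w'))"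

text \<open>An orientation \<open>\<plusminus> E\<^sub>1 \<and> \<dots> \<and> E\<^sub>m\<close> is a sign together with an enumeration of the edges.\<close>

type_synonym orient = "int \<times> nat set list"
type_synonym ograph = "graph \<times> orient"

definition is_orient :: "graph \<Rightarrow> orient \<Rightarrow> bool" where
  "is_orient \<Gamma> r \<longleftrightarrow> fst r \<in> {1, -1} \<and> distinct (snd r) \<and> set (snd r) = edges \<Gamma>"

definition reorder_sign :: "'a list \<Rightarrow> 'a list \<Rightarrow> int" where
  "reorder_sign xs ys =
     sign (THE p. p permutes {..<length xs} \<and> map (\<lambda>i. xs ! p i) [0..<length xs] = ys)"

definition is_iso :: "(nat \<Rightarrow> nat) \<Rightarrow> graph \<Rightarrow> graph \<Rightarrow> bool" where
  "is_iso \<pi> \<Gamma> \<Gamma>' \<longleftrightarrow>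
     bij_betw \<pi> (hes \<Gamma>) (hes \<Gamma>') \<and> (`) \<pi> ` edges \<Gamma> = edges \<Gamma>' \<and> (`) \<pi> ` verts \<Gamma> = verts \<Gamma>' \<and>
     (\<forall>v\<in>ext_verts \<Gamma>. deco \<Gamma>' (\<pi> ` v) = deco \<Gamma> v)"

definition iso_sign :: "(nat \<Rightarrow> nat) \<Rightarrow> orient \<Rightarrow> orient \<Rightarrow> int" where
  "iso_sign \<pi> r r' = fst r * fst r' * reorder_sign (map ((`) \<pi>) (snd r)) (snd r')"

definition Aut :: "graph \<Rightarrow> (nat \<Rightarrow> nat) set" where
  "Aut \<Gamma> = {\<pi>. \<pi> permutes hes \<Gamma> \<and> is_iso \<pi> \<Gamma> \<Gamma>}"

definition ographs :: "nat \<Rightarrow> ograph set" where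
  "ographs n = {(\<Gamma>, r). is_graph n \<Gamma> \<and> connected_graph \<Gamma> \<and> uni_trivalent \<Gamma> \<and> is_orient \<Gamma> r}"

text \<open>Formal complex combinations of oriented graphs, and the span of the relations: independence
  of the representing half-edges, sign change under reversal of the orientation, vanishing of the
  graphs above, and IHX. In the IHX relation the three graphs have the same half-edges and edges,
  hence the same orientation, and with orientations by edges all three signs are equal.\<close>

definition single :: "ograph \<Rightarrow> ograph \<Rightarrow> complex" where
  "single g = (\<lambda>x. if x = g then 1 else 0)"

definition iso_rels :: "nat \<Rightarrow> (ograph \<Rightarrow> complex) set" where
  "iso_rels n =
     {(\<lambda>x. single (\<Gamma>, r) x - of_int (iso_sign \<pi> r r') * single (\<Gamma>', r') x) | \<Gamma> r \<Gamma>' r' \<pi>.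
        (\<Gamma>, r) \<in> ographs n \<and> (\<Gamma>', r') \<in> ographs n \<and> is_iso \<pi> \<Gamma> \<Gamma>'}"

definition zero_rels :: "nat \<Rightarrow> (ograph \<Rightarrow> complex) set" where
  "zero_rels n = {single (\<Gamma>, r) | \<Gamma> r. (\<Gamma>, r) \<in> ographs n \<and> zero_graph \<Gamma>}"

definition IHX_rels :: "nat \<Rightarrow> (ograph \<Rightarrow> complex) set" where
  "IHX_rels n =
     {(\<lambda>x. single (\<Gamma>, r) x
         + single (\<Gamma>\<lparr>verts := V \<union> {{h, a, c}, {k, b, d}}\<rparr>, r) x
         + single (\<Gamma>\<lparr>verts := V \<union> {{h, a, d}, {k, b, c}}\<rparr>, r) x) | \<Gamma> r V h k a b c d.
        (\<Gamma>, r) \<in> ographs n \<and> distinct [h, k, a, b, c, d] \<and> {h, k} \<in> edges \<Gamma> \<and>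
        {h, a, b} \<in> verts \<Gamma> \<and> {k, c, d} \<in> verts \<Gamma> \<and> V = verts \<Gamma> - {{h, a, b}, {k, c, d}}}"

definition rel_span :: "nat \<Rightarrow> (ograph \<Rightarrow> complex) set" where
  "rel_span n =
     {(\<lambda>x. \<Sum>f\<in>F. c f * f x) | F c. finite F \<and> F \<subseteq> iso_rels n \<union> zero_rels n \<union> IHX_rels n}"

text \<open>The pairing: the sign version of \<open>\<delta>\<close> takes into account orientations, and it is 0 if there
  is an orientation reversing automorphism, since such a graph equals its negative.\<close>

definition graph_delta :: "ograph \<Rightarrow> ograph \<Rightarrow> complex" where
  "graph_delta g g' =
     (let \<epsilon> = {iso_sign \<pi> (snd g) (snd g') | \<pi>. is_iso \<pi> (fst g) (fst g')}
      in if zero_graph (fst g) \<or> zero_graph (fst g') then 0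
         else if \<epsilon> = {1} then 1 else if \<epsilon> = {-1} then -1 else 0)"

definition graph_pairing :: "ograph \<Rightarrow> ograph \<Rightarrow> complex" where
  "graph_pairing g g' = graph_delta g g' * of_nat (card (Aut (fst g)))"

section \<open>The forms attached to graphs\<close>

text \<open>A differential form is a function of a point and a list of tangent vectors; it is zero unless
  the length of the list is the degree.\<close>

type_synonym ('p, 't) form = "'p \<Rightarrow> 't list \<Rightarrow> complex"

text \<open>Points and tangent vectors of \<open>base \<times> \<complex>\<^sup>2\<close> with coordinates \<open>(b,z,w)\<close>.\<close>
type_synonym 'b tw = "(complex^'b) \<times> complex \<times> complex"

definition endpoint ::
  "('b::finite) family \<Rightarrow> graph \<Rightarrow> complex^'b \<Rightarrow> (nat set \<Rightarrow> complex) \<Rightarrow> nat set \<Rightarrow> P1" where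
  "endpoint X \<Gamma> b x v = (if v \<in> ext_verts \<Gamma> then mark X (deco \<Gamma> v) b else Aff (x v))"

definition edge_green ::
  "('b::finite) family \<Rightarrow> 'b green \<Rightarrow> graph \<Rightarrow> nat set \<Rightarrow> complex^'b \<Rightarrow> (nat set \<Rightarrow> complex) \<Rightarrow> complex" where
  "edge_green X G \<Gamma> E b x =
     G b (endpoint X \<Gamma> b x (vertex_of \<Gamma> (Min E))) (endpoint X \<Gamma> b x (vertex_of \<Gamma> (Max E)))"

text \<open>The 1-form \<open>((w\<partial> - z\<partial>\<bar>) + (z dw - w dz)) G\<close> pulled back along the edge \<open>E\<close>, at the
  point \<open>(b,z,w)\<close> and the configuration \<open>x\<close> of the internal vertices, on the tangent vector
  \<open>((\<beta>,\<zeta>,\<eta>),\<xi>)\<close>. As pullback along holomorphic maps commutes with \<open>\<partial>\<close> and its conjugate, it is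
  computed from the pulled back function.\<close>

definition edge_form ::
  "('b::finite) family \<Rightarrow> 'b green \<Rightarrow> graph \<Rightarrow> nat set \<Rightarrow> 'b tw \<Rightarrow> (nat set \<Rightarrow> complex) \<Rightarrow>
   'b tw \<times> (nat set \<Rightarrow> complex) \<Rightarrow> complex" where
  "edge_form X G \<Gamma> E P x T = (case P of (b, z, w) \<Rightarrow> case T of ((\<beta>, \<zeta>, \<eta>), \<xi>) \<Rightarrow>
     (let g = (\<lambda>c. edge_green X G \<Gamma> E (b + c *s \<beta>) (\<lambda>v. x v + c * \<xi> v))
      in w * wirt g - z * wirtbar g + (z * \<eta> - w * \<zeta>) * edge_green X G \<Gamma> E b x))"

definition wedge :: "('t \<Rightarrow> complex) list \<Rightarrow> 't list \<Rightarrow> complex" where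
  "wedge as ts =
     (\<Sum>\<pi> | \<pi> permutes {..<length as}. of_int (sign \<pi>) * (\<Prod>i<length as. (as ! i) (ts ! \<pi> i)))"

definition fibre_config ::
  "nat \<Rightarrow> ('b::finite) family \<Rightarrow> graph \<Rightarrow> complex^'b \<Rightarrow> (nat set \<Rightarrow> complex) set" where
  "fibre_config n X \<Gamma> b =
     {x. inj_on x (int_verts \<Gamma>) \<and>
         (\<forall>v\<in>int_verts \<Gamma>. x v \<noteq> sec0 X b \<and> (\<forall>s\<in>labels n. Aff (x v) \<noteq> mark X s b))}"

text \<open>A positively oriented real basis of the tangent space of the configuration space. Its
  length is even, so neither the order of the vertices nor the position of the
  fibre directions affects the sign of the fibre integral.\<close>

definition fibre_basis :: "graph \<Rightarrow> (('b::finite) tw \<times> (nat set \<Rightarrow> complex)) list" where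
  "fibre_basis \<Gamma> =
     concat (map (\<lambda>v. [((0, 0, 0), (\<lambda>_. 0)(v := 1)), ((0, 0, 0), (\<lambda>_. 0)(v := \<i>))])
       (SOME l. distinct l \<and> set l = int_verts \<Gamma>))"

text \<open>The fibre integral may be computed in the affine chart of the fibres, the configurations in
  which a point is at infinity forming a null set.\<close>

definition Z_form :: "nat \<Rightarrow> ('b::finite) family \<Rightarrow> 'b green \<Rightarrow> ograph \<Rightarrow> ('b tw, 'b tw) form" where
  "Z_form n X G g P ts = (case g of (\<Gamma>, (\<epsilon>, es)) \<Rightarrow>
     if fst P \<notin> base X \<or> length ts + 2 * card (int_verts \<Gamma>) \<noteq> card (edges \<Gamma>) \<or> self_loop \<Gamma> then 0
     else if card (edges \<Gamma>) = 1 then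
       (if \<exists>v\<in>ext_verts \<Gamma>. \<exists>w\<in>ext_verts \<Gamma>. v \<noteq> w \<and> deco \<Gamma> v = deco \<Gamma> w then 0
        else of_int \<epsilon> * edge_form X G \<Gamma> (hd es) P (\<lambda>_. 0) (hd ts, \<lambda>_. 0))
     else of_int \<epsilon> *
       (LINT x:fibre_config n X \<Gamma> (fst P)|PiM (int_verts \<Gamma>) (\<lambda>_. lborel).
          wedge (map (\<lambda>E. edge_form X G \<Gamma> E P x) es)
            (fibre_basis \<Gamma> @ map (\<lambda>t. (t, \<lambda>_. 0)) ts)))"

text \<open>Pullback to the twistor line \<open>(z,w) = (1-u,u)\<close>, and from there to a fixed value of \<open>u\<close>.\<close>

definition twistor ::
  "(('b::finite) tw, 'b tw) form \<Rightarrow> ((complex^'b) \<times> complex, (complex^'b) \<times> complex) form" where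
  "twistor \<omega> = (\<lambda>(b, u) ts. \<omega> (b, 1 - u, u) (map (\<lambda>(\<beta>, \<upsilon>). (\<beta>, -\<upsilon>, \<upsilon>)) ts))"

definition at_u ::
  "complex \<Rightarrow> ((complex^('b::finite)) \<times> complex, (complex^'b) \<times> complex) form \<Rightarrow> (complex^'b, complex^'b) form" where
  "at_u u \<omega> = (\<lambda>b ts. \<omega> (b, u) (map (\<lambda>\<beta>. (\<beta>, 0)) ts))"

section \<open>The effective action\<close>

definition action_graphs :: "nat \<Rightarrow> nat \<Rightarrow> graph set" where
  "action_graphs n l =
     {\<Gamma>. is_graph n \<Gamma> \<and> connected_graph \<Gamma> \<and> uni_trivalent \<Gamma> \<and> \<not> self_loop \<Gamma> \<and> betti1 \<Gamma> = int l}"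

text \<open>Representatives of the isomorphism classes. The half-edges are \<open>{..<2m}\<close>, where
  \<open>m\<close> is the number of edges; the orientation is arbitrary.\<close>

definition std_graph :: "graph \<Rightarrow> bool" where
  "std_graph \<Gamma> \<longleftrightarrow> hes \<Gamma> = {..<2 * card (edges \<Gamma>)}"

definition rep_graphs :: "nat \<Rightarrow> nat \<Rightarrow> graph set" where
  "rep_graphs n l =
     (\<lambda>C. SOME \<Gamma>. \<Gamma> \<in> C) `
       ({\<Gamma> \<in> action_graphs n l. std_graph \<Gamma>} //
        {(\<Gamma>, \<Gamma>'). \<Gamma> \<in> action_graphs n l \<and> \<Gamma>' \<in> action_graphs n l \<and>
           std_graph \<Gamma> \<and> std_graph \<Gamma>' \<and> (\<exists>\<pi>. is_iso \<pi> \<Gamma> \<Gamma>')})"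

definition rep_orient :: "graph \<Rightarrow> orient" where
  "rep_orient \<Gamma> = (SOME r. is_orient \<Gamma> r)"

text \<open>A formal series in \<open>\<hbar>\<close> and in graphs, with coefficients in forms: \<open>A l g\<close> is the
  coefficient of \<open>\<hbar>\<^sup>l g\<close>. The Tate twist, which only shifts weights and does not change the
  complex-valued forms, is not recorded, neither here nor for cyclic words.\<close>

type_synonym ('p, 't) gseries = "nat \<Rightarrow> ograph \<Rightarrow> ('p, 't) form"

definition S_eff :: "nat \<Rightarrow> ('b::finite) family \<Rightarrow> 'b green \<Rightarrow> ('b tw, 'b tw) gseries" where
  "S_eff n X G l g P ts =
     (if l \<le> 1 \<and> fst g \<in> rep_graphs n l \<and> snd g = rep_orient (fst g)
      then Z_form n X G g P ts / of_nat (card (Aut (fst g))) else 0)"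

definition S_tree :: "nat \<Rightarrow> ('b::finite) family \<Rightarrow> 'b green \<Rightarrow> ('b tw, 'b tw) gseries" where
  "S_tree n X G l = (if l = 0 then S_eff n X G 0 else (\<lambda>g P ts. 0))"

definition series_at ::
  "complex \<Rightarrow> (('b::finite) tw, 'b tw) gseries \<Rightarrow> (complex^'b, complex^'b) gseries" where
  "series_at u A = (\<lambda>l g. at_u u (twistor (A l g)))"

text \<open>Equality of series of classes of graphs: in each order in \<open>\<hbar>\<close> and for each number of edges,
  where the sums are finite, the difference is a combination of relations.\<close>

definition series_eq :: "nat \<Rightarrow> ('p, 't) gseries \<Rightarrow> ('p, 't) gseries \<Rightarrow> bool" where
  "series_eq n A B \<longleftrightarrow>
     (\<forall>l m b ts. (\<lambda>g. if card (edges (fst g)) = m then A l g b ts - B l g b ts else 0) \<in> rel_span n)"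

section \<open>Cyclic words, planar trees and the Hodge correlator class\<close>

type_synonym cyword = "nat list set"

definition cyc :: "nat list \<Rightarrow> cyword" where
  "cyc w = range (\<lambda>i. rotate i w)"

definition cywords :: "nat \<Rightarrow> nat \<Rightarrow> cyword set" where
  "cywords n k = {cyc w | w. length w = k \<and> set w \<subseteq> labels n}"

definition word_of :: "cyword \<Rightarrow> nat list" where
  "word_of W = (SOME w. w \<in> W)"

definition aut_cyword :: "cyword \<Rightarrow> nat" where
  "aut_cyword W = card {i. i < length (word_of W) \<and> rotate i (word_of W) = word_of W}"

text \<open>A planar trivalent tree with boundary vertices \<open>w\<^sub>0, \<dots>, w\<^sub>k\<close> (counterclockwise) is a planar
  binary tree with root edge ending in \<open>w\<^sub>0\<close> and leaf edges ending in \<open>w\<^sub>1, \<dots>, w\<^sub>k\<close>. The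
  edges are numbered in preorder, beginning with the root edge, which is the order in which
  they are met along the boundary of a neighbourhood. The edge number \<open>e\<close> has the half-edges
  \<open>2e\<close> (towards the root) and \<open>2e + 1\<close>.\<close>

datatype ptree = PLeaf | PNode ptree ptree

fun nleaves :: "ptree \<Rightarrow> nat" where
  "nleaves PLeaf = 1"
| "nleaves (PNode l r) = nleaves l + nleaves r"

fun nedges :: "ptree \<Rightarrow> nat" where
  "nedges PLeaf = 1"
| "nedges (PNode l r) = 1 + nedges l + nedges r"

fun leaf_edges :: "nat \<Rightarrow> ptree \<Rightarrow> nat list" where
  "leaf_edges e PLeaf = [e]"
| "leaf_edges e (PNode l r) = leaf_edges (e + 1) l @ leaf_edges (e + 1 + nedges l) r"

fun inner_verts :: "nat \<Rightarrow> ptree \<Rightarrow> nat set set" where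
  "inner_verts e PLeaf = {}"
| "inner_verts e (PNode l r) =
     insert {2 * e + 1, 2 * (e + 1), 2 * (e + 1 + nedges l)}
       (inner_verts (e + 1) l \<union> inner_verts (e + 1 + nedges l) r)"

definition outer_verts :: "ptree \<Rightarrow> nat set list" where
  "outer_verts t = {0} # map (\<lambda>e. {2 * e + 1}) (leaf_edges 0 t)"

definition plane_tree :: "ptree \<Rightarrow> nat list \<Rightarrow> ograph" where
  "plane_tree t w =
     (\<lparr>hes = {..<2 * nedges t}, edges = (\<lambda>e. {2 * e, 2 * e + 1}) ` {..<nedges t},
       verts = set (outer_verts t) \<union> inner_verts 0 t,
       deco = (\<lambda>v. case map_of (zip (outer_verts t) w) v of None \<Rightarrow> 0 | Some s \<Rightarrow> s)\<rparr>,
      (1, map (\<lambda>e. {2 * e, 2 * e + 1}) [0..<nedges t]))"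

definition ptrees :: "nat list \<Rightarrow> ptree set" where
  "ptrees w = {t. nleaves t + 1 = length w}"

text \<open>Formal series of cyclic words in the dual letters: \<open>F W\<close> is the coefficient of \<open>W\<^sup>\<or>\<close>.
  Its value on the cyclic word \<open>W\<close> is then \<open>aut_cyword W\<close> times \<open>F W\<close>.\<close>

type_synonym ('p, 't) cyseries = "cyword \<Rightarrow> ('p, 't) form"

definition Hodge_corr :: "nat \<Rightarrow> ('b::finite) family \<Rightarrow> 'b green \<Rightarrow> ('b tw, 'b tw) cyseries" where
  "Hodge_corr n X G W P ts =
     (if \<exists>k. W \<in> cywords n k
      then (\<Sum>t\<in>ptrees (word_of W). Z_form n X G (plane_tree t (word_of W)) P ts) / of_nat (aut_cyword W)
      else 0)"

definition cyseries_at ::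
  "complex \<Rightarrow> (('b::finite) tw, 'b tw) cyseries \<Rightarrow> (complex^'b, complex^'b) cyseries" where
  "cyseries_at u F = (\<lambda>W. at_u u (twistor (F W)))"

text \<open>The value of a series of graphs on the sum of the trees decorated by \<open>w\<close>.\<close>

definition eval_on_trees ::
  "nat \<Rightarrow> (ograph \<Rightarrow> ('p, 't) form) \<Rightarrow> nat list \<Rightarrow> ('p, 't) form" where
  "eval_on_trees n A w b ts =
     (\<Sum>t\<in>ptrees w. \<Sum>g | g \<in> ographs n \<and> std_graph (fst g) \<and> card (edges (fst g)) = nedges t.
        A g b ts * graph_pairing g (plane_tree t w))"

definition to_cyseries :: "nat \<Rightarrow> (ograph \<Rightarrow> ('p, 't) form) \<Rightarrow> ('p, 't) cyseries" where
  "to_cyseries n A W b ts =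
     (if \<exists>k. W \<in> cywords n k then eval_on_trees n A (word_of W) b ts / of_nat (aut_cyword W) else 0)"

section \<open>Special derivations and the KZ connection form\<close>

text \<open>Noncommutative formal power series in two letters; \<open>False\<close> stands for \<open>X\<^sub>0\<close> and
  \<open>True\<close> for \<open>X\<^sub>1\<close>.\<close>

type_synonym nc = "bool list \<Rightarrow> complex"

definition nc_letter :: "bool \<Rightarrow> nc" where
  "nc_letter a = (\<lambda>w. if w = [a] then 1 else 0)"

definition nc_one :: nc where
  "nc_one = (\<lambda>w. if w = [] then 1 else 0)"

definition nc_add :: "nc \<Rightarrow> nc \<Rightarrow> nc" where
  "nc_add f g = (\<lambda>w. f w + g w)"

definition nc_scale :: "complex \<Rightarrow> nc \<Rightarrow> nc" where
  "nc_scale c f = (\<lambda>w. c * f w)"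

definition nc_mult :: "nc \<Rightarrow> nc \<Rightarrow> nc" where
  "nc_mult f g = (\<lambda>w. \<Sum>i\<le>length w. f (take i w) * g (drop i w))"

definition nc_bracket :: "nc \<Rightarrow> nc \<Rightarrow> nc" where
  "nc_bracket f g = nc_add (nc_mult f g) (nc_scale (-1) (nc_mult g f))"

inductive_set free_lie :: "nc set" where
  "nc_letter a \<in> free_lie"
| "f \<in> free_lie \<Longrightarrow> g \<in> free_lie \<Longrightarrow> nc_add f g \<in> free_lie"
| "f \<in> free_lie \<Longrightarrow> nc_scale c f \<in> free_lie"
| "f \<in> free_lie \<Longrightarrow> g \<in> free_lie \<Longrightarrow> nc_bracket f g \<in> free_lie"

definition derivation :: "(nc \<Rightarrow> nc) \<Rightarrow> bool" where
  "derivation D \<longleftrightarrow>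
     (\<forall>f\<in>free_lie. \<forall>g\<in>free_lie. D (nc_add f g) = nc_add (D f) (D g) \<and>
        D (nc_bracket f g) = nc_add (nc_bracket (D f) g) (nc_bracket f (D g))) \<and>
     (\<forall>f\<in>free_lie. \<forall>c. D (nc_scale c f) = nc_scale c (D f))"

text \<open>The marked points 0, 1, \<open>\<infinity>\<close> have the labels 1, 2, 3. The relation between the letters
  says that \<open>X\<^sub>s\<close> for \<open>s = s\<^sub>0\<close>, which is minus the sum of the others, is 0, so that it is killed by
  any derivation.\<close>

definition X_letter :: "nat \<Rightarrow> nc" where
  "X_letter s =
     (if s = 1 then nc_letter False else if s = 2 then nc_letter True
      else nc_add (nc_scale (-1) (nc_letter False)) (nc_scale (-1) (nc_letter True)))"

definition nc_word :: "nat list \<Rightarrow> nc" where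
  "nc_word w = foldr (\<lambda>s f. nc_mult (X_letter s) f) w nc_one"

definition cy_deriv :: "nat \<Rightarrow> (cyword \<Rightarrow> complex) \<Rightarrow> nc" where
  "cy_deriv s F = (\<lambda>v. \<Sum>W\<in>cywords 4 (length v + 1).
     F W * (\<Sum>i | i < length (word_of W) \<and> word_of W ! i = s. nc_word (tl (rotate i (word_of W))) v))"

text \<open>The derivation \<open>D\<close> of the free Lie algebra (with values in its completion, as \<open>F\<close> is a series)
  is the special derivation defined by \<open>F\<close>. It is unique on \<open>free_lie\<close>.\<close>

definition special_derivation_of :: "(cyword \<Rightarrow> complex) \<Rightarrow> (nc \<Rightarrow> nc) \<Rightarrow> bool" where
  "special_derivation_of F D \<longleftrightarrow>
     derivation D \<and> (\<forall>s\<in>{1, 2, 3}. D (X_letter s) = nc_bracket (X_letter s) (cy_deriv s F))"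

definition special_derivations :: "(nc \<Rightarrow> nc) set" where
  "special_derivations =
     {D. derivation D \<and> D ` free_lie \<subseteq> free_lie \<and>
         (\<forall>s\<in>{1, 2, 3}. \<exists>f\<in>free_lie. D (X_letter s) = nc_bracket (X_letter s) f)}"

definition ad :: "nc \<Rightarrow> nc \<Rightarrow> nc" where
  "ad f = (\<lambda>g. nc_bracket g f)"

text \<open>The enhanced moduli space for \<open>n = 4\<close>: coordinates \<open>z = s\<^sub>0\<close> and the tangent vector.\<close>

definition M04 :: "2 family" where
  "M04 = \<lparr>base = {b. b $ 1 \<notin> {0, 1} \<and> b $ 2 \<noteq> 0}, sec0 = (\<lambda>b. b $ 1), tvec = (\<lambda>b. b $ 2),
          mark = (\<lambda>s b. if s = 1 then Aff 0 else if s = 2 then Aff 1 else Infty)\<rparr>"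

text \<open>The KZ form with coefficients in the Lie algebra, and its complex conjugate (the letters being
  real), pulled back from the \<open>z\<close>-line.\<close>

definition omega_KZ :: "complex^2 \<Rightarrow> (complex^2) list \<Rightarrow> nc" where
  "omega_KZ b ts = (if length ts = 1
     then nc_scale (1 / (2 * of_real pi * \<i>))
            (nc_add (nc_scale ((hd ts) $ 1 / b $ 1) (nc_letter False))
                    (nc_scale ((hd ts) $ 1 / (b $ 1 - 1)) (nc_letter True)))
     else (\<lambda>_. 0))"

definition omega_KZ_bar :: "complex^2 \<Rightarrow> (complex^2) list \<Rightarrow> nc" where
  "omega_KZ_bar b ts = (\<lambda>v. cnj (omega_KZ b ts v))"

text \<open>\<open>Id \<otimes> ad\<close>, giving a form with values in derivations.\<close>

definition Id_ad :: "('p \<Rightarrow> 't list \<Rightarrow> nc) \<Rightarrow> 'p \<Rightarrow> 't list \<Rightarrow> nc \<Rightarrow> nc" where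
  "Id_ad \<omega> b ts = ad (\<omega> b ts)"

end

theory Submission
  imports Defs
begin

text \<open>The Green current is determined by its equation. Test it against a function \<open>\<chi>(b) \<psi>(x) \<chi>'(y)\<close> where
  \<open>\<chi>\<close>, \<open>\<chi>'\<close> are narrow bumps and \<open>\<psi>\<close> is the difference of two smoothed logarithms
  of the distance to \<open>x\<^sub>0\<close>, cut off at a small radius \<open>r\<close> and a large radius \<open>R\<close>. The Laplacian of \<open>\<psi>\<close> lives on
  two annuli, on which \<open>G\<close> is smooth, so as \<open>r \<rightarrow> 0\<close> and \<open>R \<rightarrow> \<infinity>\<close> the equation expresses
  \<open>G(x\<^sub>0,y) - G(\<infinity>,y)\<close> through logarithms, and the normalization at \<open>s\<^sub>0\<close> fixes the constants. In particular
  \<open>G\<close> is symmetric.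

  At \<open>u = 1\<close> every edge form is of type (1,0), at \<open>u = 0\<close> of type (0,1). A wedge product of such
  forms has no component of type (1,1) in the position of an internal vertex, so every graph with an
  internal vertex integrates to 0. Only single edges survive; they are trees, and for four points the explicit Green function
  turns them into the coefficients of the KZ form, up to multiples of \<open>X\<^sub>s\<close> which \<open>[X\<^sub>s, \<cdot>]\<close> kills.\<close>

section \<open>Smooth functions\<close>

text \<open>What is given is a distributional equation for a function that is smooth off the
  divisors; neither a formula for G nor its symmetry comes with it. Both are needed. The
  representative of an isomorphism class may carry its two labels in the opposite order from the
  planar tree, and the KZ coefficients are derivatives of G. In place of a regularity theorem for
  harmonic distributions, a single family of test functions is inserted, and only the component of
  the equation along the first fibre coordinate is read off; there the second component of the
  divisor of s_0 is invisible. The logarithm has to be cut off at both ends because test functions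
  have compact support, and this is how the value at infinity enters. The Laplacian mass c of an
  annulus is never integrated: it is pinned to pi because the normalization at s_0 leaves no room
  for a multiple of an unbounded logarithm.

  The vanishing of graphs with internal vertices is pointwise on the configuration space, so it
  raises no question of convergence.\<close>

lemma Ck_on_Suc_imp: "Ck_on (Suc k) UNIV f \<Longrightarrow> Ck_on k UNIV f"
proof (induction k arbitrary: f)
  case 0
  then show ?case
    by (auto simp: continuous_on_eq_continuous_at differentiable_imp_continuous_within)
qed auto

text \<open>\<open>Ck_on\<close> is phrased with \<open>frechet_derivative\<close>; since
  derivatives are unique, any explicitly known derivative \<open>D\<close> may serve in
  inductions.\<close>

lemma Ck_on_SucI:
  assumes "\<And>x. (f has_derivative D x) (at x)" and "\<And>v. Ck_on k UNIV (\<lambda>x. D x v)"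
  shows "Ck_on (Suc k) UNIV f"
proof -
  have "frechet_derivative f (at x) = D x" for x
    using frechet_derivative_at[OF assms(1)] by simp
  then show ?thesis
    using assms by (auto simp: differentiable_def)
qed

lemma Ck_on_SucD:
  assumes "Ck_on (Suc k) UNIV f"
  shows "(f has_derivative frechet_derivative f (at x)) (at x)"
    and "Ck_on k UNIV (\<lambda>x. frechet_derivative f (at x) v)"
  using assms by (auto simp: frechet_derivative_works)

lemma Ck_on_const: "Ck_on k UNIV (\<lambda>_. c)"
  by (induction k arbitrary: c) (auto intro!: continuous_intros)

lemma Ck_on_add:
  "Ck_on k UNIV f \<Longrightarrow> Ck_on k UNIV g \<Longrightarrow> Ck_on k UNIV (\<lambda>x. f x + g x)"
proof (induction k arbitrary: f g)
  case 0
  then show ?case by (auto intro: continuous_intros)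
next
  case (Suc k)
  show ?case
    by (rule Ck_on_SucI[OF has_derivative_add[OF Ck_on_SucD(1)[OF Suc.prems(1)] Ck_on_SucD(1)[OF Suc.prems(2)]]])
       (rule Suc.IH[OF Ck_on_SucD(2)[OF Suc.prems(1)] Ck_on_SucD(2)[OF Suc.prems(2)]])
qed

lemma Ck_on_mult:
  "Ck_on k UNIV f \<Longrightarrow> Ck_on k UNIV g \<Longrightarrow> Ck_on k UNIV (\<lambda>x. f x * g x)"
proof (induction k arbitrary: f g)
  case 0
  then show ?case by (auto intro: continuous_intros)
next
  case (Suc k)
  have d: "((\<lambda>x. f x * g x) has_derivative
      (\<lambda>v. f x * frechet_derivative g (at x) v + frechet_derivative f (at x) v * g x)) (at x)" for x
    by (rule has_derivative_mult[OF Ck_on_SucD(1)[OF Suc.prems(1)] Ck_on_SucD(1)[OF Suc.prems(2)]])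
  show ?case
    by (rule Ck_on_SucI[OF d])
       (rule Ck_on_add Suc.IH[OF Ck_on_Suc_imp[OF Suc.prems(1)] Ck_on_SucD(2)[OF Suc.prems(2)]]
          Suc.IH[OF Ck_on_SucD(2)[OF Suc.prems(1)] Ck_on_Suc_imp[OF Suc.prems(2)]])+
qed

lemma Ck_on_cmult: "Ck_on k UNIV f \<Longrightarrow> Ck_on k UNIV (\<lambda>x. c * f x)"
  by (intro Ck_on_mult Ck_on_const)

lemma Ck_on_diff:
  assumes "Ck_on k UNIV f" "Ck_on k UNIV g"
  shows "Ck_on k UNIV (\<lambda>x. f x - g x)"
  using Ck_on_add[OF assms(1) Ck_on_cmult[OF assms(2), of "-1"]] by simp

lemma Ck_on_inverse:
  "Ck_on k UNIV f \<Longrightarrow> (\<And>x. f x \<noteq> 0) \<Longrightarrow> Ck_on k UNIV (\<lambda>x. inverse (f x))"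
proof (induction k arbitrary: f)
  case 0
  then show ?case by (auto intro!: continuous_intros)
next
  case (Suc k)
  have inv: "Ck_on k UNIV (\<lambda>x. inverse (f x))"
    by (rule Suc.IH[OF Ck_on_Suc_imp[OF Suc.prems(1)] Suc.prems(2)])
  have d: "((\<lambda>x. inverse (f x)) has_derivative
      (\<lambda>v. - (inverse (f x) * frechet_derivative f (at x) v * inverse (f x)))) (at x)" for x
    by (rule Deriv.has_derivative_inverse[OF Suc.prems(2) Ck_on_SucD(1)[OF Suc.prems(1)]])
  show ?case
  proof (rule Ck_on_SucI[OF d])
    fix v
    have "Ck_on k UNIV (\<lambda>x. (-1) * (inverse (f x) * frechet_derivative f (at x) v * inverse (f x)))"
      by (rule Ck_on_mult Ck_on_const inv Ck_on_SucD(2)[OF Suc.prems(1)])+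
    then show "Ck_on k UNIV (\<lambda>x. - (inverse (f x) * frechet_derivative f (at x) v * inverse (f x)))"
      by simp
  qed
qed

lemma Ck_on_linear:
  assumes "bounded_linear T"
  shows "Ck_on k UNIV (\<lambda>x. complex_of_real (T x))"
proof (cases k)
  case 0
  then show ?thesis
    using linear_continuous_on[OF assms, of UNIV] by (simp add: continuous_on_of_real_o_iff[unfolded o_def])
next
  case (Suc j)
  show ?thesis
    unfolding Suc
    by (rule Ck_on_SucI[where D = "\<lambda>_ v. complex_of_real (T v)"])
       (intro Ck_on_const bounded_linear.has_derivative[OF bounded_linear_of_real
          bounded_linear_imp_has_derivative[OF assms]])+
qed

text \<open>Inner functions are real while \<open>Ck_on\<close> speaks of complex values, so the
  inner function enters through \<open>complex_of_real\<close> and its real derivative is recovered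
  with \<open>Re\<close>. By the chain rule the derivative is a product containing a composition of
  lower order, to which the induction applies.\<close>

lemma Ck_on_compose:
  fixes f :: "'a::real_normed_vector \<Rightarrow> real" and g :: "real \<Rightarrow> complex"
  shows "Ck_on k UNIV g \<Longrightarrow> Ck_on k UNIV (\<lambda>x. complex_of_real (f x)) \<Longrightarrow> Ck_on k UNIV (\<lambda>x. g (f x))"
proof (induction k arbitrary: g)
  case 0
  have "continuous_on UNIV (\<lambda>x. Re (complex_of_real (f x)))"
    using 0(2) by (intro continuous_on_Re) auto
  then show ?case
    using 0(1) continuous_on_compose2[of UNIV g UNIV f] by simp
next
  case (Suc k)
  let ?D = "frechet_derivative (\<lambda>x. complex_of_real (f x))"
  have f: "(f has_derivative (\<lambda>v. Re (?D (at x) v))) (at x)" for x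
    using bounded_linear.has_derivative[OF bounded_linear_Re Ck_on_SucD(1)[OF Suc.prems(2), of x]]
    by simp
  have "(\<lambda>v. complex_of_real (Re (?D (at x) v))) = ?D (at x)" for x
    using frechet_derivative_at[OF bounded_linear.has_derivative[OF bounded_linear_of_real f[of x]]]
    by simp
  \<comment> \<open>The derivative of an embedded real function is real, so nothing is lost by
    taking \<open>Re\<close>.\<close>
  then have re: "complex_of_real (Re (?D (at x) v)) = ?D (at x) v" for x v
    by metis
  let ?g' = "\<lambda>s. frechet_derivative g (at s) 1"
  have g: "(g has_derivative (\<lambda>h. complex_of_real h * ?g' s)) (at s)" for s
  proof -
    have "linear (frechet_derivative g (at s))"
      using Suc.prems(1) by (auto intro: linear_frechet_derivative)
    then have lin: "frechet_derivative g (at s) h = h *\<^sub>R ?g' s" for h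
      using linear_scale[of "frechet_derivative g (at s)" h 1]
      by (simp only: real_scaleR_def mult_1_right)
    have "frechet_derivative g (at s) = (\<lambda>h. complex_of_real h * ?g' s)"
      by (rule ext, subst lin) (rule scaleR_conv_of_real)
    then show ?thesis
      using Ck_on_SucD(1)[OF Suc.prems(1), of s] by simp
  qed
  have d: "((\<lambda>x. g (f x)) has_derivative (\<lambda>v. ?D (at x) v * ?g' (f x))) (at x)" for x
    using has_derivative_compose[OF f g] by (simp add: re)
  show ?case
    by (rule Ck_on_SucI[OF d])
       (rule Ck_on_mult Ck_on_SucD(2)[OF Suc.prems(2)] Suc.IH[of ?g'] Ck_on_SucD(2)[OF Suc.prems(1)]
          Ck_on_Suc_imp[OF Suc.prems(2)])+
qed

lemma smooth_on_dist_sq: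
  fixes T :: "'a::real_normed_vector \<Rightarrow> 'c::real_inner"
  assumes T: "bounded_linear T"
  shows "Ck_on k UNIV (\<lambda>x. complex_of_real ((norm (T x - a))\<^sup>2 / r))"
proof (cases k)
  case 0
  have "continuous_on UNIV T"
    using linear_continuous_on[OF T] .
  then show ?thesis
    unfolding 0 by (cases "r = 0") (auto intro!: continuous_intros)
next
  case (Suc j)
  have TD: "(T has_derivative T) (at x)" for x
    by (rule bounded_linear_imp_has_derivative[OF T])
  have "((\<lambda>x. (T x - a) \<bullet> (T x - a) / r) has_derivative (\<lambda>v. 2 / r * ((T x - a) \<bullet> T v))) (at x)" for x
  proof (cases "r = 0")
    case False
    show ?thesis
      by (rule derivative_eq_intros refl TD False | simp add: inner_commute False)+
  qed simp
  then have d: "((\<lambda>x. (norm (T x - a))\<^sup>2 / r) has_derivative (\<lambda>v. 2 / r * ((T x - a) \<bullet> T v))) (at x)" for x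
    by (simp add: power2_norm_eq_inner)
  show ?thesis
    unfolding Suc
  proof (rule Ck_on_SucI[OF bounded_linear.has_derivative[OF bounded_linear_of_real d]])
    fix v
    have "bounded_linear (\<lambda>x. 2 / r * (T x \<bullet> T v))"
      by (intro bounded_linear_const_mult bounded_linear_compose[OF bounded_linear_inner_left T])
    from Ck_on_diff[OF Ck_on_linear[OF this, of j] Ck_on_const[of j "complex_of_real (2 / r * (a \<bullet> T v))"]]
    show "Ck_on j UNIV (\<lambda>x. complex_of_real (2 / r * ((T x - a) \<bullet> T v)))"
      by (simp add: inner_diff_left algebra_simps)
  qed
qed

section \<open>Flat functions, bumps and the cut-off logarithm\<close>

text \<open>The index \<open>k\<close> makes the family closed under differentiation up to linear
  combinations, so one induction gives smoothness of all its members; \<open>flat 0\<close> is the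
  standard flat function.\<close>

definition flat :: "nat \<Rightarrow> real \<Rightarrow> real" where
  "flat k t = (if t > 0 then exp (- 1 / t) / t ^ k else 0)"

lemma flat_has_derivative:
  "(flat k has_real_derivative (flat (k + 2) t - real k * flat (k + 1) t)) (at t)"
proof -
  consider "t > 0" | "t < 0" | "t = 0" by linarith
  then show ?thesis
  proof cases
    case 1
    have "((\<lambda>t. exp (- 1 / t) / t ^ k) has_real_derivative (flat (k + 2) t - real k * flat (k + 1) t)) (at t)"
    proof (cases k)
      case 0
      then show ?thesis
        using 1 by (auto intro!: derivative_eq_intros simp: flat_def power2_eq_square)
    next
      case (Suc j)
      have "((\<lambda>t. exp (- 1 / t) * inverse t ^ k) has_real_derivative
          (exp (- 1 / t) * (inverse t ^ 2)) * inverse t ^ k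
            + exp (- 1 / t) * (real k * inverse t ^ j * (- (inverse t ^ 2)))) (at t)"
      proof -
        have "((\<lambda>t. exp (- 1 / t)) has_real_derivative exp (- 1 / t) * (inverse t ^ 2)) (at t)"
          using 1 by (auto intro!: derivative_eq_intros simp: power2_eq_square divide_inverse)
        moreover have "((\<lambda>t. inverse t ^ k) has_real_derivative
            real k * inverse t ^ j * (- (inverse t ^ 2))) (at t)"
          using 1 DERIV_power[OF DERIV_inverse[of t UNIV], of k] unfolding Suc
          by (simp add: power2_eq_square algebra_simps)
        ultimately show ?thesis
          using DERIV_mult by (fastforce simp: algebra_simps)
      qed
      also have "(exp (- 1 / t) * (inverse t ^ 2)) * inverse t ^ k
            + exp (- 1 / t) * (real k * inverse t ^ j * (- (inverse t ^ 2)))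
          = flat (k + 2) t - real k * flat (k + 1) t"
        using 1 unfolding Suc
        by (simp add: flat_def divide_inverse power_inverse power2_eq_square algebra_simps)
      finally show ?thesis
        by (simp add: divide_inverse power_inverse)
    qed
    then show ?thesis
      by (rule has_field_derivative_transform_within_open[where S = "{0<..}"])
         (use 1 in \<open>auto simp: flat_def\<close>)
  next
    case 2
    have "((\<lambda>t. 0) has_real_derivative (flat (k + 2) t - real k * flat (k + 1) t)) (at t)"
      using 2 by (auto simp: flat_def)
    then show ?thesis
      by (rule has_field_derivative_transform_within_open[where S = "{..<0}"])
         (use 2 in \<open>auto simp: flat_def\<close>)
  next
    case 3
    have "((\<lambda>y. (flat k y - flat k 0) / (y - 0)) \<longlongrightarrow> 0) (at_right 0)"
    proof (rule Lim_transform_eventually)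
      \<comment> \<open>From the right the difference quotient at 0 is again of this shape.
        Substituting z = 1/y, the exponential beats every power.\<close>
      have "((\<lambda>y::real. exp (- 1 / y) / y ^ (Suc k)) \<longlongrightarrow> 0) (at_right 0)"
      proof -
        have "((\<lambda>z::real. z ^ Suc k / exp z) \<longlongrightarrow> 0) at_top"
          by (rule tendsto_power_div_exp_0)
        then have "((\<lambda>y::real. (inverse y) ^ Suc k / exp (inverse y)) \<longlongrightarrow> 0) (at_right 0)"
          using filterlim_compose[OF _ filterlim_inverse_at_top_right] by blast
        then show ?thesis
          by (simp add: exp_minus field_simps)
      qed
      then show "((\<lambda>y::real. exp (- 1 / y) / y ^ (Suc k)) \<longlongrightarrow> 0) (at_right 0)" .
      show "\<forall>\<^sub>F x in at_right 0. exp (- 1 / x) / x ^ Suc k = (flat k x - flat k 0) / (x - 0)"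
        by (auto simp: eventually_at_filter flat_def intro!: always_eventually)
    qed
    moreover have "((\<lambda>y. (flat k y - flat k 0) / (y - 0)) \<longlongrightarrow> 0) (at_left 0)"
      by (rule tendsto_eventually) (auto simp: eventually_at_filter flat_def)
    ultimately have "((\<lambda>y. (flat k y - flat k 0) / (y - 0)) \<longlongrightarrow> 0) (at 0)"
      by (intro filterlim_split_at)
    then show ?thesis
      using 3 by (simp add: has_field_derivative_iff flat_def)
  qed
qed

lemma has_derivative_of_real_comp:
  assumes "(f has_real_derivative d) (at s)"
  shows "((\<lambda>s. complex_of_real (f s)) has_derivative (\<lambda>v. complex_of_real v * complex_of_real d)) (at s)"
proof -
  have "((\<lambda>s. complex_of_real (f s)) has_derivative (\<lambda>v. complex_of_real (d * v))) (at s)"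
    using assms unfolding has_field_derivative_def
    by (rule bounded_linear.has_derivative[OF bounded_linear_of_real])
  then show ?thesis by (simp add: mult.commute)
qed

lemma Ck_on_flat: "Ck_on j UNIV (\<lambda>t. complex_of_real (flat k t))"
proof (induction j arbitrary: k)
  case 0
  have "continuous_on UNIV (flat k)"
    using flat_has_derivative DERIV_isCont by (blast intro: continuous_at_imp_continuous_on)
  then show ?case by (auto intro!: continuous_intros)
next
  case (Suc j)
  have d: "((\<lambda>t. complex_of_real (flat k t)) has_derivative
      (\<lambda>v. complex_of_real v * (complex_of_real (flat (k + 2) t) - of_nat k * complex_of_real (flat (k + 1) t)))) (at t)" for t
    using has_derivative_of_real_comp[OF flat_has_derivative[of k t]] by simp
  show ?case
    by (rule Ck_on_SucI[OF d]) (rule Ck_on_cmult[OF Ck_on_diff[OF Suc.IH Ck_on_cmult[OF Suc.IH]]])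
qed

text \<open>Meant to be applied to the squared distance divided by d^2, which gives a smooth bump
  supported in the closed ball of radius d. It is not normalized: its integral is divided out
  later.\<close>

definition bump :: "real \<Rightarrow> real" where
  "bump s = flat 0 (1 - s)"

lemma bump_nonneg: "0 \<le> bump s"
  and bump_pos: "s < 1 \<Longrightarrow> 0 < bump s"
  and bump_zero: "1 \<le> s \<Longrightarrow> bump s = 0"
  by (auto simp: bump_def flat_def)

lemma Ck_on_affine: "Ck_on k UNIV (\<lambda>s::real. complex_of_real (a + b * s))"
proof -
  have "Ck_on k UNIV (\<lambda>s::real. complex_of_real a + complex_of_real (b * s))"
    by (rule Ck_on_add[OF Ck_on_const Ck_on_linear[OF bounded_linear_mult_right]])
  then show ?thesis by simp
qed

lemma Ck_on_bump: "Ck_on k UNIV (\<lambda>s. complex_of_real (bump s))"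
  unfolding bump_def
  using Ck_on_compose[OF Ck_on_flat[of k 0], of "\<lambda>s. 1 - s"] Ck_on_affine[of k 1 "-1"] by simp

text \<open>The derivative is smooth again, so the step can be iterated to produce \<open>L'\<close>
  and \<open>L''\<close>.\<close>

lemma Ck_on_real_derivative:
  fixes f :: "real \<Rightarrow> real"
  assumes "\<And>k. Ck_on k UNIV (\<lambda>s. complex_of_real (f s))"
  obtains f' where "\<And>s. (f has_real_derivative f' s) (at s)"
    and "\<And>k. Ck_on k UNIV (\<lambda>s. complex_of_real (f' s))"
proof -
  define F where "F = (\<lambda>s. complex_of_real (f s))"
  have F: "(F has_derivative frechet_derivative F (at s)) (at s)" for s
    using Ck_on_SucD(1)[OF assms[of "Suc 0"]] unfolding F_def .
  have f: "(f has_derivative (\<lambda>v. Re (frechet_derivative F (at s) v))) (at s)" for s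
    using bounded_linear.has_derivative[OF bounded_linear_Re F[of s]] by (simp add: F_def)
  define f' where "f' = (\<lambda>s. Re (frechet_derivative F (at s) 1))"
  have der: "(f has_real_derivative f' s) (at s)" for s
  proof -
    have "linear (\<lambda>v. Re (frechet_derivative F (at s) v))"
      using f has_derivative_linear by blast
    then have lin: "Re (frechet_derivative F (at s) v) = v *\<^sub>R f' s" for v
      using linear_scale[of "\<lambda>v. Re (frechet_derivative F (at s) v)" v 1]
      by (simp only: f'_def real_scaleR_def mult_1_right)
    have "(\<lambda>v. Re (frechet_derivative F (at s) v)) = (*) (f' s)"
      by (rule ext, subst lin) simp
    then show ?thesis
      using f[of s] by (simp add: has_field_derivative_def)
  qed
  have "complex_of_real (f' s) = frechet_derivative F (at s) 1" for s
    using frechet_derivative_at[OF bounded_linear.has_derivative[OF bounded_linear_of_real f[of s]]]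
    unfolding f'_def F_def by (metis)
  then have "(\<lambda>s. complex_of_real (f' s)) = (\<lambda>s. frechet_derivative F (at s) 1)"
    by auto
  then have "Ck_on k UNIV (\<lambda>s. complex_of_real (f' s))" for k
    using assms[of "Suc k"] unfolding F_def by simp
  with der that show thesis by blast
qed

text \<open>A logarithm smoothly cut off near zero: composed with the square of the distance to a point, it
  has its Laplacian supported in an annulus.\<close>

locale log_cutoff =
  fixes L L' L'' :: "real \<Rightarrow> real"
  assumes L_smooth: "\<And>k. Ck_on k UNIV (\<lambda>s. complex_of_real (L s))"
    and L': "\<And>s. (L has_real_derivative L' s) (at s)"
    and L'': "\<And>s. (L' has_real_derivative L'' s) (at s)"
    and L''_cont: "continuous_on UNIV L''"
    and L_zero: "\<And>s. s \<le> 1 \<Longrightarrow> L s = 0"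
    and L_ln: "\<And>s. s \<ge> 2 \<Longrightarrow> L s = ln s"
    and annulus: "\<And>s. s < 1 \<or> 2 < s \<Longrightarrow> L' s + s * L'' s = 0"

text \<open>The interpolation takes place inside the logarithm: its argument is 1 for s \<le> 1,
  equals s for s \<ge> 2, and is positive throughout. The annulus condition holds because
  \<open>L' s + s * L'' s\<close> is the derivative of \<open>s * L' s\<close>, which is constant
  wherever \<open>L\<close> is 0 or a logarithm.\<close>

lemma cut_off_ln:
  obtains L L' L'' :: "real \<Rightarrow> real" where "log_cutoff L L' L''"
proof -
  \<comment> \<open>A smooth transition from 0 for s \<le> 1 to 1 for s \<ge> 2; the two flat
    functions have no common zero.\<close>
  define lm where "lm = (\<lambda>s. flat 0 (s - 1) / (flat 0 (s - 1) + flat 0 (2 - s)))"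
  define L where "L = (\<lambda>s. ln (1 + lm s * (s - 1)))"
  have pos: "flat 0 (s - 1) + flat 0 (2 - s) > 0" for s
    by (auto simp: flat_def add_pos_pos)
  have fl: "Ck_on k UNIV (\<lambda>s. complex_of_real (flat 0 (a + b * s)))" for k a b
    by (rule Ck_on_compose[OF Ck_on_flat Ck_on_affine])
  have "Ck_on k UNIV (\<lambda>s. complex_of_real (flat 0 (s - 1)) * 
      inverse (complex_of_real (flat 0 (s - 1)) + complex_of_real (flat 0 (2 - s))))" for k
  proof -
    have 1: "Ck_on k UNIV (\<lambda>s. complex_of_real (flat 0 (s - 1)))"
        and 2: "Ck_on k UNIV (\<lambda>s. complex_of_real (flat 0 (2 - s)))"
      using fl[of k "-1" 1] fl[of k 2 "-1"] by simp_all
    have "complex_of_real (flat 0 (s - 1)) + complex_of_real (flat 0 (2 - s)) \<noteq> 0" for s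
      using pos[of s] by (metis less_irrefl of_real_add of_real_eq_0_iff)
    then show ?thesis
      by (rule Ck_on_mult[OF 1 Ck_on_inverse[OF Ck_on_add[OF 1 2]]])
  qed
  then have lm: "Ck_on k UNIV (\<lambda>s. complex_of_real (lm s))" for k
    by (simp add: lm_def divide_inverse)
  define \<sigma> where "\<sigma> = (\<lambda>s. 1 + lm s * (s - 1))"
  have "Ck_on k UNIV (\<lambda>s. 1 + complex_of_real (lm s) * complex_of_real (-1 + 1 * s))" for k
    by (rule Ck_on_add[OF Ck_on_const Ck_on_mult[OF lm Ck_on_affine]])
  then have \<sigma>: "Ck_on k UNIV (\<lambda>s. complex_of_real (\<sigma> s))" for k
    by (simp add: \<sigma>_def)
  have \<sigma>_pos: "\<sigma> s > 0" for s
  proof (cases "s \<le> 1")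
    case True
    then show ?thesis by (simp add: \<sigma>_def lm_def flat_def)
  next
    case False
    then have "lm s \<ge> 0"
      using pos[of s] by (auto simp: lm_def flat_def)
    with False show ?thesis by (simp add: \<sigma>_def add_pos_nonneg)
  qed
  obtain \<sigma>' where \<sigma>': "\<And>s. (\<sigma> has_real_derivative \<sigma>' s) (at s)"
      "\<And>k. Ck_on k UNIV (\<lambda>s. complex_of_real (\<sigma>' s))"
    using Ck_on_real_derivative[OF \<sigma>] by blast
  have L: "(L has_real_derivative \<sigma>' s / \<sigma> s) (at s)" for s
  proof -
    have "L = (\<lambda>s. ln (\<sigma> s))" by (simp add: L_def \<sigma>_def)
    then show ?thesis
      using DERIV_chain2[OF DERIV_ln[OF \<sigma>_pos] \<sigma>'(1)] by (simp add: divide_inverse mult.commute)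
  qed
  have quot: "Ck_on k UNIV (\<lambda>s. complex_of_real (\<sigma>' s) * inverse (complex_of_real (\<sigma> s)))" for k
    by (rule Ck_on_mult[OF \<sigma>'(2) Ck_on_inverse[OF \<sigma>]])
       (use \<sigma>_pos in \<open>auto simp: less_imp_neq[symmetric]\<close>)
  then have quot': "Ck_on k UNIV (\<lambda>s. complex_of_real (\<sigma>' s / \<sigma> s))" for k
    by (simp add: divide_inverse)
  have LC: "Ck_on k UNIV (\<lambda>s. complex_of_real (L s))" for k
  proof (rule Ck_on_Suc_imp, rule Ck_on_SucI)
    fix s v
    show "((\<lambda>s. complex_of_real (L s)) has_derivative
        (\<lambda>v. complex_of_real v * complex_of_real (\<sigma>' s / \<sigma> s))) (at s)"
      by (rule has_derivative_of_real_comp[OF L])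
    show "Ck_on k UNIV (\<lambda>s. complex_of_real v * complex_of_real (\<sigma>' s / \<sigma> s))"
      by (rule Ck_on_cmult[OF quot'])
  qed
  obtain L' where L': "\<And>s. (L has_real_derivative L' s) (at s)"
      "\<And>k. Ck_on k UNIV (\<lambda>s. complex_of_real (L' s))"
    using Ck_on_real_derivative[OF LC] by blast
  obtain L'' where L'': "\<And>s. (L' has_real_derivative L'' s) (at s)"
      "\<And>k. Ck_on k UNIV (\<lambda>s. complex_of_real (L'' s))"
    using Ck_on_real_derivative[OF L'(2)] by blast
  have "continuous_on UNIV (\<lambda>s. Re (complex_of_real (L'' s)))"
    using L''(2)[of 0] by (intro continuous_on_Re) auto
  then have L''_cont: "continuous_on UNIV L''" by simp
  have L_zero: "L s = 0" if "s \<le> 1" for s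
    using that by (simp add: L_def lm_def flat_def)
  have L_ln: "L s = ln s" if "s \<ge> 2" for s
    using that by (simp add: L_def lm_def flat_def)
  have L'_zero: "L' s = 0" if "s < 1" for s
  proof -
    have "((\<lambda>_. 0) has_real_derivative L' s) (at s)"
      by (rule has_field_derivative_transform_within_open[OF L'(1), where S = "{..<1}"])
         (use that L_zero in auto)
    then show ?thesis
      using DERIV_unique[OF _ DERIV_const] by blast
  qed
  have L''_zero: "L'' s = 0" if "s < 1" for s
  proof -
    have "((\<lambda>_. 0) has_real_derivative L'' s) (at s)"
      by (rule has_field_derivative_transform_within_open[OF L''(1), where S = "{..<1}"])
         (use that L'_zero in auto)
    then show ?thesis
      using DERIV_unique[OF _ DERIV_const] by blast
  qed
  have L'_ln: "L' s = inverse s" if "s > 2" for s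
  proof -
    have "(ln has_real_derivative L' s) (at s)"
      by (rule has_field_derivative_transform_within_open[OF L'(1), where S = "{2<..}"])
         (use that L_ln in auto)
    then show ?thesis
      using DERIV_unique[OF _ DERIV_ln] that by fastforce
  qed
  have L''_ln: "L'' s = - inverse (s * s)" if "s > 2" for s
  proof -
    have "(inverse has_real_derivative L'' s) (at s)"
      by (rule has_field_derivative_transform_within_open[OF L''(1), where S = "{2<..}"])
         (use that L'_ln in auto)
    moreover have "(inverse has_real_derivative - inverse (s * s)) (at s)"
      using that by (auto intro!: derivative_eq_intros)
    ultimately show ?thesis
      using DERIV_unique by blast
  qed
  show thesis
    by (rule that, rule log_cutoff.intro[OF LC L'(1) L''(1) L''_cont])
       (use L_zero L_ln L'_zero L''_zero L'_ln L''_ln in auto)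
qed

section \<open>The Green current on the affine line\<close>

lemma vector_derivative_line:
  fixes \<gamma> :: "complex \<Rightarrow> complex"
  assumes "(\<gamma> has_derivative D) (at 0)"
  shows "vector_derivative (\<lambda>t. \<gamma> (e * complex_of_real t)) (at 0) = D e"
proof -
  have "((\<lambda>t. e * complex_of_real t) has_derivative (\<lambda>t. e * complex_of_real t)) (at 0)"
    by (intro bounded_linear_imp_has_derivative bounded_linear_const_mult bounded_linear_of_real)
  from has_derivative_compose[OF this, of \<gamma> D] assms
  have "((\<lambda>t. \<gamma> (e * complex_of_real t)) has_derivative (\<lambda>t. D (e * complex_of_real t))) (at 0)"
    by simp
  moreover have "D (e * complex_of_real t) = t *\<^sub>R D e" for t
    using linear_scale[OF has_derivative_linear[OF assms], of t e]
    by (simp add: scaleR_conv_of_real mult.commute)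
  ultimately show ?thesis
    by (intro vector_derivative_at) (simp add: has_vector_derivative_def)
qed

text \<open>\<open>D\<close> is only real linear; the two combinations of its values at 1 and \<i>
  extract its complex linear and its antilinear part.\<close>

lemma wirt_eqI: "(\<gamma> has_derivative D) (at 0) \<Longrightarrow> (D 1 - \<i> * D \<i>) / 2 = w \<Longrightarrow> wirt \<gamma> = w"
  and wirtbar_eqI: "(\<gamma> has_derivative D) (at 0) \<Longrightarrow> (D 1 + \<i> * D \<i>) / 2 = w \<Longrightarrow> wirtbar \<gamma> = w"
  using vector_derivative_line[of \<gamma> D 1] vector_derivative_line[of \<gamma> D \<i>]
  by (simp_all add: wirt_def wirtbar_def)

lemma wirt_const [simp]: "wirt (\<lambda>_. a) = 0"
  and wirtbar_const [simp]: "wirtbar (\<lambda>_. a) = 0"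
  by (rule wirt_eqI wirtbar_eqI, rule has_derivative_const, simp)+

lemma norm_diff_integral_le:
  fixes f g :: "'a \<Rightarrow> complex"
  assumes "integrable M f" "integrable M g" "integrable M h" "\<And>x. norm (f x - g x) \<le> h x"
  shows "norm (integral\<^sup>L M f - integral\<^sup>L M g) \<le> integral\<^sup>L M h"
proof -
  have i: "integrable M (\<lambda>x. f x - g x)"
    using assms by (intro Bochner_Integration.integrable_diff)
  have "norm (integral\<^sup>L M (\<lambda>x. f x - g x)) \<le> (\<integral>x. norm (f x - g x) \<partial>M)"
    by (rule integral_norm_bound)
  also have "\<dots> \<le> integral\<^sup>L M h"
    using i assms by (intro integral_mono) auto
  finally have "norm (integral\<^sup>L M (\<lambda>x. f x - g x)) \<le> integral\<^sup>L M h" .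
  then show ?thesis
    using assms by simp
qed

lemma lborel_integral_product:
  fixes f :: "'a::euclidean_space \<Rightarrow> complex" and g :: "'b::euclidean_space \<Rightarrow> complex"
  assumes f: "integrable lborel f" and g: "integrable lborel g"
  shows "integrable lborel (\<lambda>(x, y). f x * g y)"
    and "(LINT p|lborel. (case p of (x, y) \<Rightarrow> f x * g y)) = integral\<^sup>L lborel f * integral\<^sup>L lborel g"
proof -
  have m: "(\<lambda>(x, y). f x * g y) \<in> borel_measurable (lborel \<Otimes>\<^sub>M lborel)"
    using f g by measurable
  have i: "integrable (lborel \<Otimes>\<^sub>M lborel) (\<lambda>(x, y). f x * g y)"
  proof (rule lborel_pair.Fubini_integrable[OF m])
    have "integrable lborel (\<lambda>x. norm (f x) * (LINT y|lborel. norm (g y)))"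
      using f by (intro integrable_mult_left integrable_norm)
    then show "integrable lborel (\<lambda>x. LINT y|lborel. norm (case (x, y) of (x, y) \<Rightarrow> f x * g y))"
      by (simp add: norm_mult)
    show "AE x in lborel. integrable lborel (\<lambda>y. case (x, y) of (x, y) \<Rightarrow> f x * g y)"
      using g by auto
  qed
  then show "integrable lborel (\<lambda>(x, y). f x * g y)"
    by (simp add: lborel_prod)
  have "(LINT p|(lborel \<Otimes>\<^sub>M lborel). (case p of (x, y) \<Rightarrow> f x * g y)) =
      (LINT x|lborel. LINT y|lborel. f x * g y)"
    using lborel_pair.integral_fst'[OF i] by simp
  then show "(LINT p|lborel. (case p of (x, y) \<Rightarrow> f x * g y)) = integral\<^sup>L lborel f * integral\<^sup>L lborel g"
    by (simp add: lborel_prod)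
qed

text \<open>A dilation of the plane by \<open>r\<close> has Jacobian r^2. Hence the Laplacian mass
  of an annulus does not depend on its radius.\<close>

lemma lborel_integral_rescale:
  fixes f :: "complex \<Rightarrow> complex"
  assumes f: "integrable lborel f" and r: "r > 0"
  shows "integrable lborel (\<lambda>x. f ((x - a) / complex_of_real r) / complex_of_real (r\<^sup>2))"
    and "(LINT x|lborel. f ((x - a) / complex_of_real r) / complex_of_real (r\<^sup>2)) = integral\<^sup>L lborel f"
proof -
  let ?F = "\<lambda>x. f ((x - a) / complex_of_real r) / complex_of_real (r\<^sup>2)"
  let ?D = "density (distr lborel borel (\<lambda>x. a + r *\<^sub>R x)) (\<lambda>_. ennreal (r\<^sup>2))"
  have D: "lborel = ?D"
    using lborel_affine[of r a] r by simp
  have m: "f \<in> borel_measurable borel" using f by auto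
  then have mF: "?F \<in> borel_measurable borel" by measurable
  have eq: "(r\<^sup>2) *\<^sub>R ?F (a + r *\<^sub>R x) = f x" for x
    using r by (simp add: scaleR_conv_of_real)
  have "integrable ?D ?F"
  proof -
    have "integrable lborel (\<lambda>x. (r\<^sup>2) *\<^sub>R ?F (a + r *\<^sub>R x))"
      unfolding eq by (rule f)
    then have "integrable (distr lborel borel (\<lambda>x. a + r *\<^sub>R x)) (\<lambda>x. (r\<^sup>2) *\<^sub>R ?F x)"
      using mF by (subst integrable_distr_eq) auto
    then show ?thesis
      using mF by (subst integrable_density) auto
  qed
  then show "integrable lborel ?F"
    using D by simp
  have "integral\<^sup>L ?D ?F = integral\<^sup>L (distr lborel borel (\<lambda>x. a + r *\<^sub>R x)) (\<lambda>x. (r\<^sup>2) *\<^sub>R ?F x)"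
    using mF by (subst integral_density) auto
  also have "\<dots> = (LINT x|lborel. (r\<^sup>2) *\<^sub>R ?F (a + r *\<^sub>R x))"
    using mF by (subst integral_distr) auto
  also have "\<dots> = integral\<^sup>L lborel f"
    unfolding eq ..
  finally show "integral\<^sup>L lborel ?F = integral\<^sup>L lborel f"
    using D by simp
qed

lemma integrable_compact_support:
  fixes f :: "'a::euclidean_space \<Rightarrow> complex"
  assumes "compact S" "continuous_on S f" "\<And>x. x \<notin> S \<Longrightarrow> f x = 0"
  shows "integrable lborel f"
proof -
  have "f = (\<lambda>x. indicator S x *\<^sub>R f x)"
    using assms(3) by (auto simp: indicator_def)
  then show ?thesis
    using borel_integrable_compact[OF assms(1,2)] by simp
qed

text \<open>The polynomial core of the Wirtinger computations, freed of divisions for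
  \<open>algebra\<close>. \<open>U\<close> and \<open>P\<close> stand for the conjugates of u and p,
  and \<open>U * q + \<i> * y\<close> is the real part of \<open>U * q\<close> when \<open>y\<close>
  is the real part of \<open>\<i> * U * q\<close>.\<close>

lemma wirt_radial_algebra:
  fixes a :: complex
  shows "(m * (a * (2 * (U * q + \<i> * y) / k) - a' * (2 * (U * q + \<i> * y) / k') - 0) -
      \<i> * (m * (a * (2 * y / k) - a' * (2 * y / k') - 0))) / 2 = m * q * ((a / k - a' / k') * U)"
proof -
  have "a * (2 * z / k) = a / k * 2 * z" "a' * (2 * z / k') = a' / k' * 2 * z" for z by simp_all
  note this[of "U * q + \<i> * y"] this[of y]
  moreover have "(m * (A * 2 * (U * q + \<i> * y) - A' * 2 * (U * q + \<i> * y) - 0) - \<i> * (m * (A * 2 * y - A' * 2 * y - 0))) / 2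
     = m * q * ((A - A') * U)" for A A' :: complex
    by algebra
  ultimately show ?thesis by presburger
qed

lemma wirtbar_radial_algebra:
  fixes a :: complex
  shows "(m * q * ((a / k - a' / k') * P + (b * (2 * (u * P - \<i> * y) / k) / k - b' * (2 * (u * P - \<i> * y) / k') / k') * U) +
      \<i> * (m * q * ((a / k - a' / k') * (- \<i> * P) + (b * (2 * y / k) / k - b' * (2 * y / k') / k') * U))) / 2
      = m * q * P * ((a + u * U / k * b) / k - (a' + u * U / k' * b') / k')"
proof -
  have "b * (2 * z / k) / k = b / k / k * 2 * z" "b' * (2 * z / k') / k' = b' / k' / k' * 2 * z" 
    "(a + u * U / k * b) / k = a / k + b / k / k * u * U"
    "(a' + u * U / k' * b') / k' = a' / k' + b' / k' / k' * u * U" for z by (simp_all add: add_divide_distrib)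
  note this(3,4) this(1,2)[of "u * P - \<i> * y"] this(1,2)[of y]
  moreover have "(m * q * ((A - A') * P + (B * 2 * (u * P - \<i> * y) - B' * 2 * (u * P - \<i> * y)) * U) +
      \<i> * (m * q * ((A - A') * (- \<i> * P) + (B * 2 * y - B' * 2 * y) * U))) / 2
     = m * q * P * ((A + B * u * U) - (A' + B' * u * U))" for A A' B B' :: complex
    using i_squared by algebra
  ultimately show ?thesis by presburger
qed

section \<open>The Laplacian of the cut-off logarithm\<close>

context log_cutoff
begin

text \<open>This is the mixed Wirtinger derivative of L(|u|^2), a quarter of its Laplacian.\<close>

definition ann :: "complex \<Rightarrow> complex" where
  "ann u = complex_of_real (L' ((norm u)\<^sup>2) + (norm u)\<^sup>2 * L'' ((norm u)\<^sup>2))"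

lemma ann_nonzero: "ann u \<noteq> 0 \<Longrightarrow> 1 \<le> (norm u)\<^sup>2 \<and> (norm u)\<^sup>2 \<le> 2"
  by (metis annulus ann_def not_le of_real_0)

lemma continuous_on_ann: "continuous_on S ann"
proof -
  have "continuous_on UNIV L'"
    using L'' DERIV_isCont by (blast intro: continuous_at_imp_continuous_on)
  then have "continuous_on S (\<lambda>u::complex. L' ((norm u)\<^sup>2))"
    by (rule continuous_on_compose2) (auto intro!: continuous_intros)
  moreover have "continuous_on S (\<lambda>u::complex. L'' ((norm u)\<^sup>2))"
    by (rule continuous_on_compose2[OF L''_cont]) (auto intro!: continuous_intros)
  ultimately show ?thesis
    unfolding ann_def
    by (intro continuous_on_of_real continuous_on_add continuous_on_mult continuous_on_power
        continuous_on_norm continuous_on_id)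
qed

lemma integrable_ann: "integrable lborel ann"
proof (rule integrable_compact_support)
  show "ann x = 0" if "x \<notin> cball 0 2" for x
  proof (rule ccontr)
    assume "ann x \<noteq> 0"
    then have "(norm x)\<^sup>2 \<le> 2\<^sup>2"
      using ann_nonzero[of x] by simp
    then show False
      using that power2_le_imp_le[of "norm x" 2] by simp
  qed
qed (auto intro: continuous_on_ann)

lemma radial_derivative:
  assumes "\<And>s. (f has_real_derivative f' s) (at s)"
  shows "((\<lambda>e. complex_of_real (f ((norm (u + e * q))\<^sup>2 / k))) has_derivative
    (\<lambda>h. complex_of_real (f' ((norm u)\<^sup>2 / k) * (2 * Re (cnj u * (h * q)) / k)))) (at 0)"
proof -
  have D: "((\<lambda>e. u + e * q) has_derivative (\<lambda>h. h * q)) (at 0)"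
    by (auto intro!: derivative_eq_intros)
  have "((\<lambda>e. (u + e * q) \<bullet> (u + e * q)) has_derivative (\<lambda>h. (u + 0 * q) \<bullet> (h * q) + (h * q) \<bullet> (u + 0 * q))) (at 0)"
    by (rule has_derivative_inner[OF D D])
  moreover have "(u + 0 * q) \<bullet> (h * q) + (h * q) \<bullet> (u + 0 * q) = 2 * Re (cnj u * (h * q))" for h
    by (simp add: inner_complex_def)
  ultimately have "((\<lambda>e. (norm (u + e * q))\<^sup>2) has_derivative (\<lambda>h. 2 * Re (cnj u * (h * q)))) (at 0)"
    by (simp add: power2_norm_eq_inner)
  from has_derivative_mult_left[OF this, of "inverse k"]
  have "((\<lambda>e. (norm (u + e * q))\<^sup>2 / k) has_derivative (\<lambda>h. 2 * Re (cnj u * (h * q)) / k)) (at 0)"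
    by (simp add: divide_inverse)
  from has_derivative_compose[OF this, of f "(*) (f' ((norm u)\<^sup>2 / k))"]
  have "((\<lambda>e. f ((norm (u + e * q))\<^sup>2 / k)) has_derivative
    (\<lambda>h. f' ((norm u)\<^sup>2 / k) * (2 * Re (cnj u * (h * q)) / k))) (at 0)"
    using assms[of "(norm u)\<^sup>2 / k"] by (simp add: has_field_derivative_def)
  then show ?thesis
    by (rule bounded_linear.has_derivative[OF bounded_linear_of_real])
qed

text \<open>\<open>k\<close> and \<open>k'\<close> will be the squares of the two radii;
  \<open>m\<close> and \<open>C\<close> absorb whatever does not depend on the first fibre
  coordinate.\<close>

lemma wirt_radial:
  "wirt (\<lambda>e. m * (complex_of_real (L ((norm (u + e * q))\<^sup>2 / k)) -
      complex_of_real (L ((norm (u + e * q))\<^sup>2 / k')) - C)) =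
    m * q * ((complex_of_real (L' ((norm u)\<^sup>2 / k)) / k - complex_of_real (L' ((norm u)\<^sup>2 / k')) / k') * cnj u)"
proof (rule wirt_eqI)
  let ?D = "\<lambda>h. m * (complex_of_real (L' ((norm u)\<^sup>2 / k) * (2 * Re (cnj u * (h * q)) / k)) -
        complex_of_real (L' ((norm u)\<^sup>2 / k') * (2 * Re (cnj u * (h * q)) / k')) - 0)"
  show "((\<lambda>e. m * (complex_of_real (L ((norm (u + e * q))\<^sup>2 / k)) -
      complex_of_real (L ((norm (u + e * q))\<^sup>2 / k')) - C)) has_derivative ?D) (at 0)"
    by (intro has_derivative_mult_right has_derivative_diff has_derivative_const radial_derivative[OF L'])
  have re: "complex_of_real (Re z) - \<i> * complex_of_real (Re (\<i> * z)) = z" for z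
    by (simp add: complex_eq_iff)
  define x y where "x = complex_of_real (Re (cnj u * (1 * q)))" and "y = complex_of_real (Re (cnj u * (\<i> * q)))"
  have "x - \<i> * y = cnj u * q"
    using re[of "cnj u * q"] by (simp add: x_def y_def algebra_simps)
  then have *: "x = cnj u * q + \<i> * y"
    by (simp add: algebra_simps)
  show "(?D 1 - \<i> * ?D \<i>) / 2 =
    m * q * ((complex_of_real (L' ((norm u)\<^sup>2 / k)) / k - complex_of_real (L' ((norm u)\<^sup>2 / k')) / k') * cnj u)"
    unfolding of_real_mult of_real_divide of_real_numeral x_def[symmetric] y_def[symmetric] unfolding *
    by (rule wirt_radial_algebra)
qed

lemma wirtbar_wirt_radial:
  "wirtbar (\<lambda>c. wirt (\<lambda>e. m * (complex_of_real (L ((norm (u + c * p + e * q))\<^sup>2 / k)) -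
      complex_of_real (L ((norm (u + c * p + e * q))\<^sup>2 / k')) - C))) =
    m * q * cnj p * (complex_of_real (L' ((norm u)\<^sup>2 / k) + (norm u)\<^sup>2 / k * L'' ((norm u)\<^sup>2 / k)) / k -
      complex_of_real (L' ((norm u)\<^sup>2 / k') + (norm u)\<^sup>2 / k' * L'' ((norm u)\<^sup>2 / k')) / k')"
  unfolding wirt_radial
proof (rule wirtbar_eqI)
  let ?D = "\<lambda>h. m * q * ((complex_of_real (L' ((norm (u + 0 * p))\<^sup>2 / k)) / k -
        complex_of_real (L' ((norm (u + 0 * p))\<^sup>2 / k')) / k') * cnj (h * p) +
       (complex_of_real (L'' ((norm u)\<^sup>2 / k) * (2 * Re (cnj u * (h * p)) / k)) / k -
        complex_of_real (L'' ((norm u)\<^sup>2 / k') * (2 * Re (cnj u * (h * p)) / k')) / k') * cnj (u + 0 * p))"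
  have c: "((\<lambda>c. cnj (u + c * p)) has_derivative (\<lambda>h. cnj (h * p))) (at 0)"
    by (rule bounded_linear.has_derivative[OF bounded_linear_cnj]) (auto intro!: derivative_eq_intros)
  show "((\<lambda>c. m * q * ((complex_of_real (L' ((norm (u + c * p))\<^sup>2 / k)) / k -
        complex_of_real (L' ((norm (u + c * p))\<^sup>2 / k')) / k') * cnj (u + c * p))) has_derivative
     ?D) (at 0)"
    unfolding divide_inverse[where b = "complex_of_real k"] divide_inverse[where b = "complex_of_real k'"]
    by (intro has_derivative_mult_right has_derivative_mult has_derivative_mult_left has_derivative_diff
        radial_derivative[OF L''] c)
  have re: "complex_of_real (Re z) + \<i> * complex_of_real (Re (\<i> * z)) = cnj z" for z
    by (simp add: complex_eq_iff)
  define x y where "x = complex_of_real (Re (cnj u * p))" and "y = complex_of_real (Re (cnj u * (\<i> * p)))"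
  have "x + \<i> * y = u * cnj p"
    using re[of "cnj u * p"] by (simp add: x_def y_def algebra_simps)
  then have *: "x = u * cnj p - \<i> * y"
    by (simp add: algebra_simps)
  have n: "complex_of_real ((norm u)\<^sup>2) = u * cnj u"
    by (rule complex_norm_square)
  show "(?D 1 + \<i> * ?D \<i>) / 2 =
    m * q * cnj p * (complex_of_real (L' ((norm u)\<^sup>2 / k) + (norm u)\<^sup>2 / k * L'' ((norm u)\<^sup>2 / k)) / k -
      complex_of_real (L' ((norm u)\<^sup>2 / k') + (norm u)\<^sup>2 / k' * L'' ((norm u)\<^sup>2 / k')) / k')"
    unfolding of_real_mult of_real_divide of_real_add of_real_numeral n
      mult_zero_left mult_1_left add_0_right complex_cnj_mult complex_cnj_i
      x_def[symmetric] y_def[symmetric] unfolding *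
    by (rule wirtbar_radial_algebra)
qed

end

section \<open>The test functions\<close>

context log_cutoff
begin

text \<open>Far away both cut-off functions are logarithms that differ by
  \<open>2 * ln (R / r)\<close>; subtracting this constant makes the support compact.\<close>

definition psi :: "complex \<Rightarrow> real \<Rightarrow> real \<Rightarrow> complex \<Rightarrow> complex" where
  "psi a r R x = complex_of_real (L ((norm (x - a))\<^sup>2 / r\<^sup>2)) - complex_of_real (L ((norm (x - a))\<^sup>2 / R\<^sup>2))
     - complex_of_real (2 * ln (R / r))"

definition tester :: "complex^'b \<Rightarrow> complex \<Rightarrow> real \<Rightarrow> complex \<Rightarrow> real \<Rightarrow> real \<Rightarrow> ('b::finite) sq \<Rightarrow> complex" where
  "tester b0 y0 d a r R P = complex_of_real (bump ((norm (fst P - b0))\<^sup>2 / d\<^sup>2)) *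
     complex_of_real (bump ((norm (snd (snd P) - y0))\<^sup>2 / d\<^sup>2)) * psi a r R (fst (snd P))"

lemma psi_eq_0:
  assumes "0 < r" "r < R" "2 * R\<^sup>2 \<le> (norm (x - a))\<^sup>2"
  shows "psi a r R x = 0"
proof -
  have p: "r\<^sup>2 < R\<^sup>2" using assms by (simp add: power_strict_mono)
  have "0 < (norm (x - a))\<^sup>2" using assms p by (smt (verit) zero_le_power2)
  moreover have "(norm (x - a))\<^sup>2 / r\<^sup>2 \<ge> 2" "(norm (x - a))\<^sup>2 / R\<^sup>2 \<ge> 2"
    using assms p by (simp_all add: pos_le_divide_eq)
  ultimately have "L ((norm (x - a))\<^sup>2 / r\<^sup>2) - L ((norm (x - a))\<^sup>2 / R\<^sup>2) = 2 * ln (R / r)"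
    using assms by (simp add: L_ln ln_div ln_realpow)
  then show ?thesis
    unfolding psi_def by (metis diff_self of_real_diff)
qed

text \<open>Between the annuli only the inner cut-off function is active. The radius
  \<open>r\<close> has dropped out, and \<open>R\<close> cancels in the difference of the values at
  y and at s_0, so that both limits can be taken.\<close>

lemma psi_inner:
  assumes "0 < r" "r < R" "2 * r\<^sup>2 \<le> (norm (x - a))\<^sup>2" "(norm (x - a))\<^sup>2 \<le> R\<^sup>2"
  shows "psi a r R x = complex_of_real (2 * ln (norm (x - a)) - 2 * ln R)"
proof -
  have n: "0 < (norm (x - a))\<^sup>2" using assms by (smt (verit) zero_less_power)
  then have n': "0 < norm (x - a)" by simp
  have "(norm (x - a))\<^sup>2 / r\<^sup>2 \<ge> 2" "(norm (x - a))\<^sup>2 / R\<^sup>2 \<le> 1"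
    using assms by (simp_all add: pos_le_divide_eq)
  then have "L ((norm (x - a))\<^sup>2 / r\<^sup>2) = 2 * ln (norm (x - a)) - 2 * ln r" "L ((norm (x - a))\<^sup>2 / R\<^sup>2) = 0"
    using assms n n' by (simp_all add: L_ln L_zero ln_div ln_realpow)
  then have "L ((norm (x - a))\<^sup>2 / r\<^sup>2) - L ((norm (x - a))\<^sup>2 / R\<^sup>2) - 2 * ln (R / r) =
      2 * ln (norm (x - a)) - 2 * ln R"
    using assms by (simp add: ln_div)
  then show ?thesis
    unfolding psi_def by (metis of_real_diff)
qed

lemma bump_nonzero:
  assumes "bump ((norm u)\<^sup>2 / d\<^sup>2) \<noteq> 0" "d > 0"
  shows "norm u < d"
proof -
  have "(norm u)\<^sup>2 / d\<^sup>2 < 1"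
    using assms(1) bump_zero by (meson not_le)
  then have "(norm u)\<^sup>2 < d\<^sup>2"
    using assms(2) by (simp add: divide_less_eq)
  then show ?thesis
    using assms(2) by (meson less_le_not_le power2_less_imp_less order_less_imp_le)
qed

lemma tester_nonzero:
  assumes "tester b0 y0 d a r R (b, x, y) \<noteq> 0" "0 < d" "0 < r" "r < R"
  shows "norm (b - b0) < d" "norm (y - y0) < d" "norm (x - a) \<le> 2 * R"
proof -
  have *: "bump ((norm (b - b0))\<^sup>2 / d\<^sup>2) \<noteq> 0" "bump ((norm (y - y0))\<^sup>2 / d\<^sup>2) \<noteq> 0" "psi a r R x \<noteq> 0"
    using assms(1) by (auto simp: tester_def)
  then show "norm (b - b0) < d" "norm (y - y0) < d"
    using bump_nonzero assms(2) by blast+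
  have "(norm (x - a))\<^sup>2 < 2 * R\<^sup>2"
    using psi_eq_0[OF assms(3,4)] *(3) by (meson not_le)
  also have "\<dots> \<le> (2 * R)\<^sup>2" by (simp add: power2_eq_square)
  finally show "norm (x - a) \<le> 2 * R"
    using assms by (meson less_imp_le power2_le_imp_le zero_le_mult_iff zero_le_numeral less_trans)
qed

lemma Ck_on_tester: "Ck_on k UNIV (tester (b0 :: complex^('b::finite)) y0 d a r R)"
proof -
  have fs: "bounded_linear (\<lambda>P::'b sq. fst (snd P))" "bounded_linear (\<lambda>P::'b sq. snd (snd P))"
    by (intro bounded_linear_compose[OF bounded_linear_fst bounded_linear_snd]
        bounded_linear_compose[OF bounded_linear_snd bounded_linear_snd])+
  show ?thesis
    unfolding tester_def psi_def
    by (intro Ck_on_mult[OF Ck_on_mult[OF Ck_on_compose[OF Ck_on_bump smooth_on_dist_sq[OF bounded_linear_fst]]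
            Ck_on_compose[OF Ck_on_bump smooth_on_dist_sq[OF fs(2)]]]
          Ck_on_diff[OF Ck_on_diff[OF Ck_on_compose[OF L_smooth smooth_on_dist_sq[OF fs(1)]]
              Ck_on_compose[OF L_smooth smooth_on_dist_sq[OF fs(1)]]] Ck_on_const]])
qed

lemma test_function_tester:
  fixes X :: "('b::finite) family"
  assumes "cball b0 d \<subseteq> base X" "0 < d" "0 < r" "r < R"
  shows "test_function X (tester b0 y0 d a r R)"
  unfolding test_function_def
proof (intro conjI exI)
  show "smooth_on UNIV (tester b0 y0 d a r R)"
    by (simp add: smooth_on_def Ck_on_tester)
  show "compact (cball b0 d \<times> cball a (2 * R) \<times> cball y0 d)"
    by (intro compact_Times compact_cball)
  show "cball b0 d \<times> cball a (2 * R) \<times> cball y0 d \<subseteq> base X \<times> UNIV"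
    using assms(1) by auto
  show "\<forall>P. P \<notin> cball b0 d \<times> cball a (2 * R) \<times> cball y0 d \<longrightarrow> tester b0 y0 d a r R P = 0"
  proof (intro allI impI)
    fix P :: "'b sq"
    obtain b x y where P: "P = (b, x, y)" by (metis prod.exhaust)
    assume "P \<notin> cball b0 d \<times> cball a (2 * R) \<times> cball y0 d"
    then show "tester b0 y0 d a r R P = 0"
      using tester_nonzero[OF _ assms(2-4), of b0 y0 a b x y] unfolding P
      by (force simp: dist_norm norm_minus_commute)
  qed
qed

text \<open>The two vectors span the first fibre direction over the reals, so only second
  derivatives of \<open>psi\<close> enter. Antisymmetrization produces the factor
  \<open>\<i> * cnj 1 - 1 * cnj \<i>\<close>, which is 2 \<i>.\<close>

lemma ddbar_tester:
  assumes "0 < r" "0 < R"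
  shows "ddbar (tester b0 y0 d a r R) (b, x, y) (0, 1, 0) (0, \<i>, 0) =
    complex_of_real (bump ((norm (b - b0))\<^sup>2 / d\<^sup>2)) * (2 * \<i> *
      (ann ((x - a) / complex_of_real r) / complex_of_real (r\<^sup>2) - ann ((x - a) / complex_of_real R) / complex_of_real (R\<^sup>2)) *
     complex_of_real (bump ((norm (y - y0))\<^sup>2 / d\<^sup>2)))"
proof -
  define m where "m = complex_of_real (bump ((norm (b - b0))\<^sup>2 / d\<^sup>2)) * complex_of_real (bump ((norm (y - y0))\<^sup>2 / d\<^sup>2))"
  have s: "tester b0 y0 d a r R (shift (shift (b, x, y) c (0, p, 0)) e (0, q, 0)) =
      m * (complex_of_real (L ((norm ((x - a) + c * p + e * q))\<^sup>2 / r\<^sup>2)) -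
        complex_of_real (L ((norm ((x - a) + c * p + e * q))\<^sup>2 / R\<^sup>2)) - complex_of_real (2 * ln (R / r)))" for c e p q
    by (simp add: shift_def tester_def psi_def m_def algebra_simps)
  have ann: "complex_of_real (L' ((norm (x - a))\<^sup>2 / k\<^sup>2) + (norm (x - a))\<^sup>2 / k\<^sup>2 * L'' ((norm (x - a))\<^sup>2 / k\<^sup>2)) / complex_of_real (k\<^sup>2)
      = ann ((x - a) / complex_of_real k) / complex_of_real (k\<^sup>2)" if "k > 0" for k
    using that by (simp add: ann_def norm_divide power_divide)
  show ?thesis
    unfolding ddbar_def s wirtbar_wirt_radial ann[OF assms(1)] ann[OF assms(2)]
    by (simp add: m_def algebra_simps)
qed

end

section \<open>The current equation on the test functions\<close>

lemma green_currentD: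
  assumes "green_current X G"
  shows "smooth_on (off_divisors X k1 k2) (in_charts G k1 k2)"
    and "compact K \<Longrightarrow> K \<subseteq> base X \<times> UNIV \<Longrightarrow> set_integrable lborel K (in_charts G k1 k2)"
    and "test_function X \<phi> \<Longrightarrow> (LINT P|lborel. in_charts G k1 k2 P * ddbar \<phi> P p q) =
          delta_diag X k1 k2 \<phi> p q - (delta_sec1 X k1 \<phi> p q + delta_sec2 X k2 \<phi> p q)"
    and "b \<in> base X \<Longrightarrow> y \<noteq> Aff (sec0 X b) \<Longrightarrow> open U \<and> sec0 X b \<in> U \<and> t holomorphic_on U \<and>
      t (sec0 X b) = 0 \<and> deriv t (sec0 X b) * tvec X b = 1 \<Longrightarrow>
      ((\<lambda>x. G b (Aff x) y + 1 / (of_real pi * \<i>) * of_real (ln (norm (t x)))) \<longlongrightarrow> 0) (at (sec0 X b))"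
proof -
  note g = assms[unfolded green_current_def]
  show "smooth_on (off_divisors X k1 k2) (in_charts G k1 k2)"
    by (rule g[THEN conjunct1, rule_format])
  show "compact K \<Longrightarrow> K \<subseteq> base X \<times> UNIV \<Longrightarrow> set_integrable lborel K (in_charts G k1 k2)"
    by (rule g[THEN conjunct2, THEN conjunct1, rule_format, OF conjI])
  show "test_function X \<phi> \<Longrightarrow> (LINT P|lborel. in_charts G k1 k2 P * ddbar \<phi> P p q) =
          delta_diag X k1 k2 \<phi> p q - (delta_sec1 X k1 \<phi> p q + delta_sec2 X k2 \<phi> p q)"
    by (rule g[THEN conjunct2, THEN conjunct2, THEN conjunct1, rule_format])
  show "b \<in> base X \<Longrightarrow> y \<noteq> Aff (sec0 X b) \<Longrightarrow> open U \<and> sec0 X b \<in> U \<and> t holomorphic_on U \<and>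
      t (sec0 X b) = 0 \<and> deriv t (sec0 X b) * tvec X b = 1 \<Longrightarrow>
      ((\<lambda>x. G b (Aff x) y + 1 / (of_real pi * \<i>) * of_real (ln (norm (t x)))) \<longlongrightarrow> 0) (at (sec0 X b))"
    by (rule g[THEN conjunct2, THEN conjunct2, THEN conjunct2, rule_format])
qed

lemma coord_Aff [simp]: "coord False (Aff y) = y"
  by (simp add: coord_def chart_def)

lemma chart_False [simp]: "chart False y = Aff y"
  by (simp add: chart_def)

lemma Aff_in_range_chart [simp]: "Aff y \<in> range (chart False)"
  by (metis chart_False rangeI)

lemma holo_isCont:
  assumes "holo U f" "b \<in> U"
  shows "isCont f b"
  using assms has_derivative_continuous unfolding holo_def by blast

context log_cutoff
begin

text \<open>For the diagonal and for the first divisor \<theta> takes the values 1 and \<i> on these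
  vectors, which makes the (1,1)-form in \<open>graph_current\<close> equal to 1. The second divisor
  is tangent to this direction, so its \<theta> vanishes there.\<close>

lemma green_test:
  fixes X :: "('b::finite) family" and y0 :: complex
  assumes X: "pointed_family n X" and G: "green_current X G"
    and d: "cball b0 d \<subseteq> base X" "0 < d" and r: "0 < r" "r < R"
  defines "chi \<equiv> (\<lambda>b y. complex_of_real (bump ((norm (b - b0))\<^sup>2 / d\<^sup>2)) * complex_of_real (bump ((norm (y - y0))\<^sup>2 / d\<^sup>2)))"
  shows "(LINT P|lborel. in_charts G False False P * ddbar (tester b0 y0 d a r R) P (0, 1, 0) (0, \<i>, 0)) =
    (LINT w|lborel. (case w of (b, y) \<Rightarrow> chi b y * psi a r R y))
    - (LINT w|lborel. (case w of (b, y) \<Rightarrow> chi b y * psi a r R (sec0 X b)))"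
proof -
  let ?t = "tester b0 y0 d a r R"
  \<comment> \<open>The bump in the base lives inside \<open>base X\<close>, so the integrals over
    the domains of the graphs may be extended to the whole space.\<close>
  have chi0: "chi b y = 0" if "b \<notin> base X" for b y
    using bump_nonzero[OF _ d(2), of "b - b0"] that d(1)
    by (force simp: chi_def dist_norm norm_minus_commute)
  have "(LINT P|lborel. in_charts G False False P * ddbar ?t P (0, 1, 0) (0, \<i>, 0)) =
      delta_diag X False False ?t (0, 1, 0) (0, \<i>, 0) -
        (delta_sec1 X False ?t (0, 1, 0) (0, \<i>, 0) + delta_sec2 X False ?t (0, 1, 0) (0, \<i>, 0))"
    by (rule green_currentD(3)[OF G test_function_tester[OF d r]])
  also have "delta_diag X False False ?t (0, 1, 0) (0, \<i>, 0) =
      (LINT w|lborel. (case w of (b, y) \<Rightarrow> chi b y * psi a r R y))"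
    unfolding delta_diag_def graph_current_def set_lebesgue_integral_def
    by (rule Bochner_Integration.integral_cong)
       (auto simp: indicator_def tester_def chi_def Let_def chi0[unfolded chi_def] split: prod.splits)
  also have "delta_sec1 X False ?t (0, 1, 0) (0, \<i>, 0) =
      (LINT w|lborel. (case w of (b, y) \<Rightarrow> chi b y * psi a r R (sec0 X b)))"
    unfolding delta_sec1_def graph_current_def set_lebesgue_integral_def
    by (rule Bochner_Integration.integral_cong)
       (auto simp: indicator_def tester_def chi_def Let_def chi0[unfolded chi_def] split: prod.splits)
  also have "delta_sec2 X False ?t (0, 1, 0) (0, \<i>, 0) = 0"
    unfolding delta_sec2_def delta_sec1_def graph_current_def set_lebesgue_integral_def
    by (auto simp: swap_sq_def Let_def split: prod.splits)
  finally show ?thesis by simp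
qed

text \<open>Across the divisors \<open>G\<close> is only known to be locally integrable, so
  everything rests on the boundedness of \<open>f\<close> on a compact set outside which it
  vanishes.\<close>

lemma integrable_in_charts_mult:
  fixes X :: "('b::finite) family"
  assumes G: "green_current X G" and K: "compact K" "K \<subseteq> base X \<times> UNIV"
    and f: "continuous_on UNIV f" "\<And>P. P \<notin> K \<Longrightarrow> f P = 0"
  shows "integrable lborel (\<lambda>P. in_charts G k1 k2 P * f P)"
proof -
  have i: "integrable lborel (\<lambda>P. indicator K P *\<^sub>R in_charts G k1 k2 P)"
    using green_currentD(2)[OF G K] unfolding set_integrable_def .
  have "bounded (f ` K)"
    using compact_continuous_image[OF continuous_on_subset[OF f(1)] K(1)] compact_imp_bounded by blast
  then obtain C where C: "\<And>P. P \<in> K \<Longrightarrow> norm (f P) \<le> C"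
    unfolding bounded_iff by blast
  have eq: "in_charts G k1 k2 P * f P = indicator K P *\<^sub>R in_charts G k1 k2 P * f P" for P
    using f(2) by (auto simp: indicator_def)
  have "integrable lborel (\<lambda>P. indicator K P *\<^sub>R in_charts G k1 k2 P * f P)"
  proof (rule Bochner_Integration.integrable_bound)
    show "integrable lborel (\<lambda>P. (indicator K P *\<^sub>R in_charts G k1 k2 P) * complex_of_real C)"
      using i by (rule integrable_mult_left)
    have "f \<in> borel_measurable borel"
      using f(1) by (rule borel_measurable_continuous_onI)
    then show "(\<lambda>P. indicator K P *\<^sub>R in_charts G k1 k2 P * f P) \<in> borel_measurable lborel"
      using i by (intro borel_measurable_times) auto
    show "AE P in lborel. norm (indicator K P *\<^sub>R in_charts G k1 k2 P * f P)
        \<le> norm ((indicator K P *\<^sub>R in_charts G k1 k2 P) * complex_of_real C)"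
      using C by (auto simp: indicator_def norm_mult intro!: AE_I2 mult_left_mono order_trans[OF C abs_ge_self])
  qed
  then show ?thesis
    unfolding eq .
qed

end

lemma lborel_integral_product3:
  fixes f :: "'a::euclidean_space \<Rightarrow> complex" and g :: "'b::euclidean_space \<Rightarrow> complex"
    and h :: "'c::euclidean_space \<Rightarrow> complex"
  assumes "integrable lborel f" "integrable lborel g" "integrable lborel h"
  shows "integrable lborel (\<lambda>(x, y, z). f x * (g y * h z))"
    and "(LINT p|lborel. (case p of (x, y, z) \<Rightarrow> f x * (g y * h z))) =
      integral\<^sup>L lborel f * (integral\<^sup>L lborel g * integral\<^sup>L lborel h)"
proof -
  have "(\<lambda>(x, y, z). f x * (g y * h z)) = (\<lambda>(x, p). f x * (case p of (y, z) \<Rightarrow> g y * h z))"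
    by (auto simp: fun_eq_iff)
  then show "integrable lborel (\<lambda>(x, y, z). f x * (g y * h z))"
    and "(LINT p|lborel. (case p of (x, y, z) \<Rightarrow> f x * (g y * h z))) =
      integral\<^sup>L lborel f * (integral\<^sup>L lborel g * integral\<^sup>L lborel h)"
    using lborel_integral_product[OF assms(2,3)]
      lborel_integral_product[OF assms(1) lborel_integral_product(1)[OF assms(2,3)]] by simp_all
qed

lemma continuous_on_bump: "continuous_on UNIV bump"
proof -
  have "continuous_on UNIV (\<lambda>s. Re (complex_of_real (bump s)))"
    using Ck_on_bump[of 0] by (intro continuous_on_Re) auto
  then show ?thesis by simp
qed

lemma continuous_on_bump_dist:
  "continuous_on S (\<lambda>x. complex_of_real (bump ((norm (x - a))\<^sup>2 / d\<^sup>2)))"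
proof (cases "d = 0")
  case False
  then have "continuous_on S (\<lambda>x. bump ((norm (x - a))\<^sup>2 / d\<^sup>2))"
    by (intro continuous_on_compose2[OF continuous_on_bump, where f = "\<lambda>x. (norm (x - a))\<^sup>2 / d\<^sup>2"])
       (auto intro!: continuous_intros)
  then show ?thesis
    by (rule continuous_on_of_real)
qed auto

lemma (in log_cutoff) bump_dist_eq_0:
  assumes "d > 0" "x \<notin> cball a d"
  shows "bump ((norm (x - a))\<^sup>2 / d\<^sup>2) = 0"
  using bump_nonzero[of "x - a" d] assms by (force simp: dist_norm norm_minus_commute)

text \<open>Positivity is what later permits cancelling the mass of the bumps from the
  estimate.\<close>

lemma (in log_cutoff) bump_dist_integral:
  fixes a :: "'a::euclidean_space"
  assumes d: "d > 0"
  shows "integrable lborel (\<lambda>x. complex_of_real (bump ((norm (x - a))\<^sup>2 / d\<^sup>2)))"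
    and "\<exists>m>0. (LINT x|lborel. complex_of_real (bump ((norm (x - a))\<^sup>2 / d\<^sup>2))) = complex_of_real m"
proof -
  let ?f = "\<lambda>x. bump ((norm (x - a))\<^sup>2 / d\<^sup>2)"
  show i: "integrable lborel (\<lambda>x. complex_of_real (?f x))"
    by (rule integrable_compact_support[of "cball a d"])
       (use bump_dist_eq_0[OF d] continuous_on_bump_dist in auto)
  then have i': "integrable lborel ?f"
    using complex_of_real_integrable_eq by blast
  have "integral\<^sup>L lborel ?f \<noteq> 0"
  proof
    assume "integral\<^sup>L lborel ?f = 0"
    then have "AE x in lborel. ?f x = 0"
      using integral_nonneg_eq_0_iff_AE[OF i'] bump_nonneg by auto
    then have "emeasure lborel {x. ?f x \<noteq> 0} = 0"
      using i' by (subst (asm) AE_iff_measurable[OF _ refl]) auto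
    moreover have "ball a d \<subseteq> {x. ?f x \<noteq> 0}"
    proof
      fix x assume "x \<in> ball a d"
      then have "(norm (x - a))\<^sup>2 < d\<^sup>2"
        by (intro power_strict_mono) (auto simp: dist_norm norm_minus_commute)
      then have "bump ((norm (x - a))\<^sup>2 / d\<^sup>2) > 0"
        using d by (intro bump_pos) (simp add: divide_less_eq)
      then show "x \<in> {x. ?f x \<noteq> 0}" by simp
    qed
    moreover have "{x. ?f x \<noteq> 0} \<in> sets lborel"
      using i' by measurable
    ultimately have "emeasure lborel (ball a d) = 0"
      using emeasure_mono[of "ball a d" "{x. ?f x \<noteq> 0}" lborel] by simp
    then show False
      using emeasure_ball[of d a] d by (simp add: unit_ball_vol_pos less_imp_neq[symmetric])
  qed
  moreover have "integral\<^sup>L lborel ?f \<ge> 0"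
    by (intro Bochner_Integration.integral_nonneg bump_nonneg)
  ultimately show "\<exists>m>0. (LINT x|lborel. complex_of_real (?f x)) = complex_of_real m"
    by (intro exI[of _ "integral\<^sup>L lborel ?f"]) (auto simp: integral_complex_of_real)
qed

lemma (in log_cutoff) ann_dist_nonzero:
  assumes "ann ((x - a) / complex_of_real r) \<noteq> 0" "r > 0"
  shows "r \<le> norm (x - a)" "norm (x - a) \<le> 2 * r"
proof -
  have *: "1\<^sup>2 \<le> (norm (x - a) / r)\<^sup>2" "(norm (x - a) / r)\<^sup>2 \<le> 2\<^sup>2"
    using ann_nonzero[OF assms(1)] assms(2) by (auto simp: norm_divide)
  then have "1 \<le> norm (x - a) / r"
    using assms(2) by (intro power2_le_imp_le[OF *(1)]) auto
  then show "r \<le> norm (x - a)" using assms(2) by (simp add: le_divide_eq)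
  have "norm (x - a) / r \<le> 2"
    by (intro power2_le_imp_le[OF *(2)]) auto
  then show "norm (x - a) \<le> 2 * r" using assms(2) by (simp add: divide_le_eq)
qed

text \<open>On the inner annulus \<open>G\<close> is close to \<open>A\<close>, on the outer one to
  \<open>B\<close>, and both annuli carry the same Laplacian mass with opposite signs. Up to the
  mass of the bumps the current equation therefore compares 2 \<i> times that mass times
  \<open>A - B\<close> with \<open>l\<close>. In the bound, 4 counts two annuli times the modulus of
  2 \<i>, and 1 comes from the logarithms.\<close>

lemma (in log_cutoff) green_estimate:
  fixes X :: "('b::finite) family" and x0 y0 :: complex and l :: real
  assumes X: "pointed_family n X" and G: "green_current X G"
    and d: "cball b0 d \<subseteq> base X" "0 < d" and r: "0 < r" "r < R" and e: "0 < e"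
    and h1: "\<And>b x y. norm (b - b0) < d \<Longrightarrow> norm (y - y0) < d \<Longrightarrow> norm (x - x0) \<le> 2 * r \<Longrightarrow>
        norm (in_charts G False False (b, x, y) - A) \<le> e"
    and h2: "\<And>b x y. norm (b - b0) < d \<Longrightarrow> norm (y - y0) < d \<Longrightarrow> R \<le> norm (x - x0) \<Longrightarrow>
        norm (in_charts G False False (b, x, y) - B) \<le> e"
    and h3: "\<And>y. norm (y - y0) < d \<Longrightarrow> 2 * r\<^sup>2 \<le> (norm (y - x0))\<^sup>2 \<and> (norm (y - x0))\<^sup>2 \<le> R\<^sup>2"
    and h4: "\<And>b. norm (b - b0) < d \<Longrightarrow> 2 * r\<^sup>2 \<le> (norm (sec0 X b - x0))\<^sup>2 \<and> (norm (sec0 X b - x0))\<^sup>2 \<le> R\<^sup>2"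
    and h5: "\<And>b y. norm (b - b0) < d \<Longrightarrow> norm (y - y0) < d \<Longrightarrow>
        \<bar>2 * ln (norm (y - x0)) - 2 * ln (norm (sec0 X b - x0)) - l\<bar> \<le> e"
  shows "norm (2 * \<i> * integral\<^sup>L lborel ann * (A - B) - complex_of_real l) \<le>
    e * (4 * (LINT u|lborel. norm (ann u)) + 1)"
proof -
  define \<beta> where "\<beta> = (\<lambda>b. complex_of_real (bump ((norm (b - b0))\<^sup>2 / d\<^sup>2)))"
  define \<eta> where "\<eta> = (\<lambda>y. complex_of_real (bump ((norm (y - y0))\<^sup>2 / d\<^sup>2)))"
  \<comment> \<open>The profile \<open>f\<close> moved to \<open>x0\<close> and scaled to radius
    \<open>k\<close>, with unchanged integral.\<close>
  define \<rho> where "\<rho> = (\<lambda>f k x. f ((x - x0) / complex_of_real k) / complex_of_real (k\<^sup>2))"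
  have R: "0 < R" using r by simp
  have i\<beta>: "integrable lborel \<beta>" and i\<eta>: "integrable lborel \<eta>"
    unfolding \<beta>_def \<eta>_def by (rule bump_dist_integral[OF d(2)])+
  obtain m1 m2 where m: "m1 > 0" "integral\<^sup>L lborel \<beta> = complex_of_real m1"
      "m2 > 0" "integral\<^sup>L lborel \<eta> = complex_of_real m2"
    unfolding \<beta>_def \<eta>_def using bump_dist_integral(2)[OF d(2)] by metis
  have \<beta>_nz: "norm (b - b0) < d" if "\<beta> b \<noteq> 0" for b
    using bump_nonzero[OF _ d(2)] that by (auto simp: \<beta>_def)
  have \<eta>_nz: "norm (y - y0) < d" if "\<eta> y \<noteq> 0" for y
    using bump_nonzero[OF _ d(2)] that by (auto simp: \<eta>_def)
  have \<beta>_norm: "complex_of_real (norm (\<beta> b)) = \<beta> b" for b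
    using bump_nonneg by (simp add: \<beta>_def)
  have \<eta>_norm: "complex_of_real (norm (\<eta> y)) = \<eta> y" for y
    using bump_nonneg by (simp add: \<eta>_def)
  have i_ann: "integrable lborel ann" "integrable lborel (\<lambda>u. complex_of_real (norm (ann u)))"
    using integrable_ann by (auto intro: integrable_of_real integrable_norm)
  have i\<rho>: "integrable lborel (\<rho> f k)" "integral\<^sup>L lborel (\<rho> f k) = integral\<^sup>L lborel f"
    if "integrable lborel f" "k > 0" for f k
    unfolding \<rho>_def using lborel_integral_rescale[OF that, of x0] by auto
  define c where "c = integral\<^sup>L lborel ann"
  define N where "N = (LINT u|lborel. norm (ann u))"
  define na where "na = (\<lambda>u. complex_of_real (norm (ann u)))"
  have N: "integral\<^sup>L lborel na = complex_of_real N"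
    unfolding na_def N_def by (rule integral_complex_of_real)
  define f where "f = (\<lambda>P. in_charts G False False P * ddbar (tester b0 y0 d x0 r R) P (0, 1, 0) (0, \<i>, 0))"
  have dd: "ddbar (tester b0 y0 d x0 r R) (b, x, y) (0, 1, 0) (0, \<i>, 0) =
      \<beta> b * (2 * \<i> * (\<rho> ann r x - \<rho> ann R x) * \<eta> y)" for b x y
    unfolding \<beta>_def \<rho>_def \<eta>_def by (rule ddbar_tester[OF r(1) R])
  have \<rho>_nz: "k \<le> norm (x - x0) \<and> norm (x - x0) \<le> 2 * k" if "\<rho> ann k x \<noteq> 0" "k > 0" for k x
    using ann_dist_nonzero[of x x0 k] that by (auto simp: \<rho>_def)
  have "integrable lborel f"
    unfolding f_def
  proof (rule integrable_in_charts_mult[OF G])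
    show "compact (cball b0 d \<times> cball x0 (2 * R) \<times> cball y0 d)"
      by (intro compact_Times compact_cball)
    show "cball b0 d \<times> cball x0 (2 * R) \<times> cball y0 d \<subseteq> base X \<times> UNIV"
      using d(1) by auto
    have c\<rho>: "continuous_on UNIV (\<lambda>P::'b sq. \<rho> ann k (fst (snd P)))" for k
      unfolding \<rho>_def
      by (cases "k = 0") (auto intro!: continuous_intros continuous_on_compose2[OF continuous_on_ann[of UNIV]])
    have c\<beta>: "continuous_on UNIV (\<lambda>P::'b sq. \<beta> (fst P))" "continuous_on UNIV (\<lambda>P::'b sq. \<eta> (snd (snd P)))"
      unfolding \<beta>_def \<eta>_def
      by (rule continuous_on_compose2[OF continuous_on_bump_dist[of UNIV]];
          (intro continuous_intros subset_UNIV)?)+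
    have eq: "(\<lambda>P. ddbar (tester b0 y0 d x0 r R) P (0, 1, 0) (0, \<i>, 0)) =
        (\<lambda>P. \<beta> (fst P) * (2 * \<i> * (\<rho> ann r (fst (snd P)) - \<rho> ann R (fst (snd P))) * \<eta> (snd (snd P))))"
      using dd by (auto simp: fun_eq_iff)
    show "continuous_on UNIV (\<lambda>P. ddbar (tester b0 y0 d x0 r R) P (0, 1, 0) (0, \<i>, 0))"
      unfolding eq by (intro continuous_on_mult continuous_on_diff continuous_on_const c\<rho> c\<beta>)
    fix P :: "'b sq"
    obtain b x y where P: "P = (b, x, y)" by (metis prod.exhaust)
    assume "P \<notin> cball b0 d \<times> cball x0 (2 * R) \<times> cball y0 d"
    then have "\<beta> b = 0 \<or> \<eta> y = 0 \<or> (\<rho> ann r x = 0 \<and> \<rho> ann R x = 0)"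
      using \<beta>_nz[of b] \<eta>_nz[of y] \<rho>_nz[of r x] \<rho>_nz[of R x] r
      unfolding P by (force simp: dist_norm norm_minus_commute)
    then show "ddbar (tester b0 y0 d x0 r R) P (0, 1, 0) (0, \<i>, 0) = 0"
      unfolding P dd by auto
  qed
  \<comment> \<open>In \<open>g\<close> the function \<open>G\<close> is replaced by its approximate
    values on the two annuli; \<open>h\<close> dominates the error made.\<close>
  define g where "g = (\<lambda>(b, x, y). \<beta> b * ((2 * \<i> * (A * \<rho> ann r x - B * \<rho> ann R x)) * \<eta> y))"
  define h where "h = (\<lambda>(b, x, y). \<beta> b * ((complex_of_real (2 * e) * (\<rho> na r x + \<rho> na R x)) * \<eta> y))"
  have ina: "integrable lborel na" using i_ann by (simp add: na_def)
  have k1: "integrable lborel (\<lambda>x. 2 * \<i> * (A * \<rho> ann r x - B * \<rho> ann R x))"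
    and k1': "(LINT x|lborel. 2 * \<i> * (A * \<rho> ann r x - B * \<rho> ann R x)) = 2 * \<i> * (A * c - B * c)"
    using i\<rho>[OF i_ann(1) r(1)] i\<rho>[OF i_ann(1) R] by (simp_all add: c_def)
  have k2: "integrable lborel (\<lambda>x. complex_of_real (2 * e) * (\<rho> na r x + \<rho> na R x))"
    and k2': "(LINT x|lborel. complex_of_real (2 * e) * (\<rho> na r x + \<rho> na R x)) = complex_of_real (2 * e) * (N + N)"
    using i\<rho>[OF ina r(1)] i\<rho>[OF ina R] by (simp_all add: N)
  have ig: "integrable lborel g" "integral\<^sup>L lborel g = m1 * ((2 * \<i> * (A * c - B * c)) * m2)"
    unfolding g_def using lborel_integral_product3[OF i\<beta> k1 i\<eta>] unfolding k1' m by auto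
  have ih: "integrable lborel h" "integral\<^sup>L lborel h = m1 * ((complex_of_real (2 * e) * (N + N)) * m2)"
    unfolding h_def using lborel_integral_product3[OF i\<beta> k2 i\<eta>] unfolding k2' m by auto
  have "norm (integral\<^sup>L lborel f - integral\<^sup>L lborel g) \<le> (LINT P|lborel. Re (h P))"
  proof (rule norm_diff_integral_le)
    show "integrable lborel f" by fact
    show "integrable lborel g" by fact
    show "integrable lborel (\<lambda>P. Re (h P))" using ih(1) by simp
    fix P :: "'b sq"
    obtain b x y where P: "P = (b, x, y)" by (metis prod.exhaust)
    let ?G = "in_charts G False False (b, x, y)"
    have \<rho>_norm: "complex_of_real (norm (\<rho> ann k x)) = \<rho> na k x" for k
      by (simp add: \<rho>_def na_def norm_divide norm_power)
    have h_eq: "h P = complex_of_real (norm (\<beta> b) * norm (\<eta> y) * (2 * e * (norm (\<rho> ann r x) + norm (\<rho> ann R x))))"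
      by (simp add: h_def P \<beta>_norm \<eta>_norm \<rho>_norm algebra_simps)
    have fg: "f P - g P = \<beta> b * \<eta> y * (2 * \<i> * ((?G - A) * \<rho> ann r x - (?G - B) * \<rho> ann R x))"
      by (simp add: f_def g_def P dd algebra_simps)
    show "norm (f P - g P) \<le> Re (h P)"
    proof (cases "\<beta> b = 0 \<or> \<eta> y = 0")
      case True
      then show ?thesis unfolding fg h_eq by auto
    next
      case False
      then have bd: "norm (b - b0) < d" "norm (y - y0) < d" using \<beta>_nz \<eta>_nz by auto
      have 1: "norm ((?G - A) * \<rho> ann r x) \<le> e * norm (\<rho> ann r x)"
        using h1[OF bd, of x] \<rho>_nz[of r x] r by (cases "\<rho> ann r x = 0") (auto simp: norm_mult intro!: mult_right_mono)
      have 2: "norm ((?G - B) * \<rho> ann R x) \<le> e * norm (\<rho> ann R x)"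
        using h2[OF bd, of x] \<rho>_nz[of R x] R by (cases "\<rho> ann R x = 0") (auto simp: norm_mult intro!: mult_right_mono)
      have "norm ((?G - A) * \<rho> ann r x - (?G - B) * \<rho> ann R x) \<le> e * (norm (\<rho> ann r x) + norm (\<rho> ann R x))"
        using norm_triangle_ineq4[of "(?G - A) * \<rho> ann r x" "(?G - B) * \<rho> ann R x"] 1 2
        by (simp add: distrib_left)
      then have "norm (f P - g P) \<le> norm (\<beta> b) * norm (\<eta> y) * (2 * (e * (norm (\<rho> ann r x) + norm (\<rho> ann R x))))"
        unfolding fg norm_mult by (intro mult_left_mono) auto
      then show ?thesis unfolding h_eq by (simp add: mult.assoc)
    qed
  qed
  also have "(LINT P|lborel. Re (h P)) = m1 * m2 * (4 * e * N)"
    using integral_Re[OF ih(1)] ih(2) by simp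
  finally have est1: "norm (integral\<^sup>L lborel f - integral\<^sup>L lborel g) \<le> m1 * m2 * (4 * e * N)" .

  define f1 where "f1 = (\<lambda>(b::complex^'b, y). \<beta> b * \<eta> y * psi x0 r R y)"
  define f2 where "f2 = (\<lambda>(b, y). \<beta> b * \<eta> y * psi x0 r R (sec0 X b))"
  have int_f: "integral\<^sup>L lborel f = integral\<^sup>L lborel f1 - integral\<^sup>L lborel f2"
    unfolding f_def f1_def f2_def \<beta>_def \<eta>_def by (rule green_test[OF X G d r])
  have c_psi: "continuous_on S (psi x0 r R)" for S
  proof -
    have "continuous_on UNIV (\<lambda>s. Re (complex_of_real (L s)))"
      using L_smooth[of 0] by (intro continuous_on_Re) auto
    then have c: "continuous_on UNIV L" by simp
    have "continuous_on S (\<lambda>x. L ((norm (x - x0))\<^sup>2 / k\<^sup>2))" if "k > 0" for k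
      by (rule continuous_on_compose2[OF c]) (use that in \<open>auto intro!: continuous_intros\<close>)
    from this[OF r(1)] this[OF R] show ?thesis
      unfolding psi_def by (intro continuous_on_diff continuous_on_of_real continuous_on_const)
  qed
  have c_sec: "continuous_on (cball b0 d) (sec0 X)"
    using X d(1) holo_isCont unfolding pointed_family_def
    by (blast intro: continuous_at_imp_continuous_on)
  have zero: "\<beta> b * \<eta> y = 0" if "(b, y) \<notin> cball b0 d \<times> cball y0 d" for b y
    using that \<beta>_nz[of b] \<eta>_nz[of y] by (force simp: dist_norm norm_minus_commute)
  have c\<beta>\<eta>: "continuous_on S (\<lambda>p. \<beta> (fst p) * \<eta> (snd p))" for S :: "((complex^'b) \<times> complex) set"
    unfolding \<beta>_def \<eta>_def
    by (intro continuous_on_mult continuous_on_compose2[OF continuous_on_bump_dist[of UNIV]]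
        continuous_on_fst continuous_on_snd continuous_on_id) auto
  have i1: "integrable lborel f1"
  proof (rule integrable_compact_support)
    show "compact (cball b0 d \<times> cball y0 d)" by (intro compact_Times compact_cball)
    have eq: "f1 = (\<lambda>p. \<beta> (fst p) * \<eta> (snd p) * psi x0 r R (snd p))"
      by (auto simp: f1_def)
    show "continuous_on (cball b0 d \<times> cball y0 d) f1"
      unfolding eq
      by (rule continuous_on_mult[OF c\<beta>\<eta> continuous_on_compose2[OF c_psi[of UNIV]]])
         (auto intro!: continuous_intros)
    show "f1 p = 0" if "p \<notin> cball b0 d \<times> cball y0 d" for p
      using zero[of "fst p" "snd p"] that unfolding eq by simp
  qed
  have i2: "integrable lborel f2"
  proof (rule integrable_compact_support)
    show "compact (cball b0 d \<times> cball y0 d)" by (intro compact_Times compact_cball)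
    have eq: "f2 = (\<lambda>p. \<beta> (fst p) * \<eta> (snd p) * psi x0 r R (sec0 X (fst p)))"
      by (auto simp: f2_def)
    have "continuous_on (cball b0 d \<times> cball y0 d) (\<lambda>p. sec0 X (fst p))"
      by (rule continuous_on_compose2[OF c_sec]) (auto intro!: continuous_intros)
    then show "continuous_on (cball b0 d \<times> cball y0 d) f2"
      unfolding eq
      by (rule continuous_on_mult[OF c\<beta>\<eta> continuous_on_compose2[OF c_psi[of UNIV]]]) auto
    show "f2 p = 0" if "p \<notin> cball b0 d \<times> cball y0 d" for p
      using zero[of "fst p" "snd p"] that unfolding eq by simp
  qed
  define g' where "g' = (\<lambda>(b, y). \<beta> b * (complex_of_real l * \<eta> y))"
  define h' where "h' = (\<lambda>(b, y). \<beta> b * (complex_of_real e * \<eta> y))"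
  have ig': "integrable lborel g'" "integral\<^sup>L lborel g' = m1 * (l * m2)"
    unfolding g'_def using lborel_integral_product[OF i\<beta> integrable_mult_right[OF i\<eta>]] by (auto simp: m)
  have ih': "integrable lborel h'" "integral\<^sup>L lborel h' = m1 * (e * m2)"
    unfolding h'_def using lborel_integral_product[OF i\<beta> integrable_mult_right[OF i\<eta>]] by (auto simp: m)
  have "norm (integral\<^sup>L lborel (\<lambda>p. f1 p - f2 p) - integral\<^sup>L lborel g') \<le> (LINT P|lborel. Re (h' P))"
  proof (rule norm_diff_integral_le)
    show "integrable lborel (\<lambda>p. f1 p - f2 p)" using i1 i2 by simp
    show "integrable lborel g'" by fact
    show "integrable lborel (\<lambda>P. Re (h' P))" using ih'(1) by simp
    fix P :: "(complex^'b) \<times> complex"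
    obtain b y where P: "P = (b, y)" by (metis prod.exhaust)
    have h_eq: "h' P = complex_of_real (norm (\<beta> b) * norm (\<eta> y) * e)"
      by (simp add: h'_def P \<beta>_norm \<eta>_norm algebra_simps)
    have fg: "f1 P - f2 P - g' P = \<beta> b * \<eta> y * (psi x0 r R y - psi x0 r R (sec0 X b) - complex_of_real l)"
      by (simp add: f1_def f2_def g'_def P algebra_simps)
    show "norm (f1 P - f2 P - g' P) \<le> Re (h' P)"
    proof (cases "\<beta> b = 0 \<or> \<eta> y = 0")
      case True
      then show ?thesis unfolding fg h_eq by auto
    next
      case False
      then have bd: "norm (b - b0) < d" "norm (y - y0) < d" using \<beta>_nz \<eta>_nz by auto
      have "psi x0 r R y - psi x0 r R (sec0 X b) - complex_of_real l =
          complex_of_real (2 * ln (norm (y - x0)) - 2 * ln (norm (sec0 X b - x0)) - l)"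
        using h3[OF bd(2)] h4[OF bd(1)] by (simp add: psi_inner[OF r])
      then have "norm (psi x0 r R y - psi x0 r R (sec0 X b) - complex_of_real l) \<le> e"
        using h5[OF bd] by (simp only: norm_of_real)
      then show ?thesis
        unfolding fg h_eq norm_mult Re_complex_of_real by (intro mult_left_mono) auto
    qed
  qed
  also have "(LINT P|lborel. Re (h' P)) = m1 * m2 * e"
    using integral_Re[OF ih'(1)] ih'(2) by simp
  finally have est2: "norm (integral\<^sup>L lborel f - integral\<^sup>L lborel g') \<le> m1 * m2 * e"
    using i1 i2 int_f by simp
  \<comment> \<open>Both comparison functions integrate to multiples of \<open>m1 * m2\<close>,
    which is positive and is cancelled in the end.\<close>
  have "complex_of_real (m1 * m2) * (2 * \<i> * c * (A - B) - l) = integral\<^sup>L lborel g - integral\<^sup>L lborel g'"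
    unfolding ig ig' by (simp add: algebra_simps)
  then have "(m1 * m2) * norm (2 * \<i> * c * (A - B) - l) = norm (integral\<^sup>L lborel g - integral\<^sup>L lborel g')"
    using m by (metis abs_of_pos mult_pos_pos norm_mult norm_of_real)
  also have "\<dots> \<le> (m1 * m2) * (4 * e * N) + (m1 * m2) * e"
    using est1 est2 norm_triangle_ineq4[of "integral\<^sup>L lborel f - integral\<^sup>L lborel g'" "integral\<^sup>L lborel f - integral\<^sup>L lborel g"]
    by simp
  also have "\<dots> = (m1 * m2) * (e * (4 * N + 1))"
    by (simp add: algebra_simps)
  finally show ?thesis
    using m unfolding c_def N_def by simp
qed

section \<open>Shrinking the supports\<close>

lemma eventually_nhds_PairD:
  fixes a :: "'a::real_normed_vector" and b :: "'b::real_normed_vector"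
  assumes "\<forall>\<^sub>F p in nhds (a, b). Q p"
  obtains d where "d > 0" "\<And>x y. norm (x - a) < d \<Longrightarrow> norm (y - b) < d \<Longrightarrow> Q (x, y)"
proof -
  obtain d where d: "d > 0" "\<And>p. dist p (a, b) < d \<Longrightarrow> Q p"
    using assms unfolding eventually_nhds_metric by blast
  have "Q (x, y)" if "norm (x - a) < d / 2" "norm (y - b) < d / 2" for x y
    using norm_Pair_le[of "x - a" "y - b"] that by (intro d) (simp add: dist_norm)
  then show thesis
    using that[of "d / 2"] d(1) by simp
qed

lemma eventually_nhds_tripleD:
  fixes a :: "'a::real_normed_vector" and b :: "'b::real_normed_vector" and c :: "'c::real_normed_vector"
  assumes "\<forall>\<^sub>F p in nhds (a, b, c). Q p"
  obtains d where "d > 0"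
    "\<And>x y z. norm (x - a) < d \<Longrightarrow> norm (y - b) < d \<Longrightarrow> norm (z - c) < d \<Longrightarrow> Q (x, y, z)"
proof -
  obtain d where d: "d > 0" "\<And>x p. norm (x - a) < d \<Longrightarrow> norm (p - (b, c)) < d \<Longrightarrow> Q (x, p)"
    using eventually_nhds_PairD[OF assms] by blast
  have "Q (x, y, z)" if "norm (x - a) < d / 2" "norm (y - b) < d / 2" "norm (z - c) < d / 2" for x y z
    using norm_Pair_le[of "y - b" "z - c"] that d(1) by (intro d) auto
  then show thesis
    using that[of "d / 2"] d(1) by simp
qed

lemma chart_True_eq_Aff: "chart True w = Aff y \<longleftrightarrow> w * y = 1"
  by (auto simp: chart_def field_simps)

lemma pointed_familyD:
  assumes "pointed_family n X"
  shows "open (base X)" "b \<in> base X \<Longrightarrow> isCont (sec0 X) b" "b \<in> base X \<Longrightarrow> tvec X b \<noteq> 0"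
    "b \<in> base X \<Longrightarrow> s \<in> labels n \<Longrightarrow> mark X s b \<noteq> Aff (sec0 X b)"
    "b \<in> base X \<Longrightarrow> inj_on (\<lambda>s. mark X s b) (labels n)"
  using assms holo_isCont unfolding pointed_family_def pointed_line_def by blast+

text \<open>Membership means that certain continuous expressions do not vanish; in the chart at
  infinity the form \<open>w * y \<noteq> 1\<close> avoids division. The first point needs both
  charts, as it will also be placed at infinity.\<close>

lemma eventually_off_divisors:
  assumes X: "pointed_family n X" and P0: "P0 \<in> off_divisors X k False"
  shows "\<forall>\<^sub>F P in nhds P0. P \<in> off_divisors X k False"
proof -
  obtain b0 x0 y0 where P0_eq: "P0 = (b0, x0, y0)" by (metis prod.exhaust)
  have b0: "b0 \<in> base X" using P0 by (simp add: off_divisors_def P0_eq)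
  have t: "((\<lambda>P. P) \<longlongrightarrow> P0) (nhds P0)" by (rule filterlim_ident)
  have tb: "(fst \<longlongrightarrow> b0) (nhds P0)"
    using tendsto_fst[OF t] by (simp add: P0_eq)
  have tx: "((\<lambda>P. fst (snd P)) \<longlongrightarrow> x0) (nhds P0)"
    using tendsto_fst[OF tendsto_snd[OF t]] by (simp add: P0_eq)
  have ty: "((\<lambda>P. snd (snd P)) \<longlongrightarrow> y0) (nhds P0)"
    using tendsto_snd[OF tendsto_snd[OF t]] by (simp add: P0_eq)
  have ts: "((\<lambda>P. sec0 X (fst P)) \<longlongrightarrow> sec0 X b0) (nhds P0)"
    by (rule isCont_tendsto_compose[OF pointed_familyD(2)[OF X b0] tb])
  have eb: "\<forall>\<^sub>F P in nhds P0. fst P \<in> base X"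
    by (rule topological_tendstoD[OF tb pointed_familyD(1)[OF X] b0])
  have ey: "\<forall>\<^sub>F P in nhds P0. snd (snd P) - sec0 X (fst P) \<noteq> 0"
    by (rule tendsto_imp_eventually_ne[OF tendsto_diff[OF ty ts]])
       (use P0 in \<open>simp add: off_divisors_def P0_eq\<close>)
  show ?thesis
  proof (cases k)
    case True
    have "\<forall>\<^sub>F P in nhds P0. fst (snd P) * snd (snd P) \<noteq> 1"
      by (rule tendsto_imp_eventually_ne[OF tendsto_mult[OF tx ty]])
         (use P0 True in \<open>simp add: off_divisors_def P0_eq chart_True_eq_Aff\<close>)
    moreover have "\<forall>\<^sub>F P in nhds P0. fst (snd P) * sec0 X (fst P) \<noteq> 1"
      by (rule tendsto_imp_eventually_ne[OF tendsto_mult[OF tx ts]])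
         (use P0 True in \<open>simp add: off_divisors_def P0_eq chart_True_eq_Aff\<close>)
    ultimately show ?thesis
      using eb ey by eventually_elim (use True in \<open>auto simp: off_divisors_def chart_True_eq_Aff\<close>)
  next
    case False
    have "\<forall>\<^sub>F P in nhds P0. fst (snd P) - snd (snd P) \<noteq> 0"
      by (rule tendsto_imp_eventually_ne[OF tendsto_diff[OF tx ty]])
         (use P0 False in \<open>simp add: off_divisors_def P0_eq\<close>)
    moreover have "\<forall>\<^sub>F P in nhds P0. fst (snd P) - sec0 X (fst P) \<noteq> 0"
      by (rule tendsto_imp_eventually_ne[OF tendsto_diff[OF tx ts]])
         (use P0 False in \<open>simp add: off_divisors_def P0_eq\<close>)
    ultimately show ?thesis
      using eb ey by eventually_elim (use False in \<open>auto simp: off_divisors_def\<close>)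
  qed
qed

lemma continuous_in_charts:
  assumes "green_current X G"
  shows "continuous_on (off_divisors X k1 k2) (in_charts G k1 k2)"
  using green_currentD(1)[OF assms, of k1 k2] Ck_on.simps(1) unfolding smooth_on_def by blast

lemma eventually_in_charts_close:
  assumes X: "pointed_family n X" and G: "green_current X G"
    and P0: "P0 \<in> off_divisors X k False" and e: "e > 0"
  shows "\<forall>\<^sub>F P in nhds P0. norm (in_charts G k False P - in_charts G k False P0) < e"
proof -
  have "(in_charts G k False \<longlongrightarrow> in_charts G k False P0) (at P0 within off_divisors X k False)"
    using continuous_in_charts[OF G] P0 by (simp add: continuous_on_def)
  then have "\<forall>\<^sub>F P in at P0 within off_divisors X k False.
      dist (in_charts G k False P) (in_charts G k False P0) < e"
    using e by (rule tendstoD)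
  then show ?thesis
    unfolding eventually_at_filter using eventually_off_divisors[OF X P0]
    by eventually_elim (use e in \<open>auto simp: dist_norm\<close>)
qed

text \<open>Infinity is the centre of the second chart, and \<open>G\<close> is continuous there
  because y and s_0 are finite. So on the outer annulus \<open>G\<close> tends to
  \<open>G b0 Infty (Aff y0)\<close> as the radius grows.\<close>

lemma (in log_cutoff) green_difference:
  fixes X :: "('b::finite) family" and x0 y0 :: complex
  assumes X: "pointed_family n X" and G: "green_current X G"
    and b0: "b0 \<in> base X" and ne: "x0 \<noteq> y0" "x0 \<noteq> sec0 X b0" "y0 \<noteq> sec0 X b0"
  shows "2 * \<i> * integral\<^sup>L lborel ann * (G b0 (Aff x0) (Aff y0) - G b0 Infty (Aff y0)) =
    complex_of_real (2 * ln (norm (y0 - x0)) - 2 * ln (norm (sec0 X b0 - x0)))" (is "?l = ?r")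
proof -
  define s where "s = sec0 X b0"
  define l where "l = 2 * ln (norm (y0 - x0)) - 2 * ln (norm (s - x0))"
  define A where "A = in_charts G False False (b0, x0, y0)"
  define B where "B = in_charts G True False (b0, 0, y0)"
  define N where "N = (LINT u|lborel. norm (ann u))"
  have N: "N \<ge> 0" unfolding N_def by (intro Bochner_Integration.integral_nonneg) auto
  have PA: "(b0, x0, y0) \<in> off_divisors X False False" and PB: "(b0, 0, y0) \<in> off_divisors X True False"
    using b0 ne by (auto simp: off_divisors_def chart_True_eq_Aff)
  have est: "norm (2 * \<i> * integral\<^sup>L lborel ann * (A - B) - complex_of_real l) \<le> e * (4 * N + 1)"
    if e: "e > 0" for e
  proof -
    obtain d1 where d1: "d1 > 0" "\<And>b x y. norm (b - b0) < d1 \<Longrightarrow> norm (x - x0) < d1 \<Longrightarrow> norm (y - y0) < d1 \<Longrightarrow>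
        norm (in_charts G False False (b, x, y) - A) < e"
      using eventually_nhds_tripleD[OF eventually_in_charts_close[OF X G PA e]] unfolding A_def by metis
    obtain d2 where d2: "d2 > 0" "\<And>b x y. norm (b - b0) < d2 \<Longrightarrow> norm (x - 0) < d2 \<Longrightarrow> norm (y - y0) < d2 \<Longrightarrow>
        norm (in_charts G True False (b, x, y) - B) < e"
      using eventually_nhds_tripleD[OF eventually_in_charts_close[OF X G PB e]] unfolding B_def by metis
    obtain d3 where d3: "d3 > 0" "cball b0 d3 \<subseteq> base X"
      using pointed_familyD(1)[OF X] b0 open_contains_cball by metis
    define u where "u = norm (y0 - x0)"
    define v where "v = norm (s - x0)"
    have uv: "u > 0" "v > 0" using ne by (auto simp: u_def v_def s_def)
    have t: "((\<lambda>P. P) \<longlongrightarrow> (b0, y0)) (nhds (b0, y0))" by (rule filterlim_ident)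
    have tb: "(fst \<longlongrightarrow> b0) (nhds (b0, y0))"
      using tendsto_fst[OF t] by simp
    have ty: "((\<lambda>P. norm (snd P - x0)) \<longlongrightarrow> u) (nhds (b0, y0))"
      unfolding u_def using tendsto_snd[OF t] by (intro tendsto_norm tendsto_diff tendsto_const) simp
    have ts: "((\<lambda>P. norm (sec0 X (fst P) - x0)) \<longlongrightarrow> v) (nhds (b0, y0))"
      unfolding v_def s_def
      by (intro tendsto_norm tendsto_diff tendsto_const isCont_tendsto_compose[OF pointed_familyD(2)[OF X b0] tb])
    have tl: "((\<lambda>P. 2 * ln (norm (snd P - x0)) - 2 * ln (norm (sec0 X (fst P) - x0))) \<longlongrightarrow> l) (nhds (b0, y0))"
      unfolding l_def u_def[symmetric] v_def[symmetric] using uv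
      by (intro tendsto_diff tendsto_mult tendsto_const tendsto_ln ty ts) auto
    have "\<forall>\<^sub>F P in nhds (b0, y0). u / 2 < norm (snd P - x0) \<and> norm (snd P - x0) < 2 * u \<and>
        v / 2 < norm (sec0 X (fst P) - x0) \<and> norm (sec0 X (fst P) - x0) < 2 * v \<and>
        dist (2 * ln (norm (snd P - x0)) - 2 * ln (norm (sec0 X (fst P) - x0))) l < e"
      using uv by (intro eventually_conj order_tendstoD[OF ty] order_tendstoD[OF ts] tendstoD[OF tl e]) auto
    then obtain d4 where d4: "d4 > 0" "\<And>b y. norm (b - b0) < d4 \<Longrightarrow> norm (y - y0) < d4 \<Longrightarrow>
        u / 2 < norm (y - x0) \<and> norm (y - x0) < 2 * u \<and>
        v / 2 < norm (sec0 X b - x0) \<and> norm (sec0 X b - x0) < 2 * v \<and>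
        dist (2 * ln (norm (y - x0)) - 2 * ln (norm (sec0 X b - x0))) l < e"
      by (rule eventually_nhds_PairD) auto
    define d where "d = Min {d1, d2, d3, d4}"
    have d: "d > 0" "d \<le> d1" "d \<le> d2" "d \<le> d3" "d \<le> d4"
      using d1(1) d2(1) d3(1) d4(1) by (auto simp: d_def)
    \<comment> \<open>The disk of radius \<open>2 * r\<close> around \<open>x0\<close> lies where
      \<open>G\<close> is within \<open>e\<close> of \<open>A\<close>, and it stays clear of the
      nearby values of y and s_0.\<close>
    define r where "r = Min {d1 / 3, u / 4, v / 4}"
    have r: "r > 0" "3 * r \<le> d1" "4 * r \<le> u" "4 * r \<le> v"
      using d1(1) uv by (auto simp: r_def)
    \<comment> \<open>\<open>2 / d2\<close> and \<open>norm x0\<close> ensure that 1/x is within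
      \<open>d2\<close> of 0 once \<open>x\<close> is outside radius \<open>R\<close>; the other
      terms keep y and s_0 well inside.\<close>
    define R where "R = 2 * u + 2 * v + norm x0 + 2 / d2"
    have R: "r < R" "2 * u \<le> R" "2 * v \<le> R"
      using uv r d2(1) by (auto simp: R_def add_pos_nonneg intro!: add_nonneg_nonneg)
         (smt (verit) divide_pos_pos norm_ge_zero)
    have sq: "2 * r\<^sup>2 \<le> z\<^sup>2 \<and> z\<^sup>2 \<le> R\<^sup>2" if "w / 2 < z" "z < 2 * w" "4 * r \<le> w" "2 * w \<le> R" for z w
    proof -
      have "(2 * r)\<^sup>2 \<le> z\<^sup>2" "z\<^sup>2 \<le> R\<^sup>2"
        using that r(1) by (intro power_mono; linarith)+
      then show ?thesis by (simp add: power_mult_distrib) (smt (verit) zero_le_power2)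
    qed
    show ?thesis
      unfolding N_def
    proof (rule green_estimate[OF X G _ d(1) r(1) R(1) e])
      show "cball b0 d \<subseteq> base X" using d3(2) d(4) by auto
      show "norm (in_charts G False False (b, x, y) - A) \<le> e"
        if "norm (b - b0) < d" "norm (y - y0) < d" "norm (x - x0) \<le> 2 * r" for b x y
        using d1(2)[of b x y] that d r by (intro less_imp_le) auto
      show "norm (in_charts G False False (b, x, y) - B) \<le> e"
        if *: "norm (b - b0) < d" "norm (y - y0) < d" "R \<le> norm (x - x0)" for b x y
      proof -
        have "2 / d2 < norm x"
          using *(3) norm_triangle_ineq4[of x x0] uv by (simp add: R_def)
        then have "2 < norm x * d2"
          using d2(1) by (simp only: pos_divide_less_eq)
        then have x: "x \<noteq> 0" "1 < d2 * norm x" by (auto simp: mult.commute)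
        then have "norm (1 / x - 0) < d2"
          by (simp add: norm_divide pos_divide_less_eq)
        have "in_charts G False False (b, x, y) = in_charts G True False (b, 1 / x, y)"
          using x(1) by (simp add: in_charts_def chart_def)
        then show ?thesis
          using d2(2)[of b "1 / x" y] * d \<open>norm (1 / x - 0) < d2\<close> by (intro less_imp_le) auto
      qed
      show "2 * r\<^sup>2 \<le> (norm (y - x0))\<^sup>2 \<and> (norm (y - x0))\<^sup>2 \<le> R\<^sup>2" if "norm (y - y0) < d" for y
        using d4(2)[of b0 y] that d4(1) d r R by (intro sq[of u]) auto
      show "2 * r\<^sup>2 \<le> (norm (sec0 X b - x0))\<^sup>2 \<and> (norm (sec0 X b - x0))\<^sup>2 \<le> R\<^sup>2" if "norm (b - b0) < d" for b
        using d4(2)[of b y0] that d4(1) d r R by (intro sq[of v]) auto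
      show "\<bar>2 * ln (norm (y - x0)) - 2 * ln (norm (sec0 X b - x0)) - l\<bar> \<le> e"
        if "norm (b - b0) < d" "norm (y - y0) < d" for b y
        using d4(2)[of b y] that d by (auto simp: dist_real_def)
    qed
  qed
  have "norm (2 * \<i> * integral\<^sup>L lborel ann * (A - B) - complex_of_real l) \<le> 0"
  proof (rule field_le_epsilon)
    fix e :: real assume "e > 0"
    then show "norm (2 * \<i> * integral\<^sup>L lborel ann * (A - B) - complex_of_real l) \<le> 0 + e"
      using est[of "e / (4 * N + 1)"] N by simp
  qed
  then show ?thesis
    by (simp add: A_def B_def l_def s_def in_charts_def chart_def)
qed

section \<open>The explicit Green function\<close>

text \<open>The logarithmic distance of points in the affine chart; with the junk value 0 at infinity the
  formula for the Green function below is valid on all of the projective line.\<close>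

fun lnd :: "P1 \<Rightarrow> P1 \<Rightarrow> real" where
  "lnd (Aff x) (Aff y) = ln (norm (x - y))"
| "lnd _ _ = 0"

lemma lnd_commute: "lnd p q = lnd q p"
  by (cases p; cases q) (auto simp: norm_minus_commute)

text \<open>The logarithm of |v| |x - y| / (|x - s_0| |y - s_0|), an invariant of Moebius maps
  acting on the points and on the tangent vector v. When one point goes to infinity the ratio of its
  two distances tends to 1, so leaving both logarithms out is the correct limit.\<close>

definition green_fn :: "('b::finite) family \<Rightarrow> complex^'b \<Rightarrow> P1 \<Rightarrow> P1 \<Rightarrow> real" where
  "green_fn X b p q = lnd p q - lnd p (Aff (sec0 X b)) - lnd q (Aff (sec0 X b)) + ln (norm (tvec X b))"

text \<open>Letting x tend to s_0 plays the difference formula against the normalization. The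
  coefficient of ln |x - s_0| has to vanish, which forces the Laplacian mass \<open>c\<close> to be
  pi; the constant term that remains then gives the value at infinity.\<close>

lemma green_affine:
  assumes X: "pointed_family n X" and G: "green_current X G"
    and b: "b \<in> base X" and y: "y \<noteq> sec0 X b"
  shows "G b Infty (Aff y) = complex_of_real (green_fn X b Infty (Aff y)) / (complex_of_real pi * \<i>)"
    and "x \<noteq> y \<Longrightarrow> x \<noteq> sec0 X b \<Longrightarrow>
      G b (Aff x) (Aff y) = complex_of_real (green_fn X b (Aff x) (Aff y)) / (complex_of_real pi * \<i>)"
proof -
  obtain L L' L'' where "log_cutoff L L' L''"
    by (rule cut_off_ln)
  then interpret log_cutoff L L' L'' .
  define s where "s = sec0 X b"
  define v where "v = tvec X b"
  define c where "c = integral\<^sup>L lborel ann"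
  define B where "B = G b Infty (Aff y)"
  have v: "v \<noteq> 0" using pointed_familyD(3)[OF X b] by (simp add: v_def)
  have ys: "y \<noteq> s" using y by (simp add: s_def)
  have diff: "2 * \<i> * c * (G b (Aff x) (Aff y) - B) = complex_of_real (2 * ln (norm (y - x)) - 2 * ln (norm (s - x)))"
    if "x \<noteq> y" "x \<noteq> s" for x
    unfolding c_def B_def s_def using green_difference[OF X G b] that y by (simp add: s_def)
  let ?h = "\<lambda>x. G b (Aff x) (Aff y) + 1 / (of_real pi * \<i>) * of_real (ln (norm ((x - s) / v)))"
  have lim: "(?h \<longlongrightarrow> 0) (at s)"
  proof -
    have "deriv (\<lambda>x. (x - s) / v) s = 1 / v"
      by (rule DERIV_imp_deriv) (use v in \<open>auto intro!: derivative_eq_intros\<close>)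
    then show ?thesis
      unfolding s_def
      by (intro green_currentD(4)[OF G b, where U = UNIV])
         (use y v in \<open>auto simp: s_def v_def intro!: holomorphic_intros\<close>)
  qed
  \<comment> \<open>The value at x = s_0 of the terms of \<open>2 * \<i> * c * ?h x\<close> other
    than the multiple of ln |x - s_0|.\<close>
  define K where "K = 2 * \<i> * c * B + complex_of_real (2 * ln (norm (y - s))) - 2 * c / of_real pi * complex_of_real (ln (norm v))"
  have ev: "\<forall>\<^sub>F x in at s. x \<noteq> s \<and> x \<noteq> y"
    using eventually_neq_at_within[of s s UNIV] eventually_neq_at_within[of y s UNIV]
    by (rule eventually_conj)
  have ty: "((\<lambda>x. complex_of_real (2 * ln (norm (y - x)))) \<longlongrightarrow> complex_of_real (2 * ln (norm (y - s)))) (at s)"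
    using ys by (intro tendsto_intros) auto
  have "((\<lambda>x. 2 * \<i> * c * ?h x
      - (2 * \<i> * c * B + complex_of_real (2 * ln (norm (y - x))) - 2 * c / of_real pi * complex_of_real (ln (norm v)))) \<longlongrightarrow>
      2 * \<i> * c * 0 - K) (at s)"
    unfolding K_def by (intro tendsto_diff tendsto_add tendsto_mult tendsto_const lim ty)
  moreover have "\<forall>\<^sub>F x in at s. 2 * \<i> * c * ?h x
      - (2 * \<i> * c * B + complex_of_real (2 * ln (norm (y - x))) - 2 * c / of_real pi * complex_of_real (ln (norm v)))
      = (2 * c / of_real pi - 2) * complex_of_real (ln (norm (x - s)))"
    using ev
  proof eventually_elim
    case (elim x)
    have ln: "ln (norm ((x - s) / v)) = ln (norm (x - s)) - ln (norm v)"
      using elim v by (simp add: norm_divide ln_div)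
    have "2 * \<i> * c * G b (Aff x) (Aff y) = 2 * \<i> * c * B + complex_of_real (2 * ln (norm (y - x)) - 2 * ln (norm (s - x)))"
      using diff[of x] elim by (simp add: algebra_simps)
    moreover have "2 * \<i> * c * (1 / (of_real pi * \<i>) * z) = 2 * c / of_real pi * z" for z
      by simp
    ultimately show ?case
      unfolding ln distrib_left[of "2 * \<i> * c"]
      by (simp add: norm_minus_commute[of s x] algebra_simps diff_divide_distrib)
  qed
  ultimately have lim2: "((\<lambda>x. (2 * c / of_real pi - 2) * complex_of_real (ln (norm (x - s)))) \<longlongrightarrow> - K) (at s)"
    using Lim_transform_eventually by fastforce
  have "filterlim (\<lambda>x. norm (x - s)) (at_right 0) (at s)"
    unfolding at_within_def[of 0] filterlim_inf filterlim_principal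
    by (auto intro!: tendsto_norm_zero LIM_zero tendsto_ident_at simp: eventually_at_filter
        simp flip: tendsto_def)
  then have "filterlim (\<lambda>x. ln (norm (x - s))) at_bot (at s)"
    by (rule filterlim_compose[OF ln_at_0])
  then have inv: "((\<lambda>x. inverse (ln (norm (x - s)))) \<longlongrightarrow> 0) (at s)"
    by (intro filterlim_compose[OF tendsto_inverse_0] filterlim_mono[OF _ at_bot_le_at_infinity order_refl])
  \<comment> \<open>Dividing the convergent product by the logarithm, which tends to minus infinity,
    isolates the constant factor and shows that it is 0.\<close>
  have "((\<lambda>x. (2 * c / of_real pi - 2) * complex_of_real (ln (norm (x - s))) *
      complex_of_real (inverse (ln (norm (x - s))))) \<longlongrightarrow> - K * complex_of_real 0) (at s)"
    by (intro tendsto_mult lim2 tendsto_of_real inv)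
  moreover have "\<forall>\<^sub>F x in at s. (2 * c / of_real pi - 2) * complex_of_real (ln (norm (x - s))) *
      complex_of_real (inverse (ln (norm (x - s)))) = 2 * c / of_real pi - 2"
  proof -
    have "\<forall>\<^sub>F x in at s. ln (norm (x - s)) < 0"
      using \<open>filterlim (\<lambda>x. ln (norm (x - s))) at_bot (at s)\<close> by (simp add: filterlim_at_bot_dense)
    then show ?thesis
      by eventually_elim (simp add: of_real_inverse)
  qed
  ultimately have "((\<lambda>x. 2 * c / of_real pi - 2) \<longlongrightarrow> - K * complex_of_real 0) (at s)"
    by (rule Lim_transform_eventually)
  then have c: "2 * c / of_real pi - 2 = 0"
    by (simp add: tendsto_const_iff)
  then have c_pi: "c = of_real pi"
    by (simp add: field_simps)
  have "K = 0"
    using lim2 by (simp add: c tendsto_const_iff)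
  have B: "B = complex_of_real (ln (norm v) - ln (norm (y - s))) / (complex_of_real pi * \<i>)"
  proof -
    have "2 * (B * (complex_of_real pi * \<i>)) = 2 * complex_of_real (ln (norm v) - ln (norm (y - s)))"
      using \<open>K = 0\<close> unfolding K_def c_pi by (simp add: algebra_simps)
    then have "B * (complex_of_real pi * \<i>) = complex_of_real (ln (norm v) - ln (norm (y - s)))"
      by (simp only: mult_cancel_left) simp
    then show ?thesis
      by (metis nonzero_eq_divide_eq complex_i_not_zero mult_eq_0_iff of_real_eq_0_iff pi_neq_zero)
  qed
  from B show "G b Infty (Aff y) = complex_of_real (green_fn X b Infty (Aff y)) / (complex_of_real pi * \<i>)"
    by (simp add: B_def green_fn_def v_def s_def)
  assume x: "x \<noteq> y" "x \<noteq> sec0 X b"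
  have "2 * \<i> * of_real pi * (G b (Aff x) (Aff y) - B) = complex_of_real (2 * ln (norm (y - x)) - 2 * ln (norm (s - x)))"
    using diff[of x] x by (simp add: s_def c_pi)
  then have "2 * ((G b (Aff x) (Aff y) - B) * (of_real pi * \<i>)) = 2 * complex_of_real (ln (norm (y - x)) - ln (norm (s - x)))"
    by (simp add: algebra_simps)
  then have "(G b (Aff x) (Aff y) - B) * (of_real pi * \<i>) = complex_of_real (ln (norm (y - x)) - ln (norm (s - x)))"
    by (simp only: mult_cancel_left) simp
  then have "G b (Aff x) (Aff y) - B = complex_of_real (ln (norm (y - x)) - ln (norm (s - x))) / (of_real pi * \<i>)"
    by (metis nonzero_eq_divide_eq complex_i_not_zero mult_eq_0_iff of_real_eq_0_iff pi_neq_zero)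
  then have "G b (Aff x) (Aff y) = B + complex_of_real (ln (norm (y - x)) - ln (norm (s - x))) / (of_real pi * \<i>)"
    by (simp add: algebra_simps)
  then show "G b (Aff x) (Aff y) = complex_of_real (green_fn X b (Aff x) (Aff y)) / (complex_of_real pi * \<i>)"
    unfolding B by (simp add: green_fn_def v_def[symmetric] s_def[symmetric] norm_minus_commute
        diff_divide_distrib add_divide_distrib)
qed

text \<open>The current equation was tested near an affine second point, and symmetry of
  \<open>G\<close> is not yet known, so the case of p at infinity cannot be reused for q. Instead
  the formula is carried to infinity by continuity in the coordinate w = 1/y.\<close>

lemma green_current_explicit:
  assumes X: "pointed_family n X" and G: "green_current X G" and b: "b \<in> base X"
    and ne: "p \<noteq> q" "p \<noteq> Aff (sec0 X b)" "q \<noteq> Aff (sec0 X b)"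
  shows "G b p q = complex_of_real (green_fn X b p q) / (complex_of_real pi * \<i>)"
proof (cases q)
  case (Aff y)
  then show ?thesis
    using green_affine[OF X G b] ne by (cases p) auto
next
  case Infty
  then obtain x where p: "p = Aff x" and x: "x \<noteq> sec0 X b"
    using ne by (cases p) auto
  let ?s = "sec0 X b"
  let ?g = "\<lambda>w. complex_of_real (ln (norm (w * x - 1)) - ln (norm (w * ?s - 1)) - ln (norm (x - ?s))
    + ln (norm (tvec X b))) / (complex_of_real pi * \<i>)"
  have t0: "((\<lambda>w::complex. w * z - 1) \<longlongrightarrow> 0 * z - 1) (at 0)" for z
    by (intro tendsto_intros)
  have ne1: "\<forall>\<^sub>F w::complex in at 0. w * z - 1 \<noteq> 0" for z
    by (rule tendsto_imp_eventually_ne[OF t0]) simp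
  have ne0: "\<forall>\<^sub>F w::complex in at 0. w \<noteq> 0"
    by (rule eventually_neq_at_within)
  have ev: "\<forall>\<^sub>F w in at 0. w \<noteq> 0 \<and> w * x - 1 \<noteq> 0 \<and> w * ?s - 1 \<noteq> 0"
    by (intro eventually_conj ne0 ne1)
  have "((\<lambda>w. in_charts G False True (b, x, w)) \<longlongrightarrow> in_charts G False True (b, x, 0)) (at 0)"
  proof (rule continuous_on_tendsto_compose[OF continuous_in_charts[OF G, of False True]])
    show "((\<lambda>w. (b, x, w)) \<longlongrightarrow> (b, x, 0)) (at (0::complex))"
      by (intro tendsto_intros)
    show "(b, x, 0) \<in> off_divisors X False True"
      using b x by (auto simp: off_divisors_def chart_def)
    show "\<forall>\<^sub>F w in at 0. (b, x, w) \<in> off_divisors X False True"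
      using ev by eventually_elim
        (use b x in \<open>auto simp: off_divisors_def chart_True_eq_Aff eq_commute[of "Aff x"]\<close>)
  qed
  moreover have "\<forall>\<^sub>F w in at 0. in_charts G False True (b, x, w) = ?g w"
    using ev
  proof eventually_elim
    case (elim w)
    have nx: "1 / w \<noteq> x" "1 / w \<noteq> ?s" using elim by (auto simp: divide_eq_eq mult.commute[of w])
    \<comment> \<open>The terms \<open>ln (norm w)\<close> from the two distances to 1/w cancel, and
      what remains is continuous at w = 0.\<close>
    have l: "ln (norm (z - 1 / w)) = ln (norm (w * z - 1)) - ln (norm w)" if "w * z - 1 \<noteq> 0" for z
    proof -
      have "z - 1 / w = (w * z - 1) / w" using elim by (simp add: field_simps)
      then show ?thesis using that elim by (simp add: norm_divide ln_div)
    qed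
    have "in_charts G False True (b, x, w) = G b (Aff x) (Aff (1 / w))"
      using elim by (simp add: in_charts_def chart_def)
    also have "\<dots> = complex_of_real (green_fn X b (Aff x) (Aff (1 / w))) / (complex_of_real pi * \<i>)"
      using green_affine(2)[OF X G b nx(2), of x] nx x by auto
    also have "green_fn X b (Aff x) (Aff (1 / w)) =
        ln (norm (w * x - 1)) - ln (norm (w * ?s - 1)) - ln (norm (x - ?s)) + ln (norm (tvec X b))"
      using l[of x] l[of ?s] elim by (simp add: green_fn_def norm_minus_commute[of "1 / w"])
    finally show ?case .
  qed
  ultimately have lim: "(?g \<longlongrightarrow> in_charts G False True (b, x, 0)) (at 0)"
    by (rule Lim_transform_eventually)
  have "(?g \<longlongrightarrow> ?g 0) (at 0)"
    by (intro tendsto_intros) auto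
  from tendsto_unique[OF _ lim this] show ?thesis
    by (simp add: in_charts_def chart_def p Infty green_fn_def)
qed

section \<open>Graphs at the ends of the twistor line\<close>

text \<open>A determinant with two proportional columns. \<open>e\<close> splits off the factor
  \<open>c\<close> and \<mu> redirects column \<open>k\<close> to column \<open>j\<close>; after
  that, composing with the transposition changes nothing but the sign, so the sum equals its own
  negative.\<close>

lemma wedge_proportional:
  assumes jk: "j < length fs" "k < length fs" "j \<noteq> k"
    and fs: "\<And>a. a \<in> set fs \<Longrightarrow> a (ts ! k) = c * a (ts ! j)"
  shows "wedge fs ts = 0"
proof -
  let ?n = "length fs" and ?\<tau> = "Transposition.transpose j k"
  let ?f = "\<lambda>\<pi>. of_int (sign \<pi>) * (\<Prod>i<?n. (fs ! i) (ts ! \<pi> i))"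
  have \<tau>: "?\<tau> permutes {..<?n}" using jk by (intro permutes_swap_id) auto
  define e where "e = (\<lambda>m. if m = k then c else 1)"
  define \<mu> where "\<mu> = (\<lambda>m. if m = k then j else m)"
  have prod_eq: "(\<Prod>i<?n. (fs ! i) (ts ! \<sigma> i)) = (\<Prod>m<?n. e m) * (\<Prod>i<?n. (fs ! i) (ts ! \<mu> (\<sigma> i)))"
    if \<sigma>: "\<sigma> permutes {..<?n}" for \<sigma>
  proof -
    have "(\<Prod>i<?n. (fs ! i) (ts ! \<sigma> i)) = (\<Prod>i<?n. e (\<sigma> i) * (fs ! i) (ts ! \<mu> (\<sigma> i)))"
      by (rule prod.cong) (use fs jk in \<open>auto simp: e_def \<mu>_def\<close>)
    also have "\<dots> = (\<Prod>i<?n. e (\<sigma> i)) * (\<Prod>i<?n. (fs ! i) (ts ! \<mu> (\<sigma> i)))"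
      by (rule prod.distrib)
    also have "(\<Prod>i<?n. e (\<sigma> i)) = (\<Prod>m<?n. e m)"
      using prod.permute[OF \<sigma>, of e] by (simp add: o_def)
    finally show ?thesis .
  qed
  have "?f (?\<tau> \<circ> \<pi>) = - ?f \<pi>" if \<pi>: "\<pi> permutes {..<?n}" for \<pi>
  proof -
    have "sign (?\<tau> \<circ> \<pi>) = - sign \<pi>"
      using jk(3) permutes_imp_permutation[OF finite_lessThan \<tau>] permutes_imp_permutation[OF finite_lessThan \<pi>]
      by (simp add: sign_compose sign_swap_id)
    moreover have "\<mu> (?\<tau> m) = \<mu> m" for m
      using jk(3) by (auto simp: \<mu>_def Transposition.transpose_def)
    ultimately show ?thesis
      unfolding prod_eq[OF permutes_compose[OF \<pi> \<tau>]] prod_eq[OF \<pi>] by simp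
  qed
  then have "(\<Sum>\<pi> | \<pi> permutes {..<?n}. ?f (?\<tau> \<circ> \<pi>)) = - wedge fs ts"
    unfolding wedge_def sum_negf[symmetric] by (intro sum.cong) auto
  then show ?thesis
    using setum_permutations_compose_left[OF \<tau>, of ?f] by (simp add: wedge_def)
qed

text \<open>The (1,0) part of a real differential is complex linear in the tangent vector, the (0,1)
  part antilinear; real differentiability suffices.\<close>

lemma wirt_rotate:
  assumes "\<gamma> differentiable (at 0)"
  shows "wirt (\<lambda>c. \<gamma> (\<i> * c)) = \<i> * wirt \<gamma>" and "wirtbar (\<lambda>c. \<gamma> (\<i> * c)) = - \<i> * wirtbar \<gamma>"
proof -
  obtain D where D: "(\<gamma> has_derivative D) (at 0)"
    using assms unfolding differentiable_def by blast
  have "((\<lambda>c. \<i> * c) has_derivative (\<lambda>c. \<i> * c)) (at 0)"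
    by (auto intro!: derivative_eq_intros)
  from has_derivative_compose[OF this, of \<gamma> D] D
  have D': "((\<lambda>c. \<gamma> (\<i> * c)) has_derivative (\<lambda>h. D (\<i> * h))) (at 0)" by simp
  have "D (- 1) = - D 1"
    using linear_neg[OF has_derivative_linear[OF D]] by blast
  then show "wirt (\<lambda>c. \<gamma> (\<i> * c)) = \<i> * wirt \<gamma>" "wirtbar (\<lambda>c. \<gamma> (\<i> * c)) = - \<i> * wirtbar \<gamma>"
    unfolding wirt_eqI[OF D refl] wirtbar_eqI[OF D refl] wirt_eqI[OF D' refl] wirtbar_eqI[OF D' refl]
    by (simp_all add: field_simps)
qed

lemma chart_surj: "\<exists>k x. p = chart k x"
proof (cases p)
  case Infty
  then have "p = chart True 0" by (simp add: chart_def)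
  then show ?thesis by blast
qed (metis chart_False)

lemma green_differentiable:
  assumes G: "green_current X G" and b: "b \<in> base X"
    and ne: "Aff a \<noteq> q" "a \<noteq> sec0 X b" "q \<noteq> Aff (sec0 X b)"
  shows "(\<lambda>c. G b (Aff (a + c)) q) differentiable (at 0)" "(\<lambda>c. G b q (Aff (a + c))) differentiable (at 0)"
proof -
  obtain k y where q: "q = chart k y" using chart_surj by blast
  have d: "in_charts G k1 k2 differentiable (at P)" if "P \<in> off_divisors X k1 k2" for k1 k2 P
    using green_currentD(1)[OF G, of k1 k2] that unfolding smooth_on_def
    by (metis Ck_on.simps(2))
  have "(\<lambda>c. (b, a + c, y)) differentiable (at 0)" "(\<lambda>c. (b, y, a + c)) differentiable (at 0)"
    unfolding differentiable_def by (rule exI, (rule derivative_intros)+)+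
  moreover have "(b, a + 0, y) \<in> off_divisors X False k" "(b, y, a + 0) \<in> off_divisors X k False"
    using b ne by (auto simp: off_divisors_def q)
  ultimately have "(in_charts G False k \<circ> (\<lambda>c. (b, a + c, y))) differentiable (at 0)"
      "(in_charts G k False \<circ> (\<lambda>c. (b, y, a + c))) differentiable (at 0)"
    using differentiable_chain_at d by blast+
  then show "(\<lambda>c. G b (Aff (a + c)) q) differentiable (at 0)" "(\<lambda>c. G b q (Aff (a + c))) differentiable (at 0)"
    by (simp_all add: o_def in_charts_def q)
qed

text \<open>A common setting for the graphs of the action and for planar trees, so that one
  vanishing lemma serves both.\<close>

definition labelled_graph :: "nat \<Rightarrow> graph \<Rightarrow> bool" where
  "labelled_graph n \<Gamma> \<longleftrightarrow> finite (hes \<Gamma>) \<and> partition_on (hes \<Gamma>) (verts \<Gamma>) \<and>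
     (\<forall>E\<in>edges \<Gamma>. card E = 2 \<and> E \<subseteq> hes \<Gamma>) \<and> (\<forall>v\<in>ext_verts \<Gamma>. deco \<Gamma> v \<in> labels n)"

lemma is_graph_labelled: "is_graph n \<Gamma> \<Longrightarrow> labelled_graph n \<Gamma>"
  by (auto simp: is_graph_def labelled_graph_def dest: partition_onD1)

lemma vertex_of_in:
  assumes "partition_on H (verts \<Gamma>)" "h \<in> H"
  shows "vertex_of \<Gamma> h \<in> verts \<Gamma>" "h \<in> vertex_of \<Gamma> h"
proof -
  have "\<exists>!v. v \<in> verts \<Gamma> \<and> h \<in> v"
    using assms partition_onD1[OF assms(1)] partition_onD2[OF assms(1)]
    by (auto simp: disjoint_def)
  from theI'[OF this] show "vertex_of \<Gamma> h \<in> verts \<Gamma>" "h \<in> vertex_of \<Gamma> h"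
    by (auto simp: vertex_of_def)
qed

lemma edge_ends:
  assumes \<Gamma>: "labelled_graph n \<Gamma>" "\<not> self_loop \<Gamma>" and E: "E \<in> edges \<Gamma>"
  shows "vertex_of \<Gamma> (Min E) \<in> verts \<Gamma>" "vertex_of \<Gamma> (Max E) \<in> verts \<Gamma>"
    "vertex_of \<Gamma> (Min E) \<noteq> vertex_of \<Gamma> (Max E)"
proof -
  obtain h k where hk: "E = {h, k}"
    using \<Gamma>(1) E unfolding labelled_graph_def by (meson card_2_iff)
  have p: "partition_on (hes \<Gamma>) (verts \<Gamma>)" and sub: "E \<subseteq> hes \<Gamma>"
    using \<Gamma>(1) E by (auto simp: labelled_graph_def)
  have "Min E \<in> E" "Max E \<in> E" by (auto simp: hk)
  then have "Min E \<in> hes \<Gamma>" "Max E \<in> hes \<Gamma>" using sub by auto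
  then show v: "vertex_of \<Gamma> (Min E) \<in> verts \<Gamma>" "vertex_of \<Gamma> (Max E) \<in> verts \<Gamma>"
    using vertex_of_in[OF p] by auto
  have "E \<subseteq> {Min E, Max E}" by (auto simp: hk min_def max_def)
  then show "vertex_of \<Gamma> (Min E) \<noteq> vertex_of \<Gamma> (Max E)"
    using v vertex_of_in[OF p \<open>Min E \<in> hes \<Gamma>\<close>] vertex_of_in[OF p \<open>Max E \<in> hes \<Gamma>\<close>] \<Gamma>(2) E
    unfolding self_loop_def by (metis empty_subsetI insert_subset order_trans)
qed

text \<open>Distinct points off the labels and off s_0 keep each edge away from the divisors, where
  \<open>G\<close> is smooth. Without self-loops the moving vertex is at most one end of the edge;
  an edge that misses it gives a constant.\<close>

lemma edge_green_differentiable: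
  assumes X: "pointed_family n X" and G: "green_current X G" and b: "b \<in> base X"
    and \<Gamma>: "labelled_graph n \<Gamma>" "\<not> self_loop \<Gamma>" and E: "E \<in> edges \<Gamma>"
    and v: "v \<in> int_verts \<Gamma>" and x: "x \<in> fibre_config n X \<Gamma> b"
  shows "(\<lambda>c. edge_green X G \<Gamma> E b (x(v := x v + c))) differentiable (at 0)"
proof -
  define v1 v2 where "v1 = vertex_of \<Gamma> (Min E)" and "v2 = vertex_of \<Gamma> (Max E)"
  have v12: "v1 \<in> verts \<Gamma>" "v2 \<in> verts \<Gamma>" "v1 \<noteq> v2"
    using edge_ends[OF \<Gamma> E] by (auto simp: v1_def v2_def)
  have v_ext: "v \<notin> ext_verts \<Gamma>" using v by (auto simp: int_verts_def ext_verts_def)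
  have self: "endpoint X \<Gamma> b (x(v := x v + c)) v = Aff (x v + c)" for c
    using v_ext by (simp add: endpoint_def)
  have other: "endpoint X \<Gamma> b (x(v := x v + c)) w = endpoint X \<Gamma> b x w" if "w \<noteq> v" for w c
    using that by (simp add: endpoint_def)
  have xs: "x v \<noteq> sec0 X b" using x v by (auto simp: fibre_config_def)
  have ends: "endpoint X \<Gamma> b x w \<noteq> Aff (x v) \<and> endpoint X \<Gamma> b x w \<noteq> Aff (sec0 X b)"
    if w: "w \<in> verts \<Gamma>" "w \<noteq> v" for w
  proof (cases "w \<in> ext_verts \<Gamma>")
    case True
    then have "deco \<Gamma> w \<in> labels n" using \<Gamma>(1) by (auto simp: labelled_graph_def)
    then show ?thesis
      using True x v pointed_familyD(4)[OF X b] by (fastforce simp: endpoint_def fibre_config_def)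
  next
    case False
    then have "w \<in> int_verts \<Gamma>" using w by (auto simp: int_verts_def ext_verts_def)
    then show ?thesis
      using False w v x by (auto simp: endpoint_def fibre_config_def dest: inj_onD)
  qed
  consider "v1 = v" | "v2 = v" "v1 \<noteq> v" | "v1 \<noteq> v" "v2 \<noteq> v" by blast
  then show ?thesis
  proof cases
    case 1
    then have "v2 \<noteq> v" using v12(3) by simp
    with green_differentiable(1)[OF G b, of "x v" "endpoint X \<Gamma> b x v2"] ends[OF v12(2)] xs
    show ?thesis
      unfolding edge_green_def v1_def[symmetric] v2_def[symmetric] by (simp add: 1 self other) metis
  next
    case 2
    with green_differentiable(2)[OF G b, of "x v" "endpoint X \<Gamma> b x v1"] ends[OF v12(1)] xs
    show ?thesis
      unfolding edge_green_def v1_def[symmetric] v2_def[symmetric] by (simp add: self other) metis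
  next
    case 3
    then show ?thesis
      unfolding edge_green_def v1_def[symmetric] v2_def[symmetric] by (simp add: other)
  qed
qed

text \<open>At the two ends of the twistor line all edge forms are of type (1,0), respectively (0,1), in the
  position of an internal vertex, so two columns of the determinant are proportional.\<close>

lemma Z_form_eq_0:
  assumes X: "pointed_family n X" and G: "green_current X G"
    and \<Gamma>: "labelled_graph n \<Gamma>" "int_verts \<Gamma> \<noteq> {}"
    and es: "set es = edges \<Gamma>" "distinct es" and u: "u \<in> {0, 1}"
  shows "Z_form n X G (\<Gamma>, \<epsilon>, es) (b, 1 - u, u) ts = 0"
proof (cases "b \<notin> base X \<or> length ts + 2 * card (int_verts \<Gamma>) \<noteq> card (edges \<Gamma>) \<or> self_loop \<Gamma>")
  case True
  then show ?thesis by (auto simp: Z_form_def)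
next
  case False
  then have b: "b \<in> base X" and len: "length ts + 2 * card (int_verts \<Gamma>) = card (edges \<Gamma>)"
    and nl: "\<not> self_loop \<Gamma>" by auto
  have "finite (verts \<Gamma>)"
    using \<Gamma>(1) finite_elements unfolding labelled_graph_def by blast
  then have fin: "finite (int_verts \<Gamma>)"
    by (simp add: int_verts_def)
  define l where "l = (SOME l. distinct l \<and> set l = int_verts \<Gamma>)"
  have l: "set l = int_verts \<Gamma>"
    using someI_ex[OF finite_distinct_list[OF fin, unfolded conj_commute[of "set _ = _"]]]
    by (simp add: l_def)
  then obtain v l' where vl: "l = v # l'" and v: "v \<in> int_verts \<Gamma>"
    using \<Gamma>(2) by (cases l) auto
  define T1 T2 where "T1 = (((0, 0, 0), (\<lambda>_. 0)(v := 1)) :: 'a tw \<times> (nat set \<Rightarrow> complex))"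
    and "T2 = (((0, 0, 0), (\<lambda>_. 0)(v := \<i>)) :: 'a tw \<times> (nat set \<Rightarrow> complex))"
  obtain rest where fb: "fibre_basis \<Gamma> = T1 # T2 # rest"
    unfolding fibre_basis_def l_def[symmetric] vl T1_def T2_def by auto
  have "card (int_verts \<Gamma>) > 0" using fin \<Gamma>(2) by (simp add: card_gt_0_iff)
  \<comment> \<open>An internal vertex accounts for two fibre directions, so there are at least two
    edges and \<open>Z_form\<close> is given by its integral.\<close>
  then have card: "card (edges \<Gamma>) \<ge> 2" "length es = card (edges \<Gamma>)"
    using len es distinct_card by fastforce+
  \<comment> \<open>At u = 1 only the (1,0) part of an edge form is left, at u = 0 only the (0,1)
    part; \<open>k\<close> is the factor it picks up when the tangent vector is turned by
    \<i>.\<close>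
  define k where "k = (if u = 0 then - \<i> else \<i>)"
  have "wedge (map (\<lambda>E. edge_form X G \<Gamma> E (b, 1 - u, u) x) es)
      (fibre_basis \<Gamma> @ map (\<lambda>t. (t, \<lambda>_. 0)) ts) = 0"
    if x: "x \<in> fibre_config n X \<Gamma> b" for x
  proof (rule wedge_proportional[where j = 0 and k = 1 and c = k])
    fix a assume "a \<in> set (map (\<lambda>E. edge_form X G \<Gamma> E (b, 1 - u, u) x) es)"
    then obtain E where E: "E \<in> edges \<Gamma>" and a: "a = edge_form X G \<Gamma> E (b, 1 - u, u) x"
      using es by auto
    define g where "g = (\<lambda>c. edge_green X G \<Gamma> E b (x(v := x v + c)))"
    have g: "g differentiable (at 0)"
      unfolding g_def by (rule edge_green_differentiable[OF X G b \<Gamma>(1) nl E v x])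
    have 1: "(\<lambda>c. edge_green X G \<Gamma> E (b + c *s 0) (\<lambda>w. x w + c * ((\<lambda>_. 0)(v := 1)) w)) = g"
      unfolding g_def by (intro ext arg_cong2[where f = "edge_green X G \<Gamma> E"]) auto
    have 2: "(\<lambda>c. edge_green X G \<Gamma> E (b + c *s 0) (\<lambda>w. x w + c * ((\<lambda>_. 0)(v := \<i>)) w)) = (\<lambda>c. g (\<i> * c))"
      unfolding g_def by (intro ext arg_cong2[where f = "edge_green X G \<Gamma> E"]) auto
    have "a T1 = u * wirt g - (1 - u) * wirtbar g"
      unfolding a edge_form_def T1_def by (simp add: 1[simplified] Let_def)
    moreover have "a T2 = u * wirt (\<lambda>c. g (\<i> * c)) - (1 - u) * wirtbar (\<lambda>c. g (\<i> * c))"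
      unfolding a edge_form_def T2_def by (simp add: 2[simplified] Let_def)
    ultimately have "a T2 = k * a T1"
      using u by (auto simp: wirt_rotate[OF g] k_def)
    then show "a ((fibre_basis \<Gamma> @ map (\<lambda>t. (t, \<lambda>_. 0)) ts) ! 1) =
        k * a ((fibre_basis \<Gamma> @ map (\<lambda>t. (t, \<lambda>_. 0)) ts) ! 0)"
      by (simp add: fb)
  qed (use card in auto)
  \<comment> \<open>The integrand is 0 at every admissible configuration, so the integral vanishes
    irrespective of convergence.\<close>
  then have "(LINT x:fibre_config n X \<Gamma> b|PiM (int_verts \<Gamma>) (\<lambda>_. lborel).
      wedge (map (\<lambda>E. edge_form X G \<Gamma> E (b, 1 - u, u) x) es) (fibre_basis \<Gamma> @ map (\<lambda>t. (t, \<lambda>_. 0)) ts)) = 0"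
    unfolding set_lebesgue_integral_def
    by (intro integral_eq_zero_AE AE_I2) (auto simp: indicator_def)
  then show ?thesis
    using card by (simp add: Z_form_def)
qed

section \<open>Planar trees as labelled graphs\<close>

lemma leaf_edges_length: "length (leaf_edges e t) = nleaves t"
  by (induction t arbitrary: e) auto

lemma nedges_pos: "nedges t > 0"
  by (induction t) auto

lemma half_edge_interval:
  fixes e :: nat
  assumes "0 < a" "0 < b"
  shows "{2 * e + 1..<2 * (e + (1 + a + b))} - {2 * e + 1, 2 * (e + 1), 2 * (e + 1 + a)} =
    {2 * (e + 1) + 1..<2 * (e + 1 + a)} \<union> {2 * (e + 1 + a) + 1..<2 * (e + 1 + a + b)}"
  using assms by auto

text \<open>The half-edge \<open>2 * e\<close> belongs to the vertex on the root side and is left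
  out, which lets the induction close: the two subtrees miss exactly \<open>2 * (e + 1)\<close> and
  \<open>2 * (e + 1 + nedges l)\<close>, and these form the new trivalent vertex together with
  \<open>2 * e + 1\<close>.\<close>

lemma tree_verts_partition:
  "partition_on {2 * e + 1..<2 * (e + nedges t)} ((\<lambda>e. {2 * e + 1}) ` set (leaf_edges e t) \<union> inner_verts e t)"
  "\<forall>v\<in>inner_verts e t. card v = 3"
proof (induction t arbitrary: e)
  case PLeaf
  {
    case (1 e)
    have "{2 * e + 1..<2 * (e + 1)} = {2 * e + 1}" by auto
    then show ?case using partition_on_space[of "{2 * e + 1}"] by simp
  next
    case 2
    show ?case by simp
  }
next
  case (PNode l r)
  {
    case (1 e)
    let ?L = "\<lambda>e t. (\<lambda>e. {2 * e + 1}) ` set (leaf_edges e t) \<union> inner_verts e t"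
    let ?e1 = "e + 1" and ?e2 = "e + 1 + nedges l"
    let ?I1 = "{2 * ?e1 + 1..<2 * (?e1 + nedges l)}" and ?I2 = "{2 * ?e2 + 1..<2 * (?e2 + nedges r)}"
    let ?v = "{2 * e + 1, 2 * ?e1, 2 * ?e2}"
    have 1: "partition_on ?I1 (?L ?e1 l)"
      and 2: "partition_on ?I2 (?L ?e2 r)"
      by (rule PNode)+
    have U: "\<Union>(?L ?e1 l) = ?I1"
        "\<Union>(?L ?e2 r) = ?I2"
      using partition_onD1[OF 1] partition_onD1[OF 2] by simp_all
    have "partition_on (?I1 \<union> ?I2) (?L ?e1 l \<union> ?L ?e2 r)"
    proof (rule partition_onI)
      show "\<Union>(?L ?e1 l \<union> ?L ?e2 r) = ?I1 \<union> ?I2"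
        using U by (simp only: Union_Un_distrib)
      show "{} \<notin> ?L ?e1 l \<union> ?L ?e2 r"
        using partition_onD3[OF 1] partition_onD3[OF 2] by blast
      fix p q assume pq: "p \<in> ?L ?e1 l \<union> ?L ?e2 r" "q \<in> ?L ?e1 l \<union> ?L ?e2 r" "p \<noteq> q"
      have sub: "s \<subseteq> ?I1" if "s \<in> ?L ?e1 l" for s
        using U(1) that by blast
      have sub': "s \<subseteq> ?I2" if "s \<in> ?L ?e2 r" for s
        using U(2) that by blast
      have dj: "disjnt ?I1 ?I2"
        by (auto simp: disjnt_def)
      consider "p \<in> ?L ?e1 l" "q \<in> ?L ?e1 l" | "p \<in> ?L ?e2 r" "q \<in> ?L ?e2 r"
        | "p \<in> ?L ?e1 l" "q \<in> ?L ?e2 r" | "p \<in> ?L ?e2 r" "q \<in> ?L ?e1 l"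
        using pq(1,2) by blast
      then show "disjnt p q"
      proof cases
        case 1
        then show ?thesis
          using partition_onD2[OF \<open>partition_on _ (?L ?e1 l)\<close>] pq(3) by (auto simp: pairwise_def)
      next
        case 2
        then show ?thesis
          using partition_onD2[OF \<open>partition_on _ (?L ?e2 r)\<close>] pq(3) by (auto simp: pairwise_def)
      next
        case 3
        then show ?thesis by (intro disjnt_subset1[OF disjnt_subset2[OF dj sub'] sub])
      next
        case 4
        then show ?thesis by (intro disjnt_sym[OF disjnt_subset1[OF disjnt_subset2[OF dj sub'] sub]])
      qed
    qed
    moreover have "{2 * e + 1..<2 * (e + nedges (PNode l r))} - ?v =
        ?I1 \<union> ?I2"
      using half_edge_interval[OF nedges_pos[of l] nedges_pos[of r], of e] by simp
    moreover have "?v \<subseteq> {2 * e + 1..<2 * (e + nedges (PNode l r))}"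
      using nedges_pos[of l] nedges_pos[of r] by auto
    moreover have "disjnt ?v (\<Union>(?L ?e1 l \<union> ?L ?e2 r))"
      unfolding Union_Un_distrib[of "?L ?e1 l" "?L ?e2 r"] U by (auto simp: disjnt_def)
    moreover have "?L e (PNode l r) = insert ?v (?L ?e1 l \<union> ?L ?e2 r)"
      by auto
    ultimately show ?case
      using partition_on_insert by (metis insert_not_empty)
  next
    case (2 e)
    show ?case
      using PNode[of "e + 1"] PNode(4)[of "e + 1 + nedges l"] nedges_pos[of l] by auto
  }
qed

lemma outer_verts_set: "set (outer_verts t) = insert {0} ((\<lambda>e. {2 * e + 1}) ` set (leaf_edges 0 t))"
  by (auto simp: outer_verts_def)

lemma plane_tree_labelled:
  assumes w: "nleaves t + 1 = length w" "set w \<subseteq> labels n"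
  shows "labelled_graph n (fst (plane_tree t w))"
    "int_verts (fst (plane_tree t w)) = inner_verts 0 t"
    "ext_verts (fst (plane_tree t w)) = set (outer_verts t)"
proof -
  let ?G = "fst (plane_tree t w)"
  let ?V = "(\<lambda>e. {2 * e + 1}) ` set (leaf_edges 0 t) \<union> inner_verts 0 t"
  have verts: "verts ?G = insert {0} ?V"
    by (auto simp: plane_tree_def outer_verts_set)
  have p: "partition_on {1..<2 * nedges t} ?V"
    using tree_verts_partition(1)[of 0 t] by simp
  \<comment> \<open>The half-edge 0 missing from the interval is the external vertex at the root,
    which carries the first letter.\<close>
  have "{..<2 * nedges t} - {0} = {1..<2 * nedges t}" by auto
  then have part: "partition_on {..<2 * nedges t} (verts ?G)"
    unfolding verts using p nedges_pos[of t] partition_onD1[OF p, symmetric]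
    by (subst partition_on_insert) (auto simp: disjnt_def)
  have c1: "card v = 1" if "v \<in> set (outer_verts t)" for v
    using that by (auto simp: outer_verts_set)
  have vu: "verts ?G = set (outer_verts t) \<union> inner_verts 0 t"
    by (simp add: plane_tree_def)
  show int: "int_verts ?G = inner_verts 0 t" and ext: "ext_verts ?G = set (outer_verts t)"
    using c1 tree_verts_partition(2)[of 0 t] unfolding int_verts_def ext_verts_def vu by force+
  have "deco ?G v \<in> labels n" if v: "v \<in> set (outer_verts t)" for v
  proof -
    have "length (outer_verts t) = length w"
      using w(1) by (simp add: outer_verts_def leaf_edges_length)
    then have "v \<in> dom (map_of (zip (outer_verts t) w))"
      using v by (simp add: dom_map_of_zip)
    then obtain s where s: "map_of (zip (outer_verts t) w) v = Some s" by auto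
    then have "s \<in> set w" by (meson map_of_SomeD set_zip_rightD)
    then show ?thesis using s w(2) by (auto simp: plane_tree_def)
  qed
  then show "labelled_graph n ?G"
    using part ext unfolding labelled_graph_def by (auto simp: plane_tree_def)
qed

lemma Z_form_plane_tree_eq_0:
  assumes X: "pointed_family n X" and G: "green_current X G"
    and w: "nleaves t + 1 = length w" "set w \<subseteq> labels n" and t: "t \<noteq> PLeaf" and u: "u \<in> {0, 1}"
  shows "Z_form n X G (plane_tree t w) (b, 1 - u, u) ts = 0"
proof -
  have 1: "plane_tree t w = (fst (plane_tree t w), 1, map (\<lambda>e. {2 * e, 2 * e + 1}) [0..<nedges t])"
    by (simp add: plane_tree_def)
  have "inj (\<lambda>e::nat. {2 * e, 2 * e + 1})"
    by (rule injI) (auto simp: doubleton_eq_iff; presburger)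
  then have "distinct (map (\<lambda>e::nat. {2 * e, 2 * e + 1}) [0..<nedges t])"
    by (simp only: distinct_map distinct_upt set_upt) (blast intro: inj_on_subset)
  moreover have "inner_verts 0 t \<noteq> {}"
    using t by (cases t) auto
  moreover have "set (map (\<lambda>e. {2 * e, 2 * e + 1}) [0..<nedges t]) = edges (fst (plane_tree t w))"
    by (simp add: plane_tree_def atLeast0LessThan)
  ultimately show ?thesis
    by (subst 1, intro Z_form_eq_0[OF X G plane_tree_labelled(1)[OF w] _ _ _ u])
       (simp_all only: plane_tree_labelled(2)[OF w] not_False_eq_True)
qed

text \<open>Vectors tangent to constant u have no components along z and w, so the summand z dw - w
  dz of the twistor operator disappears.\<close>

lemma at_u_twistor: "at_u u (twistor \<omega>) b ts = \<omega> (b, 1 - u, u) (map (\<lambda>\<beta>. (\<beta>, 0, 0)) ts)"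
  by (simp add: at_u_def twistor_def o_def)

section \<open>Isomorphism classes of graphs\<close>

lemma is_iso_id: "is_iso id \<Gamma> \<Gamma>"
  by (simp add: is_iso_def)

lemma is_isoD:
  assumes "is_iso \<pi> \<Gamma> \<Gamma>'"
  shows "bij_betw \<pi> (hes \<Gamma>) (hes \<Gamma>')" "(`) \<pi> ` edges \<Gamma> = edges \<Gamma>'" "(`) \<pi> ` verts \<Gamma> = verts \<Gamma>'"
    "v \<in> ext_verts \<Gamma> \<Longrightarrow> deco \<Gamma>' (\<pi> ` v) = deco \<Gamma> v"
  using assms by (auto simp: is_iso_def)

lemma is_iso_ext_verts:
  assumes p: "partition_on (hes \<Gamma>) (verts \<Gamma>)" and i: "is_iso \<pi> \<Gamma> \<Gamma>'" and v: "v \<in> verts \<Gamma>"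
  shows "\<pi> ` v \<in> ext_verts \<Gamma>' \<longleftrightarrow> v \<in> ext_verts \<Gamma>"
proof -
  have "v \<subseteq> hes \<Gamma>" using p v partition_onD1 by blast
  then have "card (\<pi> ` v) = card v"
    using bij_betw_imp_inj_on[OF is_isoD(1)[OF i]] by (meson card_image inj_on_subset)
  moreover have "\<pi> ` v \<in> verts \<Gamma>'" using is_isoD(3)[OF i] v by blast
  ultimately show ?thesis using v by (simp add: ext_verts_def)
qed

lemma is_iso_trans:
  assumes p: "partition_on (hes \<Gamma>) (verts \<Gamma>)" and i: "is_iso \<pi> \<Gamma> \<Gamma>'" and j: "is_iso \<rho> \<Gamma>' \<Gamma>''"
  shows "is_iso (\<rho> \<circ> \<pi>) \<Gamma> \<Gamma>''"
  unfolding is_iso_def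
proof (intro conjI ballI)
  show "bij_betw (\<rho> \<circ> \<pi>) (hes \<Gamma>) (hes \<Gamma>'')"
    by (rule bij_betw_trans[OF is_isoD(1)[OF i] is_isoD(1)[OF j]])
  show "(`) (\<rho> \<circ> \<pi>) ` edges \<Gamma> = edges \<Gamma>''" "(`) (\<rho> \<circ> \<pi>) ` verts \<Gamma> = verts \<Gamma>''"
  proof -
    have "(`) (\<rho> \<circ> \<pi>) ` S = (`) \<rho> ` (`) \<pi> ` S" for S
      by (simp add: image_image o_def)
    then show "(`) (\<rho> \<circ> \<pi>) ` edges \<Gamma> = edges \<Gamma>''" "(`) (\<rho> \<circ> \<pi>) ` verts \<Gamma> = verts \<Gamma>''"
      by (simp_all only: is_isoD(2,3)[OF i] is_isoD(2,3)[OF j])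
  qed
  fix v assume v: "v \<in> ext_verts \<Gamma>"
  then have "\<pi> ` v \<in> ext_verts \<Gamma>'"
    using is_iso_ext_verts[OF p i] by (auto simp: ext_verts_def)
  then have "deco \<Gamma>'' (\<rho> ` \<pi> ` v) = deco \<Gamma>' (\<pi> ` v)" by (rule is_isoD(4)[OF j])
  also have "\<dots> = deco \<Gamma> v" by (rule is_isoD(4)[OF i v])
  finally show "deco \<Gamma>'' ((\<rho> \<circ> \<pi>) ` v) = deco \<Gamma> v" by (simp only: image_comp)
qed

lemma is_iso_sym:
  assumes p: "partition_on (hes \<Gamma>) (verts \<Gamma>)" "partition_on (hes \<Gamma>) (edges \<Gamma>)" and i: "is_iso \<pi> \<Gamma> \<Gamma>'"
  shows "is_iso (inv_into (hes \<Gamma>) \<pi>) \<Gamma>' \<Gamma>"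
  unfolding is_iso_def
proof (intro conjI ballI)
  have bij: "bij_betw \<pi> (hes \<Gamma>) (hes \<Gamma>')" using i by (simp add: is_iso_def)
  then show "bij_betw (inv_into (hes \<Gamma>) \<pi>) (hes \<Gamma>') (hes \<Gamma>)" by (rule bij_betw_inv_into)
  have inv: "inv_into (hes \<Gamma>) \<pi> ` \<pi> ` A = A" if "A \<subseteq> hes \<Gamma>" for A
    using bij that unfolding bij_betw_def by (simp add: inv_into_image_cancel)
  have sub: "A \<subseteq> hes \<Gamma>" if "A \<in> edges \<Gamma> \<or> A \<in> verts \<Gamma>" for A
    using p partition_onD1 that by blast
  show "(`) (inv_into (hes \<Gamma>) \<pi>) ` edges \<Gamma>' = edges \<Gamma>"
  proof -
    have "edges \<Gamma>' = (`) \<pi> ` edges \<Gamma>" using i by (simp add: is_iso_def)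
    then show ?thesis using inv sub by (auto simp: image_image)
  qed
  have v': "verts \<Gamma>' = (`) \<pi> ` verts \<Gamma>" using i by (simp add: is_iso_def)
  then show "(`) (inv_into (hes \<Gamma>) \<pi>) ` verts \<Gamma>' = verts \<Gamma>"
    using inv sub by (auto simp: image_image)
  fix v assume v: "v \<in> ext_verts \<Gamma>'"
  then obtain u where u: "u \<in> verts \<Gamma>" "v = \<pi> ` u" using v' by (auto simp: ext_verts_def)
  then have "u \<in> ext_verts \<Gamma>" using is_iso_ext_verts[OF p(1) i] v by blast
  then show "deco \<Gamma> (inv_into (hes \<Gamma>) \<pi> ` v) = deco \<Gamma>' v"
    using i u inv[OF sub] by (simp add: is_iso_def)
qed

definition iso_rel :: "nat \<Rightarrow> nat \<Rightarrow> (graph \<times> graph) set" where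
  "iso_rel n l = {(\<Gamma>, \<Gamma>'). \<Gamma> \<in> action_graphs n l \<and> \<Gamma>' \<in> action_graphs n l \<and>
           std_graph \<Gamma> \<and> std_graph \<Gamma>' \<and> (\<exists>\<pi>. is_iso \<pi> \<Gamma> \<Gamma>')}"

lemma action_graphsD:
  assumes "\<Gamma> \<in> action_graphs n l"
  shows "is_graph n \<Gamma>" "partition_on (hes \<Gamma>) (verts \<Gamma>)" "partition_on (hes \<Gamma>) (edges \<Gamma>)"
  using assms by (auto simp: action_graphs_def is_graph_def)

lemma equiv_iso_rel: "equiv {\<Gamma> \<in> action_graphs n l. std_graph \<Gamma>} (iso_rel n l)"
proof (rule equivI)
  show "refl_on {\<Gamma> \<in> action_graphs n l. std_graph \<Gamma>} (iso_rel n l)"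
    using is_iso_id by (auto simp: refl_on_def iso_rel_def)
  show "sym (iso_rel n l)"
    using is_iso_sym action_graphsD(2,3) by (fastforce simp: sym_def iso_rel_def)
  show "trans (iso_rel n l)"
    unfolding trans_def iso_rel_def using is_iso_trans action_graphsD(2) by blast
qed (auto simp: iso_rel_def)

lemma rep_graphs_alt:
  "rep_graphs n l = (\<lambda>C. SOME \<Gamma>. \<Gamma> \<in> C) ` ({\<Gamma> \<in> action_graphs n l. std_graph \<Gamma>} // iso_rel n l)"
  by (simp add: rep_graphs_def iso_rel_def)

lemma some_in_class:
  assumes "C \<in> {\<Gamma> \<in> action_graphs n l. std_graph \<Gamma>} // iso_rel n l"
  shows "(SOME \<Gamma>. \<Gamma> \<in> C) \<in> C"
  using in_quotient_imp_non_empty[OF equiv_iso_rel assms] some_in_eq by blast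

lemma rep_graphsD:
  assumes "\<Gamma> \<in> rep_graphs n l"
  shows "\<Gamma> \<in> action_graphs n l" "std_graph \<Gamma>"
  using assms some_in_class in_quotient_imp_subset[OF equiv_iso_rel[of n l]]
  unfolding rep_graphs_alt by blast+

lemma rep_graphs_unique:
  assumes "\<Gamma> \<in> rep_graphs n l" "\<Gamma>' \<in> rep_graphs n l" "is_iso \<pi> \<Gamma> \<Gamma>'"
  shows "\<Gamma> = \<Gamma>'"
proof -
  have r: "(\<Gamma>, \<Gamma>') \<in> iso_rel n l"
    using rep_graphsD[OF assms(1)] rep_graphsD[OF assms(2)] assms(3) by (auto simp: iso_rel_def)
  obtain C where C: "C \<in> {\<Gamma> \<in> action_graphs n l. std_graph \<Gamma>} // iso_rel n l" "\<Gamma> = (SOME \<Gamma>. \<Gamma> \<in> C)"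
    using assms(1) unfolding rep_graphs_alt by blast
  obtain C' where C': "C' \<in> {\<Gamma> \<in> action_graphs n l. std_graph \<Gamma>} // iso_rel n l" "\<Gamma>' = (SOME \<Gamma>. \<Gamma> \<in> C')"
    using assms(2) unfolding rep_graphs_alt by blast
  have "C = C'"
    by (rule quotient_eqI[OF equiv_iso_rel C(1) C'(1) _ _ r])
       (use some_in_class[OF C(1)] some_in_class[OF C'(1)] C(2) C'(2) in auto)
  then show ?thesis using C C' by simp
qed

lemma rep_graphs_exists:
  assumes "\<Gamma> \<in> action_graphs n l" "std_graph \<Gamma>"
  obtains \<Gamma>' \<pi> where "\<Gamma>' \<in> rep_graphs n l" "is_iso \<pi> \<Gamma> \<Gamma>'"
proof -
  let ?C = "iso_rel n l `` {\<Gamma>}"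
  have C: "?C \<in> {\<Gamma> \<in> action_graphs n l. std_graph \<Gamma>} // iso_rel n l"
    using assms by (auto intro: quotientI)
  then have "(SOME \<Gamma>. \<Gamma> \<in> ?C) \<in> rep_graphs n l" unfolding rep_graphs_alt by blast
  moreover obtain \<pi> where "is_iso \<pi> \<Gamma> (SOME \<Gamma>. \<Gamma> \<in> ?C)"
    using some_in_class[OF C] by (auto simp: iso_rel_def)
  ultimately show thesis by (rule that)
qed

lemma rep_orient_is_orient:
  assumes "finite (edges \<Gamma>)"
  shows "is_orient \<Gamma> (rep_orient \<Gamma>)"
proof -
  obtain xs where "set xs = edges \<Gamma>" "distinct xs"
    using finite_distinct_list[OF assms] by blast
  then have "is_orient \<Gamma> (1, xs)" by (simp add: is_orient_def)
  then show ?thesis unfolding rep_orient_def by (rule someI)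
qed

section \<open>Reduction of the effective action to single edges\<close>

lemma card_hes:
  assumes "is_graph n \<Gamma>"
  shows "card (hes \<Gamma>) = 2 * card (edges \<Gamma>)" "int_verts \<Gamma> = {} \<Longrightarrow> card (hes \<Gamma>) = card (verts \<Gamma>)"
    "finite (edges \<Gamma>)"
proof -
  have f: "finite (hes \<Gamma>)" and pe: "partition_on (hes \<Gamma>) (edges \<Gamma>)" and pv: "partition_on (hes \<Gamma>) (verts \<Gamma>)"
    and c: "\<And>E. E \<in> edges \<Gamma> \<Longrightarrow> card E = 2"
    using assms by (auto simp: is_graph_def)
  show fe: "finite (edges \<Gamma>)" using finite_elements[OF f pe] .
  have U: "card (hes \<Gamma>) = sum card P" if "partition_on (hes \<Gamma>) P" for P
  proof -
    have "card (\<Union>P) = sum card P"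
      using partition_onD1[OF that] partition_onD2[OF that] f
      by (intro card_Union_disjoint) (auto simp: disjoint_def pairwise_def disjnt_def intro: finite_subset)
    then show ?thesis using partition_onD1[OF that] by simp
  qed
  show "card (hes \<Gamma>) = 2 * card (edges \<Gamma>)"
    using U[OF pe] c by simp
  assume "int_verts \<Gamma> = {}"
  then have "card v = 1" if "v \<in> verts \<Gamma>" for v
    using that by (auto simp: int_verts_def)
  then show "card (hes \<Gamma>) = card (verts \<Gamma>)"
    using U[OF pv] by simp
qed

text \<open>If all vertices are univalent, there are twice as many vertices as edges, so the first
  Betti number of a connected graph is 1 - |E|. It is non-negative and the graph is non-empty, hence
  |E| = 1.\<close>

lemma action_graph_no_int_verts:
  assumes "\<Gamma> \<in> action_graphs n l" "int_verts \<Gamma> = {}"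
  shows "l = 0" "card (edges \<Gamma>) = 1"
proof -
  have g: "is_graph n \<Gamma>" and c: "card (components \<Gamma>) = 1" and b: "betti1 \<Gamma> = int l"
    using assms(1) by (auto simp: action_graphs_def connected_graph_def)
  have "int (card (edges \<Gamma>)) + int l = 1"
    using card_hes(1)[OF g] card_hes(2)[OF g assms(2)] b c unfolding betti1_def by simp
  moreover have "card (edges \<Gamma>) \<noteq> 0"
  proof
    assume "card (edges \<Gamma>) = 0"
    then have "hes \<Gamma> = {}"
      using card_hes(1)[OF g] g by (simp add: is_graph_def)
    then have "components \<Gamma> = {}" by (simp add: components_def)
    then show False using c by simp
  qed
  ultimately show "l = 0" "card (edges \<Gamma>) = 1" by auto
qed

lemma S_eff_nonzero:
  assumes X: "pointed_family n X" and G: "green_current X G" and u: "u \<in> {0, 1}"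
    and nz: "S_eff n X G l g (b, 1 - u, u) ts \<noteq> 0"
  shows "l = 0" "card (edges (fst g)) = 1" "fst g \<in> rep_graphs n l" "snd g = rep_orient (fst g)"
proof -
  show 1: "fst g \<in> rep_graphs n l" "snd g = rep_orient (fst g)"
    using nz by (auto simp: S_eff_def split: if_splits)
  have act: "fst g \<in> action_graphs n l" using rep_graphsD(1)[OF 1(1)] .
  have or: "is_orient (fst g) (snd g)"
    unfolding 1(2) by (rule rep_orient_is_orient[OF card_hes(3)[OF action_graphsD(1)[OF act]]])
  have "int_verts (fst g) = {}"
  proof (rule ccontr)
    assume ne: "int_verts (fst g) \<noteq> {}"
    have "Z_form n X G (fst g, fst (snd g), snd (snd g)) (b, 1 - u, u) ts = 0"
      by (rule Z_form_eq_0[OF X G is_graph_labelled[OF action_graphsD(1)[OF act]] ne _ _ u])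
         (use or in \<open>auto simp: is_orient_def\<close>)
    then show False using nz by (simp add: S_eff_def split: if_splits)
  qed
  then show "l = 0" "card (edges (fst g)) = 1"
    using action_graph_no_int_verts[OF act] by auto
qed

lemma series_eq_S_tree:
  assumes X: "pointed_family n X" and G: "green_current X G" and u: "u \<in> {0, 1}"
  shows "series_eq n (series_at u (S_eff n X G)) (series_at u (S_tree n X G))"
proof -
  have "S_eff n X G l g (b, 1 - u, u) ts = S_tree n X G l g (b, 1 - u, u) ts" for l g b ts
    using S_eff_nonzero(1)[OF X G u, of l g b ts] by (auto simp: S_tree_def)
  then have "series_at u (S_eff n X G) l g b ts = series_at u (S_tree n X G) l g b ts" for l g b ts
    by (simp add: series_at_def at_u_twistor)
  \<comment> \<open>The coefficients agree one by one, so the difference is the empty combination of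
    relations.\<close>
  moreover have "(\<lambda>_. 0) \<in> rel_span n"
    unfolding rel_span_def by (intro CollectI exI[of _ "{}"]) auto
  ultimately show ?thesis by (simp add: series_eq_def cong: if_cong)
qed

section \<open>Single-edge graphs\<close>

text \<open>Defined through \<open>plane_tree\<close>, so that graphs of the action and the one-edge
  tree are literally equal once their labels match.\<close>

definition edge_graph :: "nat \<Rightarrow> nat \<Rightarrow> graph" where
  "edge_graph s t = fst (plane_tree PLeaf [s, t])"

lemma plane_tree_PLeaf: "plane_tree PLeaf [s, t] = (edge_graph s t, 1, [{0, 1}])"
  by (simp add: edge_graph_def plane_tree_def)

lemma edge_graph_simps [simp]:
  "hes (edge_graph s t) = {0, 1}" "edges (edge_graph s t) = {{0, 1}}"
  "verts (edge_graph s t) = {{0}, {1}}" "deco (edge_graph s t) {0} = s" "deco (edge_graph s t) {Suc 0} = t"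
  "v \<noteq> {0} \<Longrightarrow> v \<noteq> {1} \<Longrightarrow> deco (edge_graph s t) v = 0"
  by (auto simp: edge_graph_def plane_tree_def outer_verts_def)

lemma edge_graph_deco_1: "deco (edge_graph s t) {1} = t"
  by simp

lemma edge_graph_ext [simp]: "ext_verts (edge_graph s t) = {{0}, {1}}"
  and edge_graph_int [simp]: "int_verts (edge_graph s t) = {}"
  by (auto simp: ext_verts_def int_verts_def)

lemma edge_graph_std: "std_graph (edge_graph s t)"
  by (auto simp: std_graph_def)

lemma edge_graph_self_loop: "\<not> self_loop (edge_graph s t)"
  by (auto simp: self_loop_def)

lemma edge_graph_components: "components (edge_graph s t) = {{0, 1}}"
proof -
  have "{(h, k). \<exists>A \<in> edges (edge_graph s t) \<union> verts (edge_graph s t). h \<in> A \<and> k \<in> A} = {0, 1} \<times> {0, 1}"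
    by auto
  moreover have "({0, 1} \<times> {0, 1})\<^sup>+ = {0, 1} \<times> {0, 1::nat}"
    by (rule trancl_id) (auto simp: trans_def)
  ultimately show ?thesis
    by (auto simp: components_def quotient_def)
qed

lemma edge_graph_action:
  assumes "s \<in> labels n" "t \<in> labels n"
  shows "edge_graph s t \<in> action_graphs n 0"
proof -
  have "partition_on {0, 1::nat} {{0, 1}}" "partition_on {0, 1::nat} {{0}, {1}}"
    by (auto simp: partition_on_def disjoint_def)
  then have "is_graph n (edge_graph s t)"
    using assms by (auto simp: is_graph_def)
  then show ?thesis
    by (simp add: action_graphs_def connected_graph_def edge_graph_components uni_trivalent_def
        edge_graph_self_loop betti1_def)
qed

text \<open>\<open>std_graph\<close> fixes the half-edges 0 and 1, which leaves only two labels and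
  the sign of the orientation free. That \<open>deco\<close> is 0 off the external vertices makes
  this an equality of records and not just an isomorphism.\<close>

lemma edge_graph_classification:
  assumes "(\<Gamma>, r) \<in> ographs n" "std_graph \<Gamma>" "card (edges \<Gamma>) = 1"
  obtains s t \<epsilon> where "s \<in> labels n" "t \<in> labels n" "\<Gamma> = edge_graph s t" "r = (\<epsilon>, [{0, 1}])" "\<epsilon> = 1 \<or> \<epsilon> = -1"
proof -
  have g: "is_graph n \<Gamma>" and u: "uni_trivalent \<Gamma>" and o: "is_orient \<Gamma> r"
    using assms(1) by (auto simp: ographs_def)
  have "hes \<Gamma> = {..<2 * 1}" using assms(2) unfolding std_graph_def assms(3) .
  also have "{..<2 * 1} = {0, 1::nat}" by auto
  finally have h: "hes \<Gamma> = {0, 1}" .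
  obtain E where E: "edges \<Gamma> = {E}" using card_1_singletonE[OF assms(3)] .
  have "partition_on (hes \<Gamma>) (edges \<Gamma>)" using g by (simp add: is_graph_def)
  then have "\<Union>(edges \<Gamma>) = hes \<Gamma>" using partition_onD1 by metis
  then have edges: "edges \<Gamma> = {{0, 1}}" using E h by simp
  have pv: "partition_on {0, 1} (verts \<Gamma>)" using g h by (simp add: is_graph_def)
  have single: "v = {0} \<or> v = {1}" if v: "v \<in> verts \<Gamma>" for v
  proof -
    have sub: "v \<subseteq> {0, 1}" using partition_onD1[OF pv] v by blast
    then have "card v \<le> 2" using card_mono[OF _ sub] by simp
    then have "card v = 1" using u v by (force simp: uni_trivalent_def)
    then show ?thesis using sub card_1_singletonE by blast
  qed
  have mem: "{h} \<in> verts \<Gamma>" if h: "h \<in> {0, 1}" for h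
  proof -
    obtain v where v: "v \<in> verts \<Gamma>" "h \<in> v" using h unfolding partition_onD1[OF pv] by (rule UnionE)
    then have "v = {h}" using single[OF v(1)] by auto
    then show ?thesis using v(1) by simp
  qed
  have verts: "verts \<Gamma> = {{0}, {1}}"
  proof
    show "verts \<Gamma> \<subseteq> {{0}, {1}}" using single by auto
    show "{{0}, {1}} \<subseteq> verts \<Gamma>" using mem[of 0] mem[of 1] by auto
  qed
  have ext_eq: "ext_verts \<Gamma> = {{0}, {1}}" by (auto simp: ext_verts_def verts)
  have dec: "deco \<Gamma> {0} \<in> labels n" "deco \<Gamma> {1} \<in> labels n" "\<And>v. v \<noteq> {0} \<Longrightarrow> v \<noteq> {1} \<Longrightarrow> deco \<Gamma> v = 0"
    using g ext_eq by (auto simp: is_graph_def)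
  let ?L = "edge_graph (deco \<Gamma> {0}) (deco \<Gamma> {1})"
  have dv: "deco \<Gamma> v = deco ?L v" for v
    using dec(3)[of v] by (cases "v = {0}"; cases "v = {1}") auto
  have d: "deco \<Gamma> = deco ?L" by (rule ext, rule dv)
  have "\<Gamma> = ?L"
  proof (rule graph.equality)
    show "deco \<Gamma> = deco ?L" by (rule d)
  qed (simp_all add: h edges verts)
  moreover have "snd r = [{0, 1}]"
  proof -
    have "distinct (snd r)" "set (snd r) = {{0, 1}}" using o edges by (auto simp: is_orient_def)
    then have "length (snd r) = 1" using distinct_card by fastforce
    then obtain x where "snd r = [x]" by (cases "snd r") auto
    then show ?thesis using \<open>set (snd r) = {{0, 1}}\<close> by simp
  qed
  moreover have "fst r = 1 \<or> fst r = -1" using o by (simp add: is_orient_def)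
  ultimately show thesis
    by (intro that[OF dec(1,2), of "fst r"]) (simp_all add: prod_eq_iff)
qed

text \<open>The ends may be exchanged, but the only edge goes to itself, so no orientation sign can
  arise.\<close>

lemma edge_graph_iso:
  assumes "is_iso \<pi> (edge_graph s t) (edge_graph s' t')"
  shows "(s' = s \<and> t' = t) \<or> (s' = t \<and> t' = s)" "\<pi> ` {0, 1} = {0, 1}"
proof -
  have bij: "bij_betw \<pi> {0, 1} {0, 1}" and d0: "deco (edge_graph s' t') (\<pi> ` {0}) = s"
    and d1: "deco (edge_graph s' t') (\<pi> ` {1}) = t"
    using assms by (auto simp: is_iso_def)
  show "\<pi> ` {0, 1} = {0, 1}" using bij by (simp add: bij_betw_def)
  have "\<pi> 0 \<noteq> \<pi> 1" using bij by (auto simp: bij_betw_def inj_on_def)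
  moreover have "\<pi> 0 \<in> {0, 1}" "\<pi> 1 \<in> {0, 1}" using bij by (auto simp: bij_betw_def)
  ultimately consider "\<pi> 0 = 0" "\<pi> 1 = 1" | "\<pi> 0 = 1" "\<pi> 1 = 0" by auto
  then show "(s' = s \<and> t' = t) \<or> (s' = t \<and> t' = s)"
    by cases (use d0 d1 in auto)
qed

lemma edge_graph_zero: "zero_graph (edge_graph s t) \<longleftrightarrow> s = t"
  by (auto simp: zero_graph_def edge_graph_self_loop multiple_edge_def)

lemma reorder_sign_single: "reorder_sign [x] [x] = 1"
proof -
  have "(THE p::nat \<Rightarrow> nat. p permutes {..<length [x]} \<and> map (\<lambda>i. [x] ! p i) [0..<length [x]] = [x]) = id"
  proof (rule the_equality)
    show "id permutes {..<length [x]} \<and> map (\<lambda>i. [x] ! id i) [0..<length [x]] = [x]"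
      by (simp add: permutes_id)
    fix p :: "nat \<Rightarrow> nat"
    assume "p permutes {..<length [x]} \<and> map (\<lambda>i. [x] ! p i) [0..<length [x]] = [x]"
    then have "p permutes {0}" by (simp add: lessThan_Suc)
    then show "p = id" by (simp add: permutes_sing)
  qed
  then show ?thesis by (simp add: reorder_sign_def sign_id)
qed

text \<open>For distinct labels the graphs are not zero and all isomorphisms have one and the same
  sign, so the pairing sees just the sign of the orientation.\<close>

lemma graph_delta_edge_graph:
  assumes "s \<noteq> t" "\<epsilon> = 1 \<or> \<epsilon> = -1" "is_iso \<pi> (edge_graph s' t') (edge_graph s t)"
  shows "graph_delta (edge_graph s' t', \<epsilon>, [{0, 1}]) (edge_graph s t, 1, [{0, 1}]) = of_int \<epsilon>"
proof -
  have sg: "iso_sign \<rho> (\<epsilon>, [{0, 1}]) (1, [{0, 1}]) = \<epsilon>" if "is_iso \<rho> (edge_graph s' t') (edge_graph s t)" for \<rho>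
    using edge_graph_iso(2)[OF that] by (simp add: iso_sign_def reorder_sign_single)
  have signs: "{iso_sign \<rho> (\<epsilon>, [{0, 1}]) (1, [{0, 1}]) | \<rho>. is_iso \<rho> (edge_graph s' t') (edge_graph s t)} = {\<epsilon>}"
  proof (intro equalityI subsetI)
    fix x assume "x \<in> {\<epsilon>}"
    then have "x = iso_sign \<pi> (\<epsilon>, [{0, 1}]) (1, [{0, 1}])" using sg[OF assms(3)] by simp
    then show "x \<in> {iso_sign \<rho> (\<epsilon>, [{0, 1}]) (1, [{0, 1}]) | \<rho>. is_iso \<rho> (edge_graph s' t') (edge_graph s t)}"
      using assms(3) by blast
  qed (auto simp: sg simp del: One_nat_def)
  have "\<not> zero_graph (edge_graph s t)" "\<not> zero_graph (edge_graph s' t')"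
    using edge_graph_iso(1)[OF assms(3)] assms(1) by (auto simp: edge_graph_zero)
  then show ?thesis
    unfolding graph_delta_def Let_def fst_conv snd_conv signs using assms(2) by auto
qed

lemma Aut_card_pos: "finite (hes \<Gamma>) \<Longrightarrow> card (Aut \<Gamma>) > 0"
proof -
  assume f: "finite (hes \<Gamma>)"
  have "finite (Aut \<Gamma>)"
    by (rule finite_subset[OF _ finite_permutations[OF f]]) (auto simp: Aut_def)
  moreover have "id \<in> Aut \<Gamma>" by (simp add: Aut_def permutes_id is_iso_id)
  ultimately show ?thesis by (auto simp: card_gt_0_iff)
qed

section \<open>The forms of single edges\<close>

lemma vector_derivative_cong_nhds:
  assumes "\<forall>\<^sub>F c in nhds (0::complex). f c = (g c :: complex)"
  shows "vector_derivative (\<lambda>t. f (e * of_real t)) (at 0) = vector_derivative (\<lambda>t. g (e * of_real t)) (at 0)"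
proof -
  have "((\<lambda>t::real. e * of_real t) \<longlongrightarrow> e * of_real 0) (nhds 0)"
    by (intro tendsto_mult tendsto_const tendsto_of_real filterlim_ident)
  then have "\<forall>\<^sub>F t in nhds (0::real). f (e * of_real t) = g (e * of_real t)"
    by (intro eventually_compose_filterlim[OF assms]) simp
  then show ?thesis
    by (intro vector_derivative_cong_eq) (auto elim: eventually_mono)
qed

text \<open>Identities for \<open>G\<close> hold only over \<open>base X\<close>, hence only near 0
  along a line in the base; Wirtinger derivatives at 0 see no more than that.\<close>

lemma wirt_cong_nhds: "\<forall>\<^sub>F c in nhds 0. f c = g c \<Longrightarrow> wirt f = wirt g"
  and wirtbar_cong_nhds: "\<forall>\<^sub>F c in nhds 0. f c = g c \<Longrightarrow> wirtbar f = wirtbar g"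
  using vector_derivative_cong_nhds[of f g 1] vector_derivative_cong_nhds[of f g \<i>]
  by (simp_all add: wirt_def wirtbar_def)

lemma eventually_base:
  assumes "open U" "b \<in> U"
  shows "\<forall>\<^sub>F c in nhds (0::complex). b + c *s \<beta> \<in> (U :: (complex^('b::finite)) set)"
proof -
  have "((\<lambda>c::complex. \<chi> i. b $ i + c * \<beta> $ i) \<longlongrightarrow> (\<chi> i. b $ i + 0 * \<beta> $ i)) (nhds 0)"
    by (intro tendsto_vec_lambda tendsto_add tendsto_mult tendsto_const filterlim_ident)
  moreover have "(\<chi> i. b $ i + c * \<beta> $ i) = b + c *s \<beta>" for c
    by (simp add: vec_eq_iff)
  ultimately have "((\<lambda>c. b + c *s \<beta>) \<longlongrightarrow> b) (nhds 0)" by simp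
  then show ?thesis using assms topological_tendstoD by blast
qed

lemma edge_green_edge_graph:
  "edge_green X G (edge_graph s t) {0, 1} b x = G b (mark X s b) (mark X t b)"
proof -
  have "vertex_of (edge_graph s t) 0 = {0}" "vertex_of (edge_graph s t) 1 = {1}"
    by (auto simp: vertex_of_def intro!: the_equality)
  moreover have "Min {0, 1::nat} = 0" "Max {0, 1::nat} = 1" by auto
  ultimately show ?thesis by (simp add: edge_green_def endpoint_def)
qed

lemma Z_form_edge_graph:
  "Z_form n X G (edge_graph s t, \<epsilon>, [{0, 1}]) (b, z, w) ts =
    (if b \<notin> base X \<or> length ts \<noteq> 1 \<or> s = t then 0
     else case hd ts of (\<beta>, \<zeta>, \<eta>) \<Rightarrow>
       of_int \<epsilon> * (let g = (\<lambda>c. G (b + c *s \<beta>) (mark X s (b + c *s \<beta>)) (mark X t (b + c *s \<beta>)))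
         in w * wirt g - z * wirtbar g + (z * \<eta> - w * \<zeta>) * G b (mark X s b) (mark X t b)))"
  by (auto simp: Z_form_def edge_graph_self_loop edge_form_def edge_green_edge_graph edge_graph_deco_1
      simp del: One_nat_def split: prod.splits)

lemma green_symmetric:
  assumes X: "pointed_family n X" and G: "green_current X G" and b: "b \<in> base X"
    and s: "s \<in> labels n" "t \<in> labels n" "s \<noteq> t"
  shows "G b (mark X s b) (mark X t b) = G b (mark X t b) (mark X s b)"
proof -
  have ne: "mark X s b \<noteq> mark X t b"
    using pointed_familyD(5)[OF X b] s by (auto dest: inj_onD)
  note m = pointed_familyD(4)[OF X b s(1)] pointed_familyD(4)[OF X b s(2)]
  show ?thesis
    unfolding green_current_explicit[OF X G b ne m] green_current_explicit[OF X G b ne[symmetric] m(2,1)]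
    by (simp add: green_fn_def lnd_commute[of "mark X s b" "mark X t b"])
qed

text \<open>\<open>edge_green\<close> takes the ends in the order of their half-edge numbers, over
  which the choice of a representative graph has no control.\<close>

lemma Z_form_edge_graph_symmetric:
  assumes X: "pointed_family n X" and G: "green_current X G" and s: "s \<in> labels n" "t \<in> labels n"
  shows "Z_form n X G (edge_graph s t, \<epsilon>, [{0, 1}]) P ts = Z_form n X G (edge_graph t s, \<epsilon>, [{0, 1}]) P ts"
proof -
  obtain b z w where P: "P = (b, z, w)" by (metis prod.exhaust)
  show ?thesis
  proof (cases "b \<in> base X \<and> s \<noteq> t")
    case True
    have ev: "\<forall>\<^sub>F c in nhds 0. G (b + c *s \<beta>) (mark X s (b + c *s \<beta>)) (mark X t (b + c *s \<beta>)) =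
        G (b + c *s \<beta>) (mark X t (b + c *s \<beta>)) (mark X s (b + c *s \<beta>))" for \<beta>
      using eventually_base[OF pointed_familyD(1)[OF X], of b \<beta>] True
      by (auto elim!: eventually_mono intro: green_symmetric[OF X G _ s])
    show ?thesis
      unfolding P Z_form_edge_graph Let_def wirt_cong_nhds[OF ev] wirtbar_cong_nhds[OF ev]
      using True green_symmetric[OF X G _ s, of b] by (auto split: prod.splits)
  next
    case False
    then show ?thesis unfolding P Z_form_edge_graph by auto
  qed
qed

lemma graph_delta_nonzero:
  assumes "graph_delta g g' \<noteq> 0"
  obtains \<pi> where "is_iso \<pi> (fst g) (fst g')"
proof -
  have "\<exists>\<pi>. is_iso \<pi> (fst g) (fst g')"
  proof (rule ccontr)
    assume "\<nexists>\<pi>. is_iso \<pi> (fst g) (fst g')"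
    then have "{iso_sign \<pi> (snd g) (snd g') | \<pi>. is_iso \<pi> (fst g) (fst g')} = {}" by blast
    then show False using assms by (simp add: graph_delta_def split: if_splits)
  qed
  then show thesis using that by blast
qed

text \<open>Guards the evaluation on trees: a sum over an infinite set would be 0 by
  convention.\<close>

lemma finite_edge_ographs:
  "finite {g. g \<in> ographs n \<and> std_graph (fst g) \<and> card (edges (fst g)) = 1}"
proof (rule finite_subset)
  show "finite ((\<lambda>(s, t, \<epsilon>). (edge_graph s t, \<epsilon>, [{0, 1}])) ` (labels n \<times> labels n \<times> {1, -1}))"
    by (simp add: labels_def)
  show "{g. g \<in> ographs n \<and> std_graph (fst g) \<and> card (edges (fst g)) = 1} \<subseteq>
      (\<lambda>(s, t, \<epsilon>). (edge_graph s t, \<epsilon>, [{0, 1}])) ` (labels n \<times> labels n \<times> {1, -1})"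
  proof
    fix g assume "g \<in> {g. g \<in> ographs n \<and> std_graph (fst g) \<and> card (edges (fst g)) = 1}"
    then have "(fst g, snd g) \<in> ographs n" "std_graph (fst g)" "card (edges (fst g)) = 1" by auto
    then obtain s t \<epsilon> where "s \<in> labels n" "t \<in> labels n" "fst g = edge_graph s t"
        "snd g = (\<epsilon>, [{0, 1}])" "\<epsilon> = 1 \<or> \<epsilon> = -1"
      by (rule edge_graph_classification)
    then show "g \<in> (\<lambda>(s, t, \<epsilon>). (edge_graph s t, \<epsilon>, [{0, 1}])) ` (labels n \<times> labels n \<times> {1, -1})"
      by (intro image_eqI[of _ _ "(s, t, \<epsilon>)"]) (auto simp: prod_eq_iff)
  qed
qed

text \<open>Exactly one representative is isomorphic to the one-edge tree. Its automorphism factor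
  cancels between the action and the pairing, and the sign \<epsilon> of its orientation occurs
  twice. For equal labels both sides vanish.\<close>

lemma sum_edge_graphs:
  assumes X: "pointed_family n X" and G: "green_current X G" and st: "s \<in> labels n" "t \<in> labels n"
  shows "(\<Sum>g | g \<in> ographs n \<and> std_graph (fst g) \<and> card (edges (fst g)) = 1.
      S_tree n X G 0 g P ts * graph_pairing g (plane_tree PLeaf [s, t])) =
    Z_form n X G (plane_tree PLeaf [s, t]) P ts"
    (is "sum ?f ?S = _")
proof (cases "s = t")
  case True
  then have "zero_graph (fst (plane_tree PLeaf [s, t]))"
    by (simp add: plane_tree_PLeaf edge_graph_zero)
  then have "graph_pairing g (plane_tree PLeaf [s, t]) = 0" for g
    by (simp add: graph_pairing_def graph_delta_def)
  moreover have "Z_form n X G (plane_tree PLeaf [s, t]) P ts = 0"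
    using True unfolding plane_tree_PLeaf by (cases P) (simp only: Z_form_edge_graph simp_thms if_True)
  ultimately show ?thesis by simp
next
  case False
  obtain \<Gamma> \<pi> where \<Gamma>: "\<Gamma> \<in> rep_graphs n 0" "is_iso \<pi> (edge_graph s t) \<Gamma>"
    using rep_graphs_exists[OF edge_graph_action[OF st] edge_graph_std] .
  note act = rep_graphsD[OF \<Gamma>(1)]
  let ?g = "(\<Gamma>, rep_orient \<Gamma>)"
  have og: "?g \<in> ographs n"
    using act(1) rep_orient_is_orient[OF card_hes(3)[OF action_graphsD(1)[OF act(1)]]]
    by (auto simp: ographs_def action_graphs_def)
  have "edges \<Gamma> = {\<pi> ` {0, 1}}" using is_isoD(2)[OF \<Gamma>(2)] by simp
  then have c1: "card (edges \<Gamma>) = 1" by simp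
  obtain s' t' \<epsilon> where g: "\<Gamma> = edge_graph s' t'" "rep_orient \<Gamma> = (\<epsilon>, [{0, 1}])" "\<epsilon> = 1 \<or> \<epsilon> = -1"
    using edge_graph_classification[OF og act(2) c1] by metis
  have pe: "partition_on (hes (edge_graph s t)) (verts (edge_graph s t))"
      "partition_on (hes (edge_graph s t)) (edges (edge_graph s t))"
    using action_graphsD(2,3)[OF edge_graph_action[OF st]] .
  have iso': "is_iso (inv_into (hes (edge_graph s t)) \<pi>) (edge_graph s' t') (edge_graph s t)"
    using is_iso_sym[OF pe \<Gamma>(2)] unfolding g(1) .
  have st': "s' = s \<and> t' = t \<or> s' = t \<and> t' = s"
    using edge_graph_iso(1) \<Gamma>(2) unfolding g(1) by blast
  have "sum ?f ?S = sum ?f {?g}"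
  proof (rule sum.mono_neutral_right[OF finite_edge_ographs])
    show "{?g} \<subseteq> ?S" using og act(2) c1 by auto
    \<comment> \<open>Another term that pairs non-trivially would be a second representative of the
      same class.\<close>
    show "\<forall>g\<in>?S - {?g}. ?f g = 0"
    proof (rule ballI, rule ccontr)
      fix h assume h: "h \<in> ?S - {?g}" "?f h \<noteq> 0"
      then have rep: "fst h \<in> rep_graphs n 0" "snd h = rep_orient (fst h)"
        by (auto simp: S_tree_def S_eff_def split: if_splits)
      have "graph_delta h (plane_tree PLeaf [s, t]) \<noteq> 0" using h(2) by (auto simp: graph_pairing_def)
      then obtain \<rho> where "is_iso \<rho> (fst h) (edge_graph s t)"
        by (rule graph_delta_nonzero) (simp add: plane_tree_PLeaf)
      then have "is_iso (\<pi> \<circ> \<rho>) (fst h) \<Gamma>"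
        using is_iso_trans[OF action_graphsD(2)[OF rep_graphsD(1)[OF rep(1)]] _ \<Gamma>(2)] by blast
      then have "fst h = \<Gamma>" by (rule rep_graphs_unique[OF rep(1) \<Gamma>(1)])
      then have "h = ?g" using rep(2) by (simp add: prod_eq_iff)
      then show False using h(1) by simp
    qed
  qed
  also have "\<dots> = ?f ?g" by simp
  also have "\<dots> = Z_form n X G ?g P ts * graph_delta ?g (plane_tree PLeaf [s, t])"
    using Aut_card_pos[of \<Gamma>] \<Gamma>(1) unfolding S_tree_def S_eff_def graph_pairing_def by (simp add: g(1))
  also have "graph_delta ?g (plane_tree PLeaf [s, t]) = of_int \<epsilon>"
    unfolding plane_tree_PLeaf g(2) unfolding g(1)
    by (rule graph_delta_edge_graph[OF False g(3) iso'])
  also have "Z_form n X G ?g P ts = Z_form n X G (edge_graph s t, \<epsilon>, [{0, 1}]) P ts"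
    unfolding g(2) unfolding g(1) using st' Z_form_edge_graph_symmetric[OF X G st] by metis
  also have "\<dots> * of_int \<epsilon> = Z_form n X G (plane_tree PLeaf [s, t]) P ts"
    unfolding plane_tree_PLeaf using g(3)
    by (cases P) (auto simp only: Z_form_edge_graph mult_zero_left split: prod.splits if_splits; simp)
  finally show ?thesis .
qed

section \<open>Comparison with cyclic words\<close>

lemma nedges_eq_1: "nedges t = 1 \<longleftrightarrow> t = PLeaf"
  using nedges_pos by (cases t) (auto simp: add_is_1 less_imp_neq[symmetric])

lemma word_of_cyword:
  assumes "W \<in> cywords n k"
  shows "word_of W \<in> W" "set (word_of W) \<subseteq> labels n" "length (word_of W) = k"
proof -
  obtain w where w: "W = cyc w" "length w = k" "set w \<subseteq> labels n"
    using assms by (auto simp: cywords_def)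
  have "w \<in> W" unfolding w cyc_def by (metis rangeI rotate0 id_apply)
  then show in_W: "word_of W \<in> W" unfolding word_of_def by (rule someI)
  then obtain i where i: "word_of W = rotate i w" by (auto simp: w cyc_def)
  then show "set (word_of W) \<subseteq> labels n" "length (word_of W) = k" using w by auto
qed

text \<open>The comparison is tree by tree. A tree with an internal vertex contributes 0 to the
  Hodge correlator, and having more than one edge it meets only graphs with zero coefficient. The
  one-edge tree is \<open>sum_edge_graphs\<close>, and both sides are divided by the same
  \<open>aut_cyword W\<close>.\<close>

lemma to_cyseries_S_tree:
  fixes X :: "('b::finite) family"
  assumes X: "pointed_family n X" and G: "green_current X G" and u: "u \<in> {0, 1}"
  shows "to_cyseries n (series_at u (S_tree n X G) 0) = cyseries_at u (Hodge_corr n X G)"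
proof (intro ext)
  fix W and b :: "complex^'b" and ts :: "(complex^'b) list"
  let ?ts = "map (\<lambda>\<beta>. (\<beta>, 0, 0)) ts" and ?w = "word_of W" and ?P = "(b, 1 - u, u)"
  have "(\<Sum>g | g \<in> ographs n \<and> std_graph (fst g) \<and> card (edges (fst g)) = nedges t.
        S_tree n X G 0 g ?P ?ts * graph_pairing g (plane_tree t ?w)) = Z_form n X G (plane_tree t ?w) ?P ?ts"
    if W: "W \<in> cywords n k" and t: "t \<in> ptrees ?w" for t k
  proof (cases "t = PLeaf")
    case True
    then have "length ?w = 2" using t by (simp add: ptrees_def)
    then obtain s s' where w: "?w = [s, s']" by (auto simp: numeral_2_eq_2 length_Suc_conv)
    have "s \<in> labels n" "s' \<in> labels n" using word_of_cyword(2)[OF W] w by auto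
    then show ?thesis unfolding w True nedges.simps by (rule sum_edge_graphs[OF X G])
  next
    case False
    have "S_tree n X G 0 g ?P ?ts = 0" if "card (edges (fst g)) = nedges t" for g
      using S_eff_nonzero(2)[OF X G u, of 0 g b ?ts] that False nedges_eq_1[of t] by (auto simp: S_tree_def)
    moreover have "Z_form n X G (plane_tree t ?w) ?P ?ts = 0"
      using t word_of_cyword(2)[OF W] by (intro Z_form_plane_tree_eq_0[OF X G _ _ False u]) (auto simp: ptrees_def)
    ultimately show ?thesis by (simp add: sum.neutral)
  qed
  then show "to_cyseries n (series_at u (S_tree n X G) 0) W b ts = cyseries_at u (Hodge_corr n X G) W b ts"
    unfolding to_cyseries_def cyseries_at_def eval_on_trees_def series_at_def at_u_twistor Hodge_corr_def
    by (auto intro!: sum.cong)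
qed

section \<open>Noncommutative series\<close>

lemma nc_mult_add_left: "nc_mult (nc_add f g) h = nc_add (nc_mult f h) (nc_mult g h)"
  and nc_mult_add_right: "nc_mult h (nc_add f g) = nc_add (nc_mult h f) (nc_mult h g)"
  and nc_mult_scale_left: "nc_mult (nc_scale c f) h = nc_scale c (nc_mult f h)"
  and nc_mult_scale_right: "nc_mult h (nc_scale c f) = nc_scale c (nc_mult h f)"
  by (auto simp: nc_mult_def nc_add_def nc_scale_def fun_eq_iff algebra_simps sum.distrib sum_distrib_left)

text \<open>Cutting a word at a position behaves like splitting an exponent, so the reindexing of
  the double sum is the one for power series. The third argument of \<open>?T\<close> is a dummy
  that matches the shape of that lemma.\<close>

lemma nc_mult_assoc: "nc_mult (nc_mult f g) h = nc_mult f (nc_mult g h)"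
proof
  fix w :: "bool list"
  let ?n = "length w"
  let ?T = "\<lambda>i k (m::nat). f (take i w) * g (take k (drop i w)) * h (drop (i + k) w)"
  have "nc_mult (nc_mult f g) h w = (\<Sum>j=0..?n. \<Sum>i=0..j. ?T i (j - i) (?n - j))"
    unfolding nc_mult_def atMost_atLeast0
    by (intro sum.cong refl) (auto simp: sum_distrib_right min_def drop_take intro!: sum.cong)
  also have "\<dots> = (\<Sum>j=0..?n. \<Sum>i=0..?n - j. ?T j i (?n - j - i))"
    by (rule fps_mult_assoc_lemma)
  also have "\<dots> = nc_mult f (nc_mult g h) w"
    unfolding nc_mult_def atMost_atLeast0
    by (intro sum.cong refl) (auto simp: sum_distrib_left mult.assoc add.commute intro!: sum.cong)
  finally show "nc_mult (nc_mult f g) h w = nc_mult f (nc_mult g h) w" .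
qed

lemma derivation_ad: "derivation (ad f)"
  unfolding derivation_def ad_def nc_bracket_def nc_mult_add_left nc_mult_add_right
    nc_mult_scale_left nc_mult_scale_right nc_mult_assoc
  by (auto simp: nc_add_def nc_scale_def fun_eq_iff algebra_simps)

lemma nc_scale_ad: "nc_scale c (ad f g) = ad (nc_scale c f) g"
  unfolding ad_def nc_bracket_def nc_mult_scale_left nc_mult_scale_right
  by (auto simp: nc_add_def nc_scale_def fun_eq_iff algebra_simps)

text \<open>The multiple of \<open>f\<close> drops out because [f, f] = 0. This is where terms
  proportional to X_s are lost, among them the contribution of the tangent vector.\<close>

lemma bracket_cancel:
  assumes "\<And>v. h v + g v = c * f v"
  shows "nc_scale (-1) (nc_bracket f g) = nc_bracket f h"
proof -
  have h: "h = nc_add (nc_scale c f) (nc_scale (-1) g)"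
    using assms by (auto simp: nc_add_def nc_scale_def fun_eq_iff algebra_simps)
  show ?thesis
    unfolding h nc_bracket_def nc_mult_add_left nc_mult_add_right nc_mult_scale_left nc_mult_scale_right
    by (auto simp: nc_add_def nc_scale_def fun_eq_iff algebra_simps)
qed

lemma nc_mult_one: "nc_mult f nc_one = f"
proof
  fix w
  have "nc_mult f nc_one w = (\<Sum>i\<le>length w. if i = length w then f w else 0)"
    unfolding nc_mult_def nc_one_def by (intro sum.cong) auto
  then show "nc_mult f nc_one w = f w" by simp
qed

lemma nc_word_single: "nc_word [s] = X_letter s"
  by (simp add: nc_word_def nc_mult_one)

lemma X_letter_zero: "length v \<noteq> 1 \<Longrightarrow> X_letter s v = 0"
  by (auto simp: X_letter_def nc_letter_def nc_add_def nc_scale_def)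

lemma labels_4: "labels 4 = {1, 2, 3}"
  by (auto simp: labels_def)

section \<open>Cyclic words of length two\<close>

lemma cyc_pair: "cyc [s, t] = {[s, t], [t, s]}"
proof -
  have "rotate i [s, t] = (if even i then [s, t] else [t, s])" for i
    by (induction i) auto
  moreover have "\<exists>i::nat. even i" "\<exists>i::nat. odd i" by (rule exI[of _ 0], simp, rule exI[of _ 1], simp)
  ultimately show ?thesis by (auto simp: cyc_def)
qed

text \<open>The chosen linear word is known only up to rotation; the formulas below are symmetric in
  the two letters.\<close>

lemma word_of_pair: "word_of (cyc [s, t]) = [s, t] \<or> word_of (cyc [s, t]) = [t, s]"
proof -
  have "word_of (cyc [s, t]) \<in> cyc [s, t]"
    unfolding word_of_def by (rule someI[of _ "[s, t]"]) (simp add: cyc_pair)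
  then show ?thesis by (simp add: cyc_pair)
qed

lemma cywords_4_2:
  "cywords 4 2 = {cyc [1, 1], cyc [2, 2], cyc [3, 3], cyc [1, 2], cyc [1, 3], cyc [2, 3]}" (is "_ = ?S")
proof
  show "cywords 4 2 \<subseteq> ?S"
  proof
    fix W assume "W \<in> cywords 4 2"
    then obtain w where w: "W = cyc w" "length w = 2" "set w \<subseteq> {1, 2, 3}"
      by (auto simp: cywords_def labels_4)
    then obtain s t where "w = [s, t]" by (auto simp: numeral_2_eq_2 length_Suc_conv)
    with w show "W \<in> ?S"
      by (auto simp: cyc_pair)
  qed
  have "cyc [s, t] \<in> cywords 4 2" if "s \<in> {1, 2, 3}" "t \<in> {1, 2, 3}" for s t
    using that by (auto simp: cywords_def labels_4 intro!: exI[of _ "[s, t]"])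
  then show "?S \<subseteq> cywords 4 2"
    by auto
qed

lemma occurrence_sum:
  assumes "w = [p, q]"
  shows "(\<Sum>i | i < length w \<and> w ! i = s. nc_word (tl (rotate i w)) v) =
    (if s = p then X_letter q v else 0) + (if s = q then X_letter p v else 0)"
proof -
  have "{i. i < length w \<and> w ! i = s} = (if s = p then {0} else {}) \<union> (if s = q then {1} else {})"
    using assms by (auto simp: less_Suc_eq nth_Cons' split: if_splits)
  then show ?thesis
    using assms by (auto simp: nc_word_single)
qed

text \<open>The coefficient at \<open>v\<close> comes from cyclic words of length
  \<open>length v + 1\<close>, so only one-letter words \<open>v\<close> matter. Pairs of equal
  letters have coefficient 0, which leaves three cyclic words.\<close>

lemma cy_deriv_pairs:
  assumes F0: "\<And>k W. k \<noteq> 2 \<Longrightarrow> W \<in> cywords 4 k \<Longrightarrow> F W = 0"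
    and F2: "\<And>W s t. W \<in> cywords 4 2 \<Longrightarrow> word_of W = [s, t] \<Longrightarrow> F W = (if s = t then 0 else A - B s - B t)"
  shows "cy_deriv s F v =
      (A - B 1 - B 2) * ((if s = 1 then X_letter 2 v else 0) + (if s = 2 then X_letter 1 v else 0))
    + (A - B 1 - B 3) * ((if s = 1 then X_letter 3 v else 0) + (if s = 3 then X_letter 1 v else 0))
    + (A - B 2 - B 3) * ((if s = 2 then X_letter 3 v else 0) + (if s = 3 then X_letter 2 v else 0))"
    (is "_ = ?X + ?Y + ?Z")
proof (cases "length v = 1")
  case False
  then have "cy_deriv s F v = 0"
    unfolding cy_deriv_def by (intro sum.neutral ballI) (simp add: F0[of "length v + 1"])
  then show ?thesis using X_letter_zero[OF False] by simp
next
  case True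
  let ?P = "{cyc [1, 2], cyc [1, 3], cyc [2, 3]}"
  let ?I = "\<lambda>W. \<Sum>i | i < length (word_of W) \<and> word_of W ! i = s. nc_word (tl (rotate i (word_of W))) v"
  have pair: "F (cyc [p, q]) * ?I (cyc [p, q]) = (if p = q then 0 else (A - B p - B q) *
      ((if s = p then X_letter q v else 0) + (if s = q then X_letter p v else 0)))"
    if "cyc [p, q] \<in> cywords 4 2" for p q
    using word_of_pair[of p q]
  proof
    assume w: "word_of (cyc [p, q]) = [p, q]"
    show ?thesis unfolding F2[OF that w] occurrence_sum[OF w] by simp
  next
    assume w: "word_of (cyc [p, q]) = [q, p]"
    show ?thesis unfolding F2[OF that w] occurrence_sum[OF w] by simp
  qed
  have "cy_deriv s F v = (\<Sum>W\<in>cywords 4 2. F W * ?I W)"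
    unfolding cy_deriv_def using True by (simp add: numeral_2_eq_2)
  also have "\<dots> = (\<Sum>W\<in>?P. F W * ?I W)"
  proof (rule sum.mono_neutral_right)
    show "\<forall>W\<in>cywords 4 2 - ?P. F W * ?I W = 0"
    proof
      fix W assume W: "W \<in> cywords 4 2 - ?P"
      then obtain p where p: "W = cyc [p, p]" by (auto simp: cywords_4_2)
      show "F W * ?I W = 0" using pair[of p p] W p by simp
    qed
  qed (auto simp: cywords_4_2)
  also have "\<dots> = F (cyc [1, 2]) * ?I (cyc [1, 2]) + F (cyc [1, 3]) * ?I (cyc [1, 3]) + F (cyc [2, 3]) * ?I (cyc [2, 3])"
  proof -
    have "cyc [1, 2] \<noteq> cyc [1, 3]" "cyc [1, 2] \<noteq> cyc [2, 3]" "cyc [1, 3] \<noteq> cyc [2, 3]"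
      by (auto simp: cyc_pair doubleton_eq_iff)
    then show ?thesis by (simp add: add.assoc del: One_nat_def)
  qed
  also have "F (cyc [1, 2]) * ?I (cyc [1, 2]) =
      ?X"
    by (subst pair) (auto simp: cywords_4_2)
  also have "F (cyc [1, 3]) * ?I (cyc [1, 3]) =
      ?Y"
    by (subst pair) (auto simp: cywords_4_2)
  also have "F (cyc [2, 3]) * ?I (cyc [2, 3]) =
      ?Z"
    by (subst pair) (auto simp: cywords_4_2)
  finally show ?thesis .
qed

text \<open>Write B_t for \<open>B t\<close>. As X_1 + X_2 + X_3 = 0, the sum of (A - B_s - B_t) X_t
  over t \<noteq> s equals (2 B_s - A) X_s - \<omega>, and the first term commutes with X_s.\<close>

lemma special_derivation_of_pairs:
  assumes F0: "\<And>k W. k \<noteq> 2 \<Longrightarrow> W \<in> cywords 4 k \<Longrightarrow> F W = 0"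
    and F2: "\<And>W s t. W \<in> cywords 4 2 \<Longrightarrow> word_of W = [s, t] \<Longrightarrow> F W = (if s = t then 0 else A - B s - B t)"
    and B3: "B 3 = 0"
    and \<omega>: "\<omega> = nc_add (nc_scale (B 1) (nc_letter False)) (nc_scale (B 2) (nc_letter True))"
  shows "special_derivation_of F (\<lambda>Y. nc_scale (-1) (ad \<omega> Y))"
  unfolding special_derivation_of_def
proof (intro conjI ballI)
  show "derivation (\<lambda>Y. nc_scale (-1) (ad \<omega> Y))"
    unfolding nc_scale_ad by (rule derivation_ad)
  fix s :: nat assume s: "s \<in> {1, 2, 3}"
  define c where "c = (if s = 1 then 2 * B 1 - A else if s = 2 then 2 * B 2 - A else - A)"
  have "cy_deriv s F v + \<omega> v = c * X_letter s v" for v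
  proof -
    note cd = cy_deriv_pairs[of F A B s v, OF F0 F2]
    show ?thesis
      using s by (subst cd) (auto simp: B3 \<omega> c_def X_letter_def nc_add_def nc_scale_def algebra_simps)
  qed
  then show "nc_scale (-1) (ad \<omega> (X_letter s)) = nc_bracket (X_letter s) (cy_deriv s F)"
    unfolding ad_def by (rule bracket_cancel)
qed

lemma ad_special: "f \<in> free_lie \<Longrightarrow> ad f \<in> special_derivations"
  unfolding special_derivations_def using derivation_ad
  by (auto simp: ad_def intro: free_lie.intros)

section \<open>The enhanced moduli space of four points\<close>

lemma base_M04: "b \<in> base M04 \<longleftrightarrow> b $ 1 \<noteq> 0 \<and> b $ 1 \<noteq> 1 \<and> b $ 2 \<noteq> 0"
  and sec0_M04: "sec0 M04 b = b $ 1" and tvec_M04: "tvec M04 b = b $ 2"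
  and mark_M04: "mark M04 1 b = Aff 0" "mark M04 2 b = Aff 1" "mark M04 3 b = Infty"
  by (auto simp: M04_def)

lemma holo_component: "holo U (\<lambda>b. b $ i)"
  unfolding holo_def
  by (intro ballI exI[of _ "\<lambda>b. b $ i"] conjI bounded_linear_imp_has_derivative bounded_linear_vec_nth) auto

lemma holo_P1_const: "open U \<Longrightarrow> holo_P1 U (\<lambda>_. p)"
proof -
  assume U: "open U"
  obtain k x where p: "p = chart k x" using chart_surj by blast
  have "holo U (\<lambda>_. x)"
    unfolding holo_def by (intro ballI exI[of _ "\<lambda>_. 0"] conjI has_derivative_const) auto
  then show ?thesis
    using U p unfolding holo_P1_def by blast
qed

lemma pointed_family_M04: "pointed_family 4 M04"
  unfolding pointed_family_def
proof (intro conjI ballI)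
  have "base M04 = {b. b $ 1 \<noteq> 0} \<inter> {b. b $ 1 \<noteq> 1} \<inter> {b. b $ 2 \<noteq> 0}"
    by (auto simp: base_M04)
  moreover have "open {b :: complex^2. b $ i \<noteq> z}" for i z
    by (intro open_Collect_neq continuous_intros)
  ultimately show o: "open (base M04)" by (simp only: open_Int)
  show "holo (base M04) (sec0 M04)" "holo (base M04) (tvec M04)"
    using holo_component by (simp_all add: M04_def)
  show "holo_P1 (base M04) (mark M04 s)" if "s \<in> labels 4" for s
    using holo_P1_const[OF o] that by (auto simp: M04_def)
  show "pointed_line 4 (sec0 M04 b) (tvec M04 b) (\<lambda>s. mark M04 s b)" if "b \<in> base M04" for b
    using that by (auto simp: pointed_line_def labels_4 base_M04 sec0_M04 tvec_M04 mark_M04 inj_on_def M04_def)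
qed

section \<open>Homogeneous coordinates and universality for four points\<close>

text \<open>The point with homogeneous coordinates u, w. Moebius maps become linear, and the case
  distinctions at infinity disappear.\<close>

definition ratio :: "complex \<Rightarrow> complex \<Rightarrow> P1" where
  "ratio u w = (if w = 0 then Infty else Aff (u / w))"

lemma mob_ratio: "mob a b c d (Aff x) = ratio (a * x + b) (c * x + d)" "mob a b c d Infty = ratio a c"
  by (auto simp: ratio_def moebius_def)

lemma ratio_eq_iff:
  "(u, w) \<noteq> (0, 0) \<Longrightarrow> (u', w') \<noteq> (0, 0) \<Longrightarrow> ratio u w = ratio u' w' \<longleftrightarrow> u * w' = u' * w"
  by (auto simp: ratio_def frac_eq_eq)

lemma ratio_surj: obtains u w where "p = ratio u w" "(u, w) \<noteq> (0, 0)"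
proof (cases p)
  case (Aff x)
  then have "p = ratio x 1" by (simp add: ratio_def)
  then show thesis using that by force
next
  case Infty
  then have "p = ratio 1 0" by (simp add: ratio_def)
  then show thesis using that by force
qed

lemma ratio_scale: "k \<noteq> 0 \<Longrightarrow> ratio (k * u) (k * w) = ratio u w"
  by (simp add: ratio_def)

lemma ratio_Aff_iff: "(u, w) \<noteq> (0, 0) \<Longrightarrow> ratio u w = Aff z \<longleftrightarrow> u = z * w"
  by (auto simp: ratio_def field_simps)

lemma parallel_pairs:
  fixes a c a' c' :: complex
  assumes "(a, c) \<noteq> (0, 0)" "(a', c') \<noteq> (0, 0)" "a * c' = a' * c"
  obtains k where "k \<noteq> 0" "a = k * a'" "c = k * c'"
proof (cases "a' = 0")
  case True
  then have "a = 0" "c' \<noteq> 0" "c \<noteq> 0" using assms by auto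
  then show thesis using True that[of "c / c'"] by auto
next
  case False
  have "a \<noteq> 0" using assms False by auto
  then show thesis using False that[of "a / a'"] assms by (auto simp: field_simps)
qed

lemma pointed_iso_M04:
  "pointed_iso 4 (sec0 M04 b) (tvec M04 b) (\<lambda>s. mark M04 s b) z v q \<longleftrightarrow>
    (\<exists>a \<beta> c d. a * d - \<beta> * c \<noteq> 0 \<and> ratio (a * b $ 1 + \<beta>) (c * b $ 1 + d) = Aff z \<and>
       (a * d - \<beta> * c) / (c * b $ 1 + d)\<^sup>2 * b $ 2 = v \<and>
       ratio \<beta> d = q 1 \<and> ratio (a + \<beta>) (c + d) = q 2 \<and> ratio a c = q 3)"
  unfolding pointed_iso_def labels_4 sec0_M04 tvec_M04
  by (simp only: ball_simps mark_M04 mob_ratio mult_zero_right mult_1_right add_0_left simp_thms)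

text \<open>The columns of the matrices are lifts of the images of \<infinity> and 0, so the
  matrices agree up to one factor per column, and the image of 1 makes the two factors equal. The
  maps then coincide, and by injectivity they determine s_0 and the tangent vector.\<close>

lemma pointed_iso_M04_unique:
  assumes "pointed_iso 4 (sec0 M04 b) (tvec M04 b) (\<lambda>s. mark M04 s b) z v q"
    and "pointed_iso 4 (sec0 M04 b') (tvec M04 b') (\<lambda>s. mark M04 s b') z v q"
  shows "b = b'"
proof -
  obtain a \<beta> c d where 1: "a * d - \<beta> * c \<noteq> 0" "ratio (a * b $ 1 + \<beta>) (c * b $ 1 + d) = Aff z"
      "(a * d - \<beta> * c) / (c * b $ 1 + d)\<^sup>2 * b $ 2 = v"
      "ratio \<beta> d = q 1" "ratio (a + \<beta>) (c + d) = q 2" "ratio a c = q 3"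
    using assms(1) unfolding pointed_iso_M04 by blast
  obtain a' \<beta>' c' d' where 2: "a' * d' - \<beta>' * c' \<noteq> 0" "ratio (a' * b' $ 1 + \<beta>') (c' * b' $ 1 + d') = Aff z"
      "(a' * d' - \<beta>' * c') / (c' * b' $ 1 + d')\<^sup>2 * b' $ 2 = v"
      "ratio \<beta>' d' = q 1" "ratio (a' + \<beta>') (c' + d') = q 2" "ratio a' c' = q 3"
    using assms(2) unfolding pointed_iso_M04 by blast
  have nz: "(a, c) \<noteq> (0, 0)" "(\<beta>, d) \<noteq> (0, 0)" "(a + \<beta>, c + d) \<noteq> (0, 0)"
    using 1(1) by (auto simp: add_eq_0_iff algebra_simps)
  have nz': "(a', c') \<noteq> (0, 0)" "(\<beta>', d') \<noteq> (0, 0)" "(a' + \<beta>', c' + d') \<noteq> (0, 0)"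
    using 2(1) by (auto simp: add_eq_0_iff algebra_simps)
  obtain k where k: "k \<noteq> 0" "a = k * a'" "c = k * c'"
    using parallel_pairs[OF nz(1) nz'(1)] 1(6) 2(6) ratio_eq_iff[OF nz(1) nz'(1)] by metis
  obtain m where m: "m \<noteq> 0" "\<beta> = m * \<beta>'" "d = m * d'"
    using parallel_pairs[OF nz(2) nz'(2)] 1(4) 2(4) ratio_eq_iff[OF nz(2) nz'(2)] by metis
  have "(a + \<beta>) * (c' + d') = (a' + \<beta>') * (c + d)"
    using 1(5) 2(5) ratio_eq_iff[OF nz(3) nz'(3)] by metis
  then have "(k - m) * (a' * d' - \<beta>' * c') = 0"
    unfolding k m by (simp add: algebra_simps)
  then have mk: "m = k" using 2(1) by simp
  have r: "ratio (a * b $ 1 + \<beta>) (c * b $ 1 + d) = ratio (a' * b $ 1 + \<beta>') (c' * b $ 1 + d')"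
    using ratio_scale[OF k(1), of "a' * b $ 1 + \<beta>'" "c' * b $ 1 + d'"] unfolding k m mk by (simp add: algebra_simps)
  have den: "c' * x + d' \<noteq> 0 \<and> a' * x + \<beta>' = z * (c' * x + d')" if "ratio (a' * x + \<beta>') (c' * x + d') = Aff z" for x
    using that by (auto simp: ratio_def split: if_splits)
  have den1: "c' * b $ 1 + d' \<noteq> 0" "a' * b $ 1 + \<beta>' = z * (c' * b $ 1 + d')"
    using den[of "b $ 1"] 1(2) r by auto
  have den2: "c' * b' $ 1 + d' \<noteq> 0" "a' * b' $ 1 + \<beta>' = z * (c' * b' $ 1 + d')"
    using den[of "b' $ 1"] 2(2) by auto
  have "(b $ 1 - b' $ 1) * (a' - z * c') = 0"
    using den1(2) den2(2) by algebra
  moreover have "a' - z * c' \<noteq> 0"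
  proof
    assume "a' - z * c' = 0"
    then have a': "a' = z * c'" by simp
    then have "\<beta>' = z * d'" using den1(2) by (simp add: algebra_simps)
    then show False using 2(1) a' by simp
  qed
  ultimately have b1: "b $ 1 = b' $ 1" by simp
  have "(a * d - \<beta> * c) / (c * b $ 1 + d)\<^sup>2 = (a' * d' - \<beta>' * c') / (c' * b $ 1 + d')\<^sup>2"
  proof -
    have "a * d - \<beta> * c = k\<^sup>2 * (a' * d' - \<beta>' * c')" "c * b $ 1 + d = k * (c' * b $ 1 + d')"
      unfolding k m mk by (simp_all add: algebra_simps power2_eq_square)
    then show ?thesis using k(1) by (simp add: power_mult_distrib)
  qed
  moreover have "(a' * d' - \<beta>' * c') / (c' * b $ 1 + d')\<^sup>2 \<noteq> 0"
    using 2(1) den1(1) by simp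
  ultimately have "b $ 2 = b' $ 2"
    using 1(3) 2(3) unfolding b1[symmetric] by (metis mult_left_cancel)
  with b1 show ?thesis by (simp add: vec_eq_iff forall_2)
qed

lemma pointed_iso_M04_exists:
  assumes "pointed_line 4 z v q"
  shows "\<exists>b\<in>base M04. pointed_iso 4 (sec0 M04 b) (tvec M04 b) (\<lambda>s. mark M04 s b) z v q"
proof -
  have v: "v \<noteq> 0" and q: "q 1 \<noteq> q 2" "q 1 \<noteq> q 3" "q 2 \<noteq> q 3"
    and qz: "q 1 \<noteq> Aff z" "q 2 \<noteq> Aff z" "q 3 \<noteq> Aff z"
    using assms by (auto simp: pointed_line_def labels_4 inj_on_def)
  obtain u1 w1 where 1: "q 1 = ratio u1 w1" "(u1, w1) \<noteq> (0, 0)" by (rule ratio_surj)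
  obtain u2 w2 where 2: "q 2 = ratio u2 w2" "(u2, w2) \<noteq> (0, 0)" by (rule ratio_surj)
  obtain u3 w3 where 3: "q 3 = ratio u3 w3" "(u3, w3) \<noteq> (0, 0)" by (rule ratio_surj)
  \<comment> \<open>Cramer's rule: \<open>k\<close> times the lift of \<open>q 3\<close> plus
    \<open>m\<close> times the lift of \<open>q 1\<close> is the lift of \<open>q 2\<close>, so the
    matrix with these two columns maps 1 to \<open>q 2\<close>.\<close>
  define D where "D = u3 * w1 - u1 * w3"
  define k where "k = (u2 * w1 - u1 * w2) / D"
  define m where "m = (u3 * w2 - u2 * w3) / D"
  have D: "D \<noteq> 0" using q(2) 1 3 ratio_eq_iff[OF 1(2) 3(2)] by (auto simp: D_def)
  have k: "k \<noteq> 0" using D q(1) 1 2 ratio_eq_iff[OF 1(2) 2(2)] by (auto simp: k_def)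
  have m: "m \<noteq> 0" using D q(3) 3 2 ratio_eq_iff[OF 2(2) 3(2)] by (auto simp: m_def)
  have "k * D = u2 * w1 - u1 * w2" "m * D = u3 * w2 - u2 * w3"
    using D by (simp_all add: k_def m_def)
  then have "(k * u3 + m * u1) * D = u2 * D" "(k * w3 + m * w1) * D = w2 * D"
    unfolding D_def by algebra+
  then have sum: "k * u3 + m * u1 = u2" "k * w3 + m * w1 = w2"
    using D by simp_all
  define a \<beta> c d where "a = k * u3" and "\<beta> = m * u1" and "c = k * w3" and "d = m * w1"
  have det: "a * d - \<beta> * c = k * m * D"
    by (simp add: a_def \<beta>_def c_def d_def D_def algebra_simps)
  then have det_nz: "a * d - \<beta> * c \<noteq> 0" using k m D by simp
  have acz: "a - c * z \<noteq> 0" using qz(3) 3 k ratio_Aff_iff[OF 3(2), of z] by (auto simp: a_def c_def)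
  \<comment> \<open>The preimage of \<open>z\<close>; the denominator is non-zero because
    \<infinity> goes to \<open>q 3\<close>, which differs from \<open>Aff z\<close>.\<close>
  define z0 where "z0 = (d * z - \<beta>) / (a - c * z)"
  have z0_0: "z0 \<noteq> 0"
    using qz(1) 1 m acz ratio_Aff_iff[OF 1(2), of z] by (auto simp: z0_def \<beta>_def d_def)
  have z0_1: "z0 \<noteq> 1"
  proof
    assume "z0 = 1"
    then have "d * z - \<beta> = a - c * z" using acz by (simp add: z0_def)
    then have "a + \<beta> = z * (c + d)" by (simp add: algebra_simps)
    then show False using qz(2) 2 ratio_Aff_iff[OF 2(2), of z] sum by (simp add: a_def \<beta>_def c_def d_def)
  qed
  have den: "(c * z0 + d) * (a - c * z) = a * d - \<beta> * c" "(a * z0 + \<beta>) * (a - c * z) = (a * d - \<beta> * c) * z"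
  proof -
    have z0: "z0 * (a - c * z) = d * z - \<beta>" using acz by (simp add: z0_def)
    have "(c * z0 + d) * (a - c * z) = c * (z0 * (a - c * z)) + d * (a - c * z)"
        "(a * z0 + \<beta>) * (a - c * z) = a * (z0 * (a - c * z)) + \<beta> * (a - c * z)"
      by (simp_all only: distrib_right mult.assoc)
    then show "(c * z0 + d) * (a - c * z) = a * d - \<beta> * c" "(a * z0 + \<beta>) * (a - c * z) = (a * d - \<beta> * c) * z"
      unfolding z0 by (simp_all add: algebra_simps)
  qed
  have den_nz: "c * z0 + d \<noteq> 0" using den(1) det_nz by auto
  have "(a * z0 + \<beta>) * (a - c * z) = z * (c * z0 + d) * (a - c * z)"
    using den by (simp add: mult.commute mult.left_commute)
  then have "a * z0 + \<beta> = z * (c * z0 + d)" using acz by simp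
  then have r: "ratio (a * z0 + \<beta>) (c * z0 + d) = Aff z"
    using den_nz by (simp add: ratio_def)
  \<comment> \<open>The vector \<open>v\<close> divided by the derivative of the map at
    \<open>z0\<close>.\<close>
  define v0 where "v0 = v * (c * z0 + d)\<^sup>2 / (a * d - \<beta> * c)"
  define b :: "complex^2" where "b = vector [z0, v0]"
  have b: "b $ 1 = z0" "b $ 2 = v0" by (simp_all add: b_def vector_2)
  have v0: "v0 \<noteq> 0" "(a * d - \<beta> * c) / (c * z0 + d)\<^sup>2 * v0 = v"
    using v den_nz det_nz by (simp_all add: v0_def)
  have "ratio \<beta> d = q 1" "ratio (a + \<beta>) (c + d) = q 2" "ratio a c = q 3"
    using 1(1) 2(1) 3(1) sum ratio_scale[OF m] ratio_scale[OF k] by (simp_all add: a_def \<beta>_def c_def d_def)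
  then have "pointed_iso 4 (sec0 M04 b) (tvec M04 b) (\<lambda>s. mark M04 s b) z v q"
    unfolding pointed_iso_M04 b using det_nz r v0(2) by blast
  moreover have "b \<in> base M04" using b z0_0 z0_1 v0(1) by (simp add: base_M04)
  ultimately show ?thesis by blast
qed

lemma universal_family_M04: "universal_family 4 M04"
  unfolding universal_family_def
proof (intro conjI allI impI)
  show "pointed_family 4 M04" by (rule pointed_family_M04)
  fix z v q assume "pointed_line 4 z v q"
  then show "\<exists>!b. b \<in> base M04 \<and> pointed_iso 4 (sec0 M04 b) (tvec M04 b) (\<lambda>s. mark M04 s b) z v q"
    using pointed_iso_M04_exists pointed_iso_M04_unique by blast
qed

section \<open>The Knizhnik-Zamolodchikov form\<close>

text \<open>Locally the logarithm of the modulus is the real part of a holomorphic logarithm, whose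
  derivative along \<open>q\<close> is q/p.\<close>

lemma ln_norm_derivative:
  fixes p q :: complex
  assumes p: "p \<noteq> 0"
  shows "((\<lambda>c. ln (norm (p + c * q))) has_derivative (\<lambda>h. Re (h * (q / p)))) (at 0)"
proof -
  have D: "((\<lambda>c. p + c * q) has_derivative (\<lambda>h. h * q)) (at 0)"
    by (auto intro!: derivative_eq_intros)
  have "(norm has_derivative (\<lambda>h. h \<bullet> sgn p)) (at (p + 0 * q))"
    using has_derivative_norm[OF p] by (simp add: inner_commute)
  from has_derivative_compose[OF D this]
  have "((\<lambda>c. norm (p + c * q)) has_derivative (\<lambda>h. (h * q) \<bullet> sgn p)) (at 0)" .
  then have "((\<lambda>c. ln (norm (p + c * q))) has_derivative
      (\<lambda>h. (h * q) \<bullet> sgn p * inverse (norm (p + 0 * q)))) (at 0)"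
    by (intro has_derivative_ln) (use p in auto)
  moreover have "(h * q) \<bullet> sgn p * inverse (norm (p + 0 * q)) = Re (h * (q / p))" for h
  proof -
    have "(h * q) \<bullet> sgn p * inverse (norm p) = Re ((h * q) * cnj p) / (norm p)\<^sup>2"
      using p by (simp add: inner_complex_def sgn_div_norm power2_eq_square divide_inverse algebra_simps)
    also have "\<dots> = Re ((h * q) * cnj p / complex_of_real ((norm p)\<^sup>2))"
      by (simp only: Re_divide_of_real)
    also have "(h * q) * cnj p / complex_of_real ((norm p)\<^sup>2) = h * (q / p)"
      using p unfolding complex_norm_square by (simp add: field_simps)
    finally show ?thesis by simp
  qed
  ultimately show ?thesis by simp
qed

text \<open>The differential of log(z - s) along \<beta> for a finite marked point s; 0 for the
  point at infinity, in accordance with the convention in \<open>lnd\<close>.\<close>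

definition kappa :: "complex^2 \<Rightarrow> complex^2 \<Rightarrow> nat \<Rightarrow> complex" where
  "kappa b \<beta> s = (if s = 1 then \<beta> $ 1 / b $ 1 else if s = 2 then \<beta> $ 1 / (b $ 1 - 1) else 0)"

lemma lnd_mark_derivative:
  assumes b: "b \<in> base M04" and s: "s \<in> {1, 2, 3}"
  shows "((\<lambda>c. lnd (mark M04 s b) (Aff (b $ 1 + c * \<beta> $ 1))) has_derivative
    (\<lambda>h. Re (h * kappa b \<beta> s))) (at 0)"
proof -
  have z: "b $ 1 \<noteq> 0" "b $ 1 \<noteq> 1" using b by (auto simp: base_M04)
  consider "s = 1" | "s = 2" | "s = 3" using s by auto
  then show ?thesis
  proof cases
    case 1
    have "((\<lambda>c. ln (norm (- b $ 1 + c * (- \<beta> $ 1)))) has_derivative (\<lambda>h. Re (h * ((- \<beta> $ 1) / (- b $ 1))))) (at 0)"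
      by (rule ln_norm_derivative) (use z in simp)
    moreover have "lnd (mark M04 s b) (Aff (b $ 1 + c * \<beta> $ 1)) = ln (norm (- b $ 1 + c * (- \<beta> $ 1)))" for c
      unfolding 1 mark_M04 by (simp add: algebra_simps)
    ultimately show ?thesis using 1 by (simp add: kappa_def)
  next
    case 2
    have "((\<lambda>c. ln (norm ((1 - b $ 1) + c * (- \<beta> $ 1)))) has_derivative (\<lambda>h. Re (h * ((- \<beta> $ 1) / (1 - b $ 1))))) (at 0)"
      by (rule ln_norm_derivative) (use z in simp)
    moreover have "lnd (mark M04 s b) (Aff (b $ 1 + c * \<beta> $ 1)) = ln (norm ((1 - b $ 1) + c * (- \<beta> $ 1)))" for c
      unfolding 2 mark_M04 by (simp add: algebra_simps)
    moreover have "kappa b \<beta> s = (- \<beta> $ 1) / (1 - b $ 1)"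
      using 2 minus_divide_divide[of "\<beta> $ 1" "b $ 1 - 1"] by (simp add: kappa_def)
    ultimately show ?thesis by (simp only:)
  next
    case 3
    then show ?thesis unfolding 3 mark_M04 by (simp add: kappa_def)
  qed
qed

text \<open>The marked points are fixed, so only s_0 and the tangent vector vary. The (1,0) part of
  d ln|f| is half of d log f, which turns the factor 1/(pi \<i>) of the Green function into 1/(2 pi
  \<i>).\<close>

lemma wirt_green_M04:
  fixes \<beta> :: "complex^2"
  assumes G: "green_current M04 G" and b: "b \<in> base M04" and s: "s \<in> {1, 2, 3}" "t \<in> {1, 2, 3}" "s \<noteq> t"
  defines "g \<equiv> (\<lambda>c. G (b + c *s \<beta>) (mark M04 s (b + c *s \<beta>)) (mark M04 t (b + c *s \<beta>)))"
    and "K \<equiv> \<beta> $ 2 / b $ 2 - kappa b \<beta> s - kappa b \<beta> t"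
  shows "wirt g = K / (2 * complex_of_real pi * \<i>)" and "wirtbar g = cnj K / (2 * complex_of_real pi * \<i>)"
proof -
  define f where "f = (\<lambda>c. complex_of_real (ln (norm (b $ 2 + c * \<beta> $ 2)) - lnd (mark M04 s b) (Aff (b $ 1 + c * \<beta> $ 1))
      - lnd (mark M04 t b) (Aff (b $ 1 + c * \<beta> $ 1))) * (1 / (complex_of_real pi * \<i>)))"
  have mark: "mark M04 u b' = mark M04 u b" for u b' by (simp add: M04_def)
  \<comment> \<open>|0 - 1| = 1, and the pairs involving infinity have the value 0 by
    convention.\<close>
  have zero: "lnd (mark M04 s b) (mark M04 t b) = 0"
    using s by (auto simp: M04_def)
  have "\<forall>\<^sub>F c in nhds 0. b + c *s \<beta> \<in> base M04"
    by (rule eventually_base[OF pointed_familyD(1)[OF pointed_family_M04] b])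
  then have ev: "\<forall>\<^sub>F c in nhds 0. g c = f c"
  proof eventually_elim
    case (elim c)
    have st: "s \<in> labels 4" "t \<in> labels 4" using s by (simp_all add: labels_4)
    have ne: "mark M04 s (b + c *s \<beta>) \<noteq> mark M04 t (b + c *s \<beta>)"
      using pointed_familyD(5)[OF pointed_family_M04 elim] s(3) st by (auto dest: inj_onD)
    have "green_fn M04 (b + c *s \<beta>) (mark M04 s (b + c *s \<beta>)) (mark M04 t (b + c *s \<beta>)) =
        ln (norm (b $ 2 + c * \<beta> $ 2)) - lnd (mark M04 s b) (Aff (b $ 1 + c * \<beta> $ 1))
        - lnd (mark M04 t b) (Aff (b $ 1 + c * \<beta> $ 1))"
      unfolding green_fn_def mark[of _ "b + c *s \<beta>"] zero by (simp add: sec0_M04 tvec_M04)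
    then show ?case
      using green_current_explicit[OF pointed_family_M04 G elim ne
          pointed_familyD(4)[OF pointed_family_M04 elim st(1)] pointed_familyD(4)[OF pointed_family_M04 elim st(2)]]
      by (simp add: g_def f_def)
  qed
  have b2: "b $ 2 \<noteq> 0" using b by (simp add: base_M04)
  have f: "(f has_derivative (\<lambda>h. complex_of_real (Re (h * (\<beta> $ 2 / b $ 2)) - Re (h * kappa b \<beta> s) - Re (h * kappa b \<beta> t))
      * (1 / (complex_of_real pi * \<i>)))) (at 0)"
    unfolding f_def
    by (intro has_derivative_mult_left bounded_linear.has_derivative[OF bounded_linear_of_real] has_derivative_diff
        ln_norm_derivative[OF b2] lnd_mark_derivative[OF b] s)
  have D: "Re (h * (\<beta> $ 2 / b $ 2)) - Re (h * kappa b \<beta> s) - Re (h * kappa b \<beta> t) = Re (h * K)" for h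
    by (simp add: K_def right_diff_distrib)
  have r: "complex_of_real (Re (1 * K)) - \<i> * complex_of_real (Re (\<i> * K)) = K"
    and r': "complex_of_real (Re (1 * K)) + \<i> * complex_of_real (Re (\<i> * K)) = cnj K"
    by (simp_all add: complex_eq_iff)
  have "wirt f = K / (2 * complex_of_real pi * \<i>)"
  proof (rule wirt_eqI[OF f], unfold D)
    have l: "(complex_of_real (Re (1 * K)) * c - \<i> * (complex_of_real (Re (\<i> * K)) * c)) / 2 = K * c / 2" for c
      unfolding mult.assoc[symmetric] left_diff_distrib[symmetric] r ..
    show "(complex_of_real (Re (1 * K)) * (1 / (complex_of_real pi * \<i>)) -
        \<i> * (complex_of_real (Re (\<i> * K)) * (1 / (complex_of_real pi * \<i>)))) / 2 = K / (2 * complex_of_real pi * \<i>)"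
      unfolding l by simp
  qed
  then show "wirt g = K / (2 * complex_of_real pi * \<i>)"
    using wirt_cong_nhds[OF ev] by simp
  have "wirtbar f = cnj K / (2 * complex_of_real pi * \<i>)"
  proof (rule wirtbar_eqI[OF f], unfold D)
    have l: "(complex_of_real (Re (1 * K)) * c + \<i> * (complex_of_real (Re (\<i> * K)) * c)) / 2 = cnj K * c / 2" for c
      unfolding mult.assoc[symmetric] distrib_right[symmetric] r' ..
    show "(complex_of_real (Re (1 * K)) * (1 / (complex_of_real pi * \<i>)) +
        \<i> * (complex_of_real (Re (\<i> * K)) * (1 / (complex_of_real pi * \<i>)))) / 2 = cnj K / (2 * complex_of_real pi * \<i>)"
      unfolding l by simp
  qed
  then show "wirtbar g = cnj K / (2 * complex_of_real pi * \<i>)"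
    using wirtbar_cong_nhds[OF ev] by simp
qed

section \<open>The Hodge correlator of four points\<close>

lemma nleaves_pos: "nleaves t > 0"
  by (induction t) auto

lemma ptrees_pair: "ptrees [s, t] = {PLeaf}"
proof -
  have "nleaves t = 1 \<longleftrightarrow> t = PLeaf" for t
    using nleaves_pos by (cases t) (auto simp: add_is_1 less_imp_neq[symmetric])
  then show ?thesis by (auto simp: ptrees_def)
qed

lemma Hodge_corr_not_pair:
  assumes X: "pointed_family n X" and G: "green_current X G" and u: "u \<in> {0, 1}"
    and W: "k \<noteq> 2" "W \<in> cywords n k"
  shows "cyseries_at u (Hodge_corr n X G) W b ts = 0"
proof -
  have "Z_form n X G (plane_tree t (word_of W)) (b, 1 - u, u) ts' = 0" if "t \<in> ptrees (word_of W)" for t ts'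
    by (rule Z_form_plane_tree_eq_0[OF X G _ word_of_cyword(2)[OF W(2)] _ u])
       (use that W(1) word_of_cyword(3)[OF W(2)] in \<open>auto simp: ptrees_def\<close>)
  then show ?thesis
    unfolding cyseries_at_def at_u_twistor Hodge_corr_def by simp
qed

text \<open>Two distinct letters admit no non-trivial rotation; for equal letters the form of the
  edge is 0, whatever the automorphism factor.\<close>

lemma Hodge_corr_pair:
  assumes W: "W \<in> cywords n 2" "word_of W = [s, t]"
  shows "cyseries_at u (Hodge_corr n X G) W b ts =
    (if s = t then 0 else Z_form n X G (edge_graph s t, 1, [{0, 1}]) (b, 1 - u, u) (map (\<lambda>\<beta>. (\<beta>, 0, 0)) ts))"
proof -
  have "aut_cyword W = 1" if "s \<noteq> t"
  proof -
    have "{i. i < length (word_of W) \<and> rotate i (word_of W) = word_of W} = {0}"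
      using that W(2) by (auto simp: less_Suc_eq)
    then show ?thesis by (simp add: aut_cyword_def)
  qed
  moreover have "\<exists>k. W \<in> cywords n k" using W(1) by blast
  moreover have "Z_form n X G (plane_tree PLeaf [s, t]) (b, 1 - u, u) ts' =
      (if s = t then 0 else Z_form n X G (edge_graph s t, 1, [{0, 1}]) (b, 1 - u, u) ts')" for ts'
    unfolding plane_tree_PLeaf Z_form_edge_graph by auto
  ultimately show ?thesis
    unfolding cyseries_at_def at_u_twistor Hodge_corr_def W(2) ptrees_pair
    by (simp del: One_nat_def split del: if_split) simp
qed

definition form_coeff :: "complex \<Rightarrow> (complex^2) list \<Rightarrow> complex" where
  "form_coeff K ts = (if length ts = 1 then K / (2 * complex_of_real pi * \<i>) else 0)"

text \<open>At u = 0 the operator is minus the antiholomorphic differential, and -1/(2 pi \<i>) is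
  the conjugate of 1/(2 pi \<i>). Hence the coefficients at the two ends are exactly
  conjugate.\<close>

lemma Hodge_corr_M04:
  assumes G: "green_current M04 G" and b: "b \<in> base M04" and W: "W \<in> cywords 4 2" "word_of W = [s, t]"
  shows "cyseries_at 1 (Hodge_corr 4 M04 G) W b ts = (if s = t then 0 else
      form_coeff (hd ts $ 2 / b $ 2) ts - form_coeff (kappa b (hd ts) s) ts - form_coeff (kappa b (hd ts) t) ts)" (is ?one)
    and "cyseries_at 0 (Hodge_corr 4 M04 G) W b ts = (if s = t then 0 else
      cnj (form_coeff (hd ts $ 2 / b $ 2) ts) - cnj (form_coeff (kappa b (hd ts) s) ts)
      - cnj (form_coeff (kappa b (hd ts) t) ts))" (is ?zero)
proof -
  have s: "s \<in> {1, 2, 3}" "t \<in> {1, 2, 3}"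
    using word_of_cyword(2)[OF W(1)] W(2) by (auto simp: labels_4)
  note wirt = wirt_green_M04[OF G b s]
  show ?one
    using b unfolding Hodge_corr_pair[OF W] Z_form_edge_graph
    by (cases ts) (auto simp: Let_def wirt(1) form_coeff_def diff_divide_distrib)
  show ?zero
    using b unfolding Hodge_corr_pair[OF W] Z_form_edge_graph
    by (cases ts) (auto simp: Let_def wirt(2) form_coeff_def diff_divide_distrib)
qed

lemma omega_KZ_eq:
  "omega_KZ b ts = nc_add (nc_scale (form_coeff (kappa b (hd ts) 1) ts) (nc_letter False))
    (nc_scale (form_coeff (kappa b (hd ts) 2) ts) (nc_letter True))"
  by (auto simp: omega_KZ_def form_coeff_def kappa_def nc_add_def nc_scale_def fun_eq_iff algebra_simps)

lemma omega_KZ_bar_eq: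
  "omega_KZ_bar b ts = nc_add (nc_scale (cnj (form_coeff (kappa b (hd ts) 1) ts)) (nc_letter False))
    (nc_scale (cnj (form_coeff (kappa b (hd ts) 2) ts)) (nc_letter True))"
  by (auto simp: omega_KZ_bar_def omega_KZ_eq nc_add_def nc_scale_def nc_letter_def fun_eq_iff)

theorem proposition6p3p1:
  fixes n :: nat and X :: "('b::finite) family" and G :: "'b green" and G4 :: "2 green"
  assumes "n \<ge> 3"
    and "universal_family n X" and "green_current X G"
    and "green_current M04 G4"
  shows
    "(\<forall>u\<in>{0, 1}.
        series_eq n (series_at u (S_eff n X G)) (series_at u (S_tree n X G)) \<and>
        to_cyseries n (series_at u (S_tree n X G) 0) = cyseries_at u (Hodge_corr n X G)) \<and>
     universal_family 4 M04 \<and>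
     (\<forall>u\<in>{0, 1}.
        series_eq 4 (series_at u (S_eff 4 M04 G4)) (series_at u (S_tree 4 M04 G4)) \<and>
        to_cyseries 4 (series_at u (S_tree 4 M04 G4) 0) = cyseries_at u (Hodge_corr 4 M04 G4)) \<and>
     (\<forall>b\<in>base M04. \<forall>ts.
        special_derivation_of (\<lambda>W. cyseries_at 1 (Hodge_corr 4 M04 G4) W b ts)
          (\<lambda>Y. nc_scale (-1) (Id_ad omega_KZ b ts Y)) \<and>
        special_derivation_of (\<lambda>W. cyseries_at 0 (Hodge_corr 4 M04 G4) W b ts)
          (\<lambda>Y. nc_scale (-1) (Id_ad omega_KZ_bar b ts Y)) \<and>
        Id_ad omega_KZ b ts \<in> special_derivations)"
proof (intro conjI ballI allI)
  have X: "pointed_family n X" using assms(2) by (simp add: universal_family_def)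
  note M = pointed_family_M04
  show "universal_family 4 M04" by (rule universal_family_M04)
  show "series_eq n (series_at u (S_eff n X G)) (series_at u (S_tree n X G))"
    "to_cyseries n (series_at u (S_tree n X G) 0) = cyseries_at u (Hodge_corr n X G)"
    "series_eq 4 (series_at u (S_eff 4 M04 G4)) (series_at u (S_tree 4 M04 G4))"
    "to_cyseries 4 (series_at u (S_tree 4 M04 G4) 0) = cyseries_at u (Hodge_corr 4 M04 G4)"
    if "u \<in> {0, 1}" for u
    using series_eq_S_tree[OF X assms(3) that] to_cyseries_S_tree[OF X assms(3) that]
      series_eq_S_tree[OF M assms(4) that] to_cyseries_S_tree[OF M assms(4) that] by blast+
  fix b :: "complex^2" and ts :: "(complex^2) list"
  assume b: "b \<in> base M04"
  have u: "1 \<in> {0, 1::complex}" "0 \<in> {0, 1::complex}" by auto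
  \<comment> \<open>The coefficients at the marked points; the constant \<open>A\<close> supplied
    below is the logarithmic differential of the tangent vector, which the bracket with X_s
    removes.\<close>
  let ?B = "\<lambda>s. form_coeff (kappa b (hd ts) s) ts"
  show "special_derivation_of (\<lambda>W. cyseries_at 1 (Hodge_corr 4 M04 G4) W b ts)
      (\<lambda>Y. nc_scale (-1) (Id_ad omega_KZ b ts Y))"
    unfolding Id_ad_def
  proof (rule special_derivation_of_pairs[where B = ?B and A = "form_coeff (hd ts $ 2 / b $ 2) ts"])
    show "cyseries_at 1 (Hodge_corr 4 M04 G4) W b ts = 0" if "k \<noteq> 2" "W \<in> cywords 4 k" for k W
      by (rule Hodge_corr_not_pair[OF M assms(4) u(1) that])
    show "?B 3 = 0" by (simp add: kappa_def form_coeff_def)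
  qed (rule Hodge_corr_M04[OF assms(4) b] omega_KZ_eq; assumption?)+
  show "special_derivation_of (\<lambda>W. cyseries_at 0 (Hodge_corr 4 M04 G4) W b ts)
      (\<lambda>Y. nc_scale (-1) (Id_ad omega_KZ_bar b ts Y))"
    unfolding Id_ad_def
  proof (rule special_derivation_of_pairs[where B = "\<lambda>s. cnj (?B s)" and A = "cnj (form_coeff (hd ts $ 2 / b $ 2) ts)"])
    show "cyseries_at 0 (Hodge_corr 4 M04 G4) W b ts = 0" if "k \<noteq> 2" "W \<in> cywords 4 k" for k W
      by (rule Hodge_corr_not_pair[OF M assms(4) u(2) that])
    show "cnj (?B 3) = 0" by (simp add: kappa_def form_coeff_def)
  qed (rule Hodge_corr_M04[OF assms(4) b] omega_KZ_bar_eq; assumption?)+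
  have "omega_KZ b ts \<in> free_lie" unfolding omega_KZ_eq by (intro free_lie.intros)
  then show "Id_ad omega_KZ b ts \<in> special_derivations"
    unfolding Id_ad_def by (rule ad_special)
qed

end
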